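(* Let $M$ be a $2$-manifold and $\gamma:[0,\varepsilon)\to M$ a smooth regular curve starting from an intrinsic cross cap singularity $p\in M$ (that is, $\gamma(0)=p$) of an admissible metric $d\sigma^2$ on $M$. Then the geodesic curvature measure $\kappa_g\,ds$ is a continuous $1$-form on $[0,\varepsilon)$, where $ds$ is the arc-length measure with respect to $d\sigma^2$.
   Context: **Metrics and singular points.** $d\sigma^2=\langle\cdot,\cdot\rangle$ denotes a smooth positive semi-definite symmetric $(0,2)$-tensor field on $M$ (called a positive semi-definite metric). A point $q\in M$ is a singular point of $d\sigma^2$ if $(d\sigma^2)_q$ is degenerate. The null space at $q$ is $\mathcal{N}_q:=\{\mathbf{v}\in T_qM : \langle \mathbf{v},\mathbf{w}\rangle=0 \text{ for all } \mathbf{w}\in T_qM\}$. **Admissible metrics.** For smooth vector fields $\mathbf{X},\mathbf{Y},\mathbf{Z}$ on $M$, the Kossowski pseudo-connection is $$\Gamma(\mathbf{X},\mathbf{Y},\mathbf{Z}):=\tfrac12\big(\mathbf{X}\langle\mathbf{Y},\mathbf{Z}\rangle+\mathbf{Y}\langle\mathbf{Z},\mathbf{X}\rangle-\mathbf{Z}\langle\mathbf{X},\mathbf{Y}\rangle+\langle[\mathbf{X},\mathbf{Y}],\mathbf{Z}\rangle-\langle[\mathbf{Y},\mathbf{Z}],\mathbf{X}\rangle+\langle[\mathbf{Z},\mathbf{X}],\mathbf{Y}\rangle\big).$$ At a singular point $q$ it induces a well-defined trilinear map $\widehat\Gamma_q:T_qM\times T_qM\times\mathcal{N}_q\to\mathbb{R}$,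 $\widehat\Gamma_q(\mathbf{v}_1,\mathbf{v}_2,\mathbf{v}_3):=\Gamma(\mathbf{V}_1,\mathbf{V}_2,\mathbf{V}_3)(q)$, where $\mathbf{V}_j$ are any smooth vector fields with $(\mathbf{V}_j)_q=\mathbf{v}_j$. The singular point $q$ is admissible if $\widehat\Gamma_q=0$. The metric $d\sigma^2$ is admissible if all its singular points are admissible. **Intrinsic cross cap singularities.** Let $d\sigma^2$ be admissible, $q$ a singular point, $(u,v)$ local coordinates centered at $q$, and write $d\sigma^2=E\,du\otimes du+F\,du\otimes dv+F\,dv\otimes du+G\,dv\otimes dv$, $\lambda:=EG-F^2\ge 0$. The point $q$ is an intrinsic cross cap singularity of $d\sigma^2$ if $\det\begin{pmatrix}\lambda_{uu}(q)&\lambda_{uv}(q)\\ \lambda_{uv}(q)&\lambda_{vv}(q)\end{pmatrix}\neq 0$. This does not depend on the choice of local coordinates. **Geodesic curvature measure.** A regular curve is one with $\dot\gamma(t)\neq 0$ in $T_{\gamma(t)}M$ for every $t$ (including $t=0$). Write $|\xi|:=\sqrt{\langle\xi,\xi\rangle}$ and $ds:=|\dot\gamma(t)|\,dt$. The geodesic curvature of $\gamma$ for $t>0$ is $$\kappa_g(t):=\frac{\langle\nabla_{\dot\gamma(t)}\dot\gamma(t),\mathbf{n}(t)\rangle}{|\dot\gamma(t)|^2},$$ where $\nabla$ is the Levi-Civita connection of $d\sigma^2$ and, writing $\gamma(t)=(u(t),v(t))$ in local coordinates, $$\mathbf{n}(t)=\frac{-(\dot uF+\dot vG)\,\partial_u+(\dot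 uE+\dot vF)\,\partial_v}{\sqrt{EG-F^2}\,\sqrt{\dot u^2E+2\dot u\dot vF+\dot v^2G}}$$ is the unit normal vector field of $\gamma$, with $E,F,G$ evaluated at $\gamma(t)$ (these expressions are formed where $d\sigma^2$ is non-degenerate). The geodesic curvature measure is the $1$-form $\kappa_g\,ds=\kappa_g(t)\,|\dot\gamma(t)|\,dt$. Since $\gamma(0)=p$ is a singular point, continuity at $t=0$ means that the coefficient $\kappa_g(t)\,|\dot\gamma(t)|$ extends continuously to $t=0$. *)

theory Defs
  imports "HOL-Analysis.Analysis"
begin

(* The set S is always an open set or a relatively open part of an interval
   [0, eps), so that the derivative within S is unique; at the end point 0 it is the one-sided
   derivative. *)

primrec Ck_on :: "nat \<Rightarrow> 'a::euclidean_space set \<Rightarrow> ('a \<Rightarrow> 'b::real_normed_vector) \<Rightarrow> bool" where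
  "Ck_on 0 S f \<longleftrightarrow> continuous_on S f"
| "Ck_on (Suc k) S f \<longleftrightarrow> f differentiable_on S \<and>
     (\<forall>v. Ck_on k S (\<lambda>x. frechet_derivative f (at x within S) v))"

definition smooth_on :: "'a::euclidean_space set \<Rightarrow> ('a \<Rightarrow> 'b::real_normed_vector) \<Rightarrow> bool" where
  "smooth_on S f \<longleftrightarrow> (\<forall>k. Ck_on k S f)"

definition partial_deriv :: "2 \<Rightarrow> (real^2 \<Rightarrow> real) \<Rightarrow> real^2 \<Rightarrow> real" where
  "partial_deriv i f x = frechet_derivative f (at x) (axis i 1)"


section \<open>Smooth surfaces\<close>

(* A chart is a pair of its domain and its coordinate map; the values of the coordinate map
   outside the domain are irrelevant. *)

type_synonym 'm chart = "'m set \<times> ('m \<Rightarrow> real^2)"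

abbreviation cdom :: "'m chart \<Rightarrow> 'm set" where "cdom c \<equiv> fst c"
abbreviation cmap :: "'m chart \<Rightarrow> 'm \<Rightarrow> real^2" where "cmap c \<equiv> snd c"
abbreviation cimg :: "'m chart \<Rightarrow> (real^2) set" where "cimg c \<equiv> cmap c ` cdom c"
abbreviation cinv :: "'m chart \<Rightarrow> real^2 \<Rightarrow> 'm" where "cinv c \<equiv> inv_into (cdom c) (cmap c)"

definition is_chart :: "'m::topological_space chart \<Rightarrow> bool" where
  "is_chart c \<longleftrightarrow> open (cdom c) \<and> open (cimg c) \<and>
     homeomorphism (cdom c) (cimg c) (cmap c) (cinv c)"

definition transition :: "'m chart \<Rightarrow> 'm chart \<Rightarrow> real^2 \<Rightarrow> real^2" where
  "transition c d = cmap d \<circ> cinv c"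

definition compatible :: "'m chart \<Rightarrow> 'm chart \<Rightarrow> bool" where
  "compatible c d \<longleftrightarrow>
     smooth_on (cmap c ` (cdom c \<inter> cdom d)) (transition c d) \<and>
     smooth_on (cmap d ` (cdom c \<inter> cdom d)) (transition d c)"

(* A smooth 2-manifold is a Hausdorff, second countable type 'm together with a maximal smooth
   atlas A; the members of A are exactly the local coordinate systems. *)

definition smooth_structure :: "'m::{t2_space,second_countable_topology} chart set \<Rightarrow> bool" where
  "smooth_structure A \<longleftrightarrow>
     (\<forall>c\<in>A. is_chart c) \<and> (\<Union>c\<in>A. cdom c) = UNIV \<and>
     (\<forall>c\<in>A. \<forall>d\<in>A. compatible c d) \<and>
     (\<forall>c. is_chart c \<and> (\<forall>d\<in>A. compatible c d) \<longrightarrow> c \<in> A)"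


section \<open>Tangent vectors and vector fields\<close>

(* The tangent space at q is real^2: a tangent vector is represented by its components with
   respect to one preferred chart around q, chosen once and for all.  Components with respect to
   another chart are obtained by the derivative of the transition map. *)

definition chart_at :: "'m chart set \<Rightarrow> 'm \<Rightarrow> 'm chart" where
  "chart_at A q = (SOME c. c \<in> A \<and> q \<in> cdom c)"

definition components :: "'m chart set \<Rightarrow> 'm chart \<Rightarrow> 'm \<Rightarrow> real^2 \<Rightarrow> real^2" where
  "components A c q v =
     frechet_derivative (transition (chart_at A q) c) (at (cmap (chart_at A q) q)) v"

definition tangent_vector :: "'m chart set \<Rightarrow> 'm chart \<Rightarrow> 'm \<Rightarrow> real^2 \<Rightarrow> real^2" where
  "tangent_vector A c q a =
     frechet_derivative (transition c (chart_at A q)) (at (cmap c q)) a"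

definition coord_vector :: "'m chart set \<Rightarrow> 'm chart \<Rightarrow> 2 \<Rightarrow> 'm \<Rightarrow> real^2" where
  "coord_vector A c i q = tangent_vector A c q (axis i 1)"

definition local_rep :: "'m chart set \<Rightarrow> 'm chart \<Rightarrow> ('m \<Rightarrow> real^2) \<Rightarrow> real^2 \<Rightarrow> real^2" where
  "local_rep A c X x = components A c (cinv c x) (X (cinv c x))"

definition smooth_vector_field :: "'m chart set \<Rightarrow> ('m \<Rightarrow> real^2) \<Rightarrow> bool" where
  "smooth_vector_field A X \<longleftrightarrow> (\<forall>c\<in>A. smooth_on (cimg c) (local_rep A c X))"

definition dir_deriv :: "'m chart set \<Rightarrow> ('m \<Rightarrow> real^2) \<Rightarrow> ('m \<Rightarrow> real) \<Rightarrow> 'm \<Rightarrow> real" where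
  "dir_deriv A X f q =
     frechet_derivative (f \<circ> cinv (chart_at A q)) (at (cmap (chart_at A q) q)) (X q)"

definition lie_bracket ::
  "'m chart set \<Rightarrow> ('m \<Rightarrow> real^2) \<Rightarrow> ('m \<Rightarrow> real^2) \<Rightarrow> 'm \<Rightarrow> real^2" where
  "lie_bracket A X Y q =
     (let c = chart_at A q; x = cmap c q in
        frechet_derivative (local_rep A c Y) (at x) (X q) -
        frechet_derivative (local_rep A c X) (at x) (Y q))"


section \<open>Positive semi-definite metrics\<close>

type_synonym 'm metric_tensor = "'m \<Rightarrow> real^2 \<Rightarrow> real^2 \<Rightarrow> real"

definition coeff :: "'m chart set \<Rightarrow> 'm metric_tensor \<Rightarrow> 'm chart \<Rightarrow> 2 \<Rightarrow> 2 \<Rightarrow> real^2 \<Rightarrow> real" where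
  "coeff A g c i j x =
     (let q = cinv c x in g q (coord_vector A c i q) (coord_vector A c j q))"

definition psd_metric :: "'m chart set \<Rightarrow> 'm metric_tensor \<Rightarrow> bool" where
  "psd_metric A g \<longleftrightarrow>
     (\<forall>q. bilinear (g q) \<and> (\<forall>v w. g q v w = g q w v) \<and> (\<forall>v. 0 \<le> g q v v)) \<and>
     (\<forall>c\<in>A. \<forall>i j. smooth_on (cimg c) (coeff A g c i j))"

definition null_space :: "'m metric_tensor \<Rightarrow> 'm \<Rightarrow> (real^2) set" where
  "null_space g q = {v. \<forall>w. g q v w = 0}"

definition singular_point :: "'m metric_tensor \<Rightarrow> 'm \<Rightarrow> bool" where
  "singular_point g q \<longleftrightarrow> null_space g q \<noteq> {0}"

definition inner_fields ::
  "'m metric_tensor \<Rightarrow> ('m \<Rightarrow> real^2) \<Rightarrow> ('m \<Rightarrow> real^2) \<Rightarrow> 'm \<Rightarrow> real" where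
  "inner_fields g X Y q = g q (X q) (Y q)"

definition kossowski :: "'m chart set \<Rightarrow> 'm metric_tensor \<Rightarrow>
    ('m \<Rightarrow> real^2) \<Rightarrow> ('m \<Rightarrow> real^2) \<Rightarrow> ('m \<Rightarrow> real^2) \<Rightarrow> 'm \<Rightarrow> real" where
  "kossowski A g X Y Z q = 1/2 *
     (dir_deriv A X (inner_fields g Y Z) q
    + dir_deriv A Y (inner_fields g Z X) q
    - dir_deriv A Z (inner_fields g X Y) q
    + inner_fields g (lie_bracket A X Y) Z q
    - inner_fields g (lie_bracket A Y Z) X q
    + inner_fields g (lie_bracket A Z X) Y q)"

(* The value of the induced trilinear map at (v1, v2, v3) is kossowski at q of any smooth
   vector fields extending v1, v2, v3; so its vanishing is stated for all such extensions. *)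

definition admissible_point :: "'m chart set \<Rightarrow> 'm metric_tensor \<Rightarrow> 'm \<Rightarrow> bool" where
  "admissible_point A g q \<longleftrightarrow>
     (\<forall>v1 v2. \<forall>v3\<in>null_space g q. \<forall>V1 V2 V3.
        smooth_vector_field A V1 \<and> smooth_vector_field A V2 \<and> smooth_vector_field A V3 \<and>
        V1 q = v1 \<and> V2 q = v2 \<and> V3 q = v3 \<longrightarrow> kossowski A g V1 V2 V3 q = 0)"

definition admissible_metric :: "'m chart set \<Rightarrow> 'm metric_tensor \<Rightarrow> bool" where
  "admissible_metric A g \<longleftrightarrow> psd_metric A g \<and> (\<forall>q. singular_point g q \<longrightarrow> admissible_point A g q)"

definition lam :: "'m chart set \<Rightarrow> 'm metric_tensor \<Rightarrow> 'm chart \<Rightarrow> real^2 \<Rightarrow> real" where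
  "lam A g c x = coeff A g c 1 1 x * coeff A g c 2 2 x - (coeff A g c 1 2 x)\<^sup>2"

(* The Hessian condition does not depend on the centered chart; it is required for one of them. *)

definition intrinsic_cross_cap :: "'m chart set \<Rightarrow> 'm metric_tensor \<Rightarrow> 'm \<Rightarrow> bool" where
  "intrinsic_cross_cap A g q \<longleftrightarrow> singular_point g q \<and>
     (\<exists>c\<in>A. q \<in> cdom c \<and> cmap c q = 0 \<and>
        (let l = lam A g c;
             luu = partial_deriv 1 (partial_deriv 1 l) 0;
             luv = partial_deriv 2 (partial_deriv 1 l) 0;
             lvv = partial_deriv 2 (partial_deriv 2 l) 0
         in det (vector [vector [luu, luv], vector [luv, lvv]] :: real^2^2) \<noteq> 0))"


section \<open>Curves and geodesic curvature\<close>

(* The parameter interval I is [0, eps). *)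

definition smooth_curve ::
  "'m::topological_space chart set \<Rightarrow> real set \<Rightarrow> (real \<Rightarrow> 'm) \<Rightarrow> bool" where
  "smooth_curve A I \<gamma> \<longleftrightarrow> continuous_on I \<gamma> \<and>
     (\<forall>c\<in>A. smooth_on (I \<inter> \<gamma> -` cdom c) (cmap c \<circ> \<gamma>))"

definition coord_velocity :: "'m chart \<Rightarrow> real set \<Rightarrow> (real \<Rightarrow> 'm) \<Rightarrow> real \<Rightarrow> real^2" where
  "coord_velocity c I \<gamma> t = vector_derivative (cmap c \<circ> \<gamma>) (at t within I)"

definition velocity :: "'m chart set \<Rightarrow> real set \<Rightarrow> (real \<Rightarrow> 'm) \<Rightarrow> real \<Rightarrow> real^2" where
  "velocity A I \<gamma> t = coord_velocity (chart_at A (\<gamma> t)) I \<gamma> t"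

definition regular_curve :: "'m chart set \<Rightarrow> real set \<Rightarrow> (real \<Rightarrow> 'm) \<Rightarrow> bool" where
  "regular_curve A I \<gamma> \<longleftrightarrow> (\<forall>t\<in>I. velocity A I \<gamma> t \<noteq> 0)"

definition speed :: "'m chart set \<Rightarrow> 'm metric_tensor \<Rightarrow> real set \<Rightarrow> (real \<Rightarrow> 'm) \<Rightarrow> real \<Rightarrow> real" where
  "speed A g I \<gamma> t = sqrt (g (\<gamma> t) (velocity A I \<gamma> t) (velocity A I \<gamma> t))"

definition christoffel ::
  "'m chart set \<Rightarrow> 'm metric_tensor \<Rightarrow> 'm chart \<Rightarrow> 2 \<Rightarrow> 2 \<Rightarrow> 2 \<Rightarrow> real^2 \<Rightarrow> real" where
  "christoffel A g c k i j x = 1/2 *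
     (\<Sum>l\<in>UNIV. matrix_inv (\<chi> a b. coeff A g c a b x) $ k $ l *
        (partial_deriv i (coeff A g c j l) x + partial_deriv j (coeff A g c i l) x
         - partial_deriv l (coeff A g c i j) x))"

(* The covariant derivative of the velocity along the curve for the Levi-Civita connection,
   in the local coordinates c (meaningful at non-singular points). *)

definition acceleration :: "'m chart set \<Rightarrow> 'm metric_tensor \<Rightarrow> 'm chart \<Rightarrow> real set \<Rightarrow>
    (real \<Rightarrow> 'm) \<Rightarrow> real \<Rightarrow> real^2" where
  "acceleration A g c I \<gamma> t =
     (let w = coord_velocity c I \<gamma>; x = cmap c (\<gamma> t) in
      tangent_vector A c (\<gamma> t)
        (\<chi> k. vector_derivative w (at t within I) $ k
           + (\<Sum>i\<in>UNIV. \<Sum>j\<in>UNIV. christoffel A g c k i j x * w t $ i * w t $ j)))"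

(* The sign of the unit normal is fixed by the orientation of the local coordinates c. *)

definition unit_normal :: "'m chart set \<Rightarrow> 'm metric_tensor \<Rightarrow> 'm chart \<Rightarrow> real set \<Rightarrow>
    (real \<Rightarrow> 'm) \<Rightarrow> real \<Rightarrow> real^2" where
  "unit_normal A g c I \<gamma> t =
     (let x = cmap c (\<gamma> t);
          E = coeff A g c 1 1 x; F = coeff A g c 1 2 x; G = coeff A g c 2 2 x;
          u' = coord_velocity c I \<gamma> t $ 1; v' = coord_velocity c I \<gamma> t $ 2
      in (1 / (sqrt (E * G - F\<^sup>2) * sqrt (u'\<^sup>2 * E + 2 * u' * v' * F + v'\<^sup>2 * G))) *\<^sub>R
         (- (u' * F + v' * G) *\<^sub>R coord_vector A c 1 (\<gamma> t)
          + (u' * E + v' * F) *\<^sub>R coord_vector A c 2 (\<gamma> t)))"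

definition geodesic_curvature :: "'m chart set \<Rightarrow> 'm metric_tensor \<Rightarrow> 'm chart \<Rightarrow> real set \<Rightarrow>
    (real \<Rightarrow> 'm) \<Rightarrow> real \<Rightarrow> real" where
  "geodesic_curvature A g c I \<gamma> t =
     g (\<gamma> t) (acceleration A g c I \<gamma> t) (unit_normal A g c I \<gamma> t) / (speed A g I \<gamma> t)\<^sup>2"

(* A choice C t of local coordinates around each point of the curve, consistently oriented along
   the curve.  It is needed because a curve need not lie in one chart and the manifold need not be
   oriented; if the curve lies in one chart c, then the constant choice c is admitted. *)

definition coherent_charts :: "'m chart set \<Rightarrow> real set \<Rightarrow> (real \<Rightarrow> 'm) \<Rightarrow> (real \<Rightarrow> 'm chart) \<Rightarrow> bool" where
  "coherent_charts A I \<gamma> C \<longleftrightarrow>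
     (\<forall>t\<in>I. C t \<in> A \<and> \<gamma> t \<in> cdom (C t) \<and>
        (\<forall>\<^sub>F s in at t within I. \<gamma> s \<in> cdom (C t) \<and>
           0 < det (matrix (frechet_derivative (transition (C s) (C t)) (at (cmap (C s) (\<gamma> s)))))))"

(* The coefficient of dt in the 1-form kappa_g ds. *)

definition geodesic_curvature_measure :: "'m chart set \<Rightarrow> 'm metric_tensor \<Rightarrow> (real \<Rightarrow> 'm chart) \<Rightarrow>
    real set \<Rightarrow> (real \<Rightarrow> 'm) \<Rightarrow> real \<Rightarrow> real" where
  "geodesic_curvature_measure A g C I \<gamma> t = geodesic_curvature A g (C t) I \<gamma> t * speed A g I \<gamma> t"

end

theory Submission
  imports Defs
begin

text \<open>Write \<open>E, F, G\<close> for the metric coefficients in a chart, \<open>\<lambda> = EG - F\<^sup>2\<close>, and \<open>(u, v)\<close> for the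
coordinate velocity of the curve. The coefficient of \<open>dt\<close> in the curvature measure looks badly
singular at the cross cap: it is a quotient whose denominator \<open>\<surd>\<lambda> |\<gamma>'|\<^sup>2\<close> vanishes there to order
one or, if the initial velocity is a null vector, to order three. The idea that avoids Taylor
expansions of the numerator is to compare the velocity with an
orthonormal frame, the first vector of which is proportional to \<open>\<partial>\<^sub>u\<close>. With
\<open>X = E u + F v\<close> and \<open>Y = \<surd>\<lambda> v\<close>, the velocity has direction \<open>(X, Y)\<close> in this frame, and the curvature
measure is the derivative of the direction angle plus the connection form of the frame:

  \<open>\<kappa>\<^sub>g |\<gamma>'| = (X Y' - Y X') / (X\<^sup>2 + Y\<^sup>2) + \<Gamma>(\<gamma>', \<partial>\<^sub>u, E \<partial>\<^sub>v - F \<partial>\<^sub>u) / (E \<surd>\<lambda>)\<close>.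

Both summands converge at the cross cap. Since \<open>\<lambda> \<ge> 0\<close> vanishes there, its gradient vanishes, and its
nondegenerate Hessian is positive definite; so \<open>\<lambda>(\<gamma>(t)) = t\<^sup>2 h(t)\<close> with \<open>h(0) > 0\<close>, and \<open>\<surd>\<lambda> = t \<surd>h\<close>
(in particular the curve leaves the singular set at once). The vector \<open>E \<partial>\<^sub>v - F \<partial>\<^sub>u\<close> is a null
vector at the cross cap, so admissibility makes the numerator of the second summand vanish there, and
its quotient by \<open>t\<close> converges. In the first summand, \<open>Y = t \<surd>h v\<close>; either \<open>X(0) \<noteq> 0\<close>, or \<open>X\<close> is divisible
by \<open>t\<close> and the angle of \<open>(X, Y)\<close> is the angle of \<open>(X/t, \<surd>h v)\<close>, where now \<open>v(0) \<noteq> 0\<close>. In both cases the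
angle is a \<open>C\<^sup>1\<close> function up to \<open>t = 0\<close>. The formula needs \<open>E \<noteq> 0\<close> at the cross cap. If \<open>E\<close> vanishes
there, then \<open>G\<close> does not, because for \<open>E = F = G = 0\<close> the Hessian of \<open>\<lambda>\<close> would be \<open>-2 dF \<otimes> dF\<close>, which has
rank at most one; exchanging \<open>u\<close> and \<open>v\<close> then reduces to the first case. This analysis is
\<open>scalar_curvature_converges\<close> and \<open>curvature_density_converges\<close>.

Three further ingredients connect it with the surface. The covector
\<open>n \<mapsto> \<langle>\<nabla>\<gamma>', n\<rangle> = \<langle>x'', n\<rangle> + \<Gamma>(x', x', n)\<close> involves no inverse of the metric and is tensorial, because the
second derivatives of a coordinate change are symmetric; hence the curvature measure changes at most
by the sign of the Jacobian under a change of charts (\<open>curvature_density_transform\<close>). Admissibility,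
which speaks about global vector fields, becomes a condition on the Christoffel symbols of the first
kind in one chart by cutting off coordinate fields with bump functions, and in every chart by the
transformation law (\<open>admissible_first_kind\<close>). Finally, the measure at \<open>t\<close>, formed in the chart \<open>C t\<close>, may be
formed in one fixed chart near each parameter because the charts are consistently oriented
(\<open>curvature_measure_eventually_eq\<close>).\<close>

section \<open>Calculus on sets with unique derivatives\<close>

text \<open>The condition under which derivatives within a set are unique: every point of the set can be
approached inside the set along each coordinate direction. It covers open sets and intervals
\<open>{0..<\<delta>}\<close> alike, so that the calculus below serves both charts and curves with an initial point.\<close>

definition accessible :: "'a::euclidean_space set \<Rightarrow> bool" where
  "accessible S \<longleftrightarrow> (\<forall>x\<in>S. \<forall>i\<in>Basis. \<forall>e>0. \<exists>d. 0 < \<bar>d\<bar> \<and> \<bar>d\<bar> < e \<and> x + d *\<^sub>R i \<in> S)"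

lemma accessible_open:
  fixes S :: "'a::euclidean_space set"
  assumes "open S" shows "accessible S"
  unfolding accessible_def
proof (intro ballI allI impI)
  fix x i :: 'a and e :: real assume x: "x \<in> S" and i: "i \<in> Basis" and e: "e > 0"
  obtain r where r: "r > 0" "ball x r \<subseteq> S" using assms x openE by blast
  define d where "d = min e r / 2"
  have "d > 0" "d < e" "d < r" using e r by (auto simp: d_def min_def)
  moreover have "x + d *\<^sub>R i \<in> ball x r"
    using \<open>d > 0\<close> \<open>d < r\<close> i by (simp add: dist_norm)
  ultimately show "\<exists>d. 0 < \<bar>d\<bar> \<and> \<bar>d\<bar> < e \<and> x + d *\<^sub>R i \<in> S"
    using r by (intro exI[of _ d]) auto
qed

lemma accessible_limpt:
  fixes S :: "real set"
  assumes "\<And>x. x \<in> S \<Longrightarrow> x islimpt S" shows "accessible S"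
  unfolding accessible_def
proof (intro ballI allI impI)
  fix x i e :: real assume x: "x \<in> S" and i: "i \<in> Basis" and e: "e > 0"
  obtain y where "y \<in> S" "y \<noteq> x" "dist y x < e"
    using assms[OF x] e unfolding islimpt_approachable by blast
  then show "\<exists>d. 0 < \<bar>d\<bar> \<and> \<bar>d\<bar> < e \<and> x + d *\<^sub>R i \<in> S"
    using i by (intro exI[of _ "y - x"]) (auto simp: dist_real_def)
qed

lemma frechet_derivative_within_eqI:
  assumes "accessible S" "x \<in> S" "(f has_derivative f') (at x within S)"
  shows "frechet_derivative f (at x within S) = f'"
proof (rule frechet_derivative_unique_within[OF _ assms(3)])
  show "(f has_derivative frechet_derivative f (at x within S)) (at x within S)"
    using assms(3) frechet_derivative_works differentiable_def by blast
  show "\<exists>d. 0 < \<bar>d\<bar> \<and> \<bar>d\<bar> < e \<and> x + d *\<^sub>R i \<in> S" if "i \<in> Basis" "e > 0" for i e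
    using assms(1,2) that unfolding accessible_def by blast
qed

lemma frechet_derivative_within_cong:
  assumes "x \<in> S" "\<And>y. y \<in> S \<Longrightarrow> f y = g y"
  shows "frechet_derivative f (at x within S) = frechet_derivative g (at x within S)"
proof -
  have "(f has_derivative D) (at x within S) \<longleftrightarrow> (g has_derivative D) (at x within S)" for D
    using assms by (metis has_derivative_transform)
  then show ?thesis by (simp add: frechet_derivative_def)
qed

lemma Ck_on_cong:
  assumes "\<And>x. x \<in> S \<Longrightarrow> f x = g x"
  shows "Ck_on k S f \<longleftrightarrow> Ck_on k S g"
  using assms
proof (induction k arbitrary: f g)
  case 0 then show ?case by (simp cong: continuous_on_cong)
next
  case (Suc k)
  have "f differentiable_on S \<longleftrightarrow> g differentiable_on S"
    unfolding differentiable_on_def differentiable_def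
    using Suc.prems by (metis has_derivative_transform)
  moreover have "Ck_on k S (\<lambda>x. frechet_derivative f (at x within S) v) =
      Ck_on k S (\<lambda>x. frechet_derivative g (at x within S) v)" for v
    by (rule Suc.IH) (metis frechet_derivative_within_cong Suc.prems)
  ultimately show ?case by simp
qed

lemma Ck_on_SucD: "Ck_on (Suc k) S f \<Longrightarrow> Ck_on k S f"
proof (induction k arbitrary: f)
  case 0 then show ?case by (simp add: differentiable_imp_continuous_on)
next
  case (Suc k)
  then show ?case unfolding Ck_on.simps(2)[of "Suc k"] Ck_on.simps(2)[of k] by blast
qed

lemma Ck_on_has_derivative:
  assumes "Ck_on (Suc k) S f" "x \<in> S"
  shows "(f has_derivative frechet_derivative f (at x within S)) (at x within S)"
  using assms frechet_derivative_works unfolding Ck_on.simps differentiable_on_def by blast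

text \<open>With unique derivatives, any family of derivatives may replace the one chosen by
\<open>frechet_derivative\<close>.\<close>

lemma Ck_on_SucI:
  assumes "accessible S" "\<And>x. x \<in> S \<Longrightarrow> (f has_derivative f' x) (at x within S)"
    and "\<And>v. Ck_on k S (\<lambda>x. f' x v)"
  shows "Ck_on (Suc k) S f"
proof -
  have "f differentiable_on S"
    using assms(2) unfolding differentiable_on_def differentiable_def by blast
  moreover have "Ck_on k S (\<lambda>x. frechet_derivative f (at x within S) v)" for v
    using assms(3)[of v]
    by (subst Ck_on_cong[where g="\<lambda>x. f' x v"])
       (auto simp: frechet_derivative_within_eqI[OF assms(1) _ assms(2)])
  ultimately show ?thesis by simp
qed

lemma Ck_on_subset:
  assumes "accessible T" "T \<subseteq> S" "Ck_on k S f"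
  shows "Ck_on k T f"
  using assms(3)
proof (induction k arbitrary: f)
  case 0 then show ?case using assms continuous_on_subset by simp blast
next
  case (Suc k)
  show ?case
  proof (rule Ck_on_SucI[OF assms(1)])
    show "(f has_derivative frechet_derivative f (at x within S)) (at x within T)" if "x \<in> T" for x
      using Ck_on_has_derivative[OF Suc.prems] that assms(2) has_derivative_subset by blast
    show "Ck_on k T (\<lambda>x. frechet_derivative f (at x within S) v)" for v
      using Suc by simp
  qed
qed

lemma Ck_on_const [simp]: "accessible S \<Longrightarrow> Ck_on k S (\<lambda>x. c)"
proof (induction k arbitrary: c)
  case (Suc k)
  show ?case
    by (rule Ck_on_SucI[OF Suc.prems]) (auto intro!: derivative_eq_intros Suc)
qed auto

lemma Ck_on_bounded_linear:
  assumes "accessible S" "bounded_linear L" "Ck_on k S f"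
  shows "Ck_on k S (\<lambda>x. L (f x))"
  using assms(3)
proof (induction k arbitrary: f)
  case 0 then show ?case
    using assms(2) linear_continuous_on_compose bounded_linear.continuous_on by auto
next
  case (Suc k)
  show ?case
  proof (rule Ck_on_SucI[OF assms(1)])
    show "((\<lambda>x. L (f x)) has_derivative (\<lambda>v. L (frechet_derivative f (at x within S) v)))
      (at x within S)" if "x \<in> S" for x
      using bounded_linear.has_derivative[OF assms(2) Ck_on_has_derivative[OF Suc.prems that]] .
  qed (use Suc in simp)
qed

lemma Ck_on_add:
  assumes "accessible S" "Ck_on k S f" "Ck_on k S g"
  shows "Ck_on k S (\<lambda>x. f x + g x)"
  using assms(2,3)
proof (induction k arbitrary: f g)
  case 0 then show ?case by (auto intro: continuous_intros)
next
  case (Suc k)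
  show ?case
  proof (rule Ck_on_SucI[OF assms(1)])
    show "((\<lambda>x. f x + g x) has_derivative (\<lambda>v. frechet_derivative f (at x within S) v +
        frechet_derivative g (at x within S) v)) (at x within S)" if "x \<in> S" for x
      using has_derivative_add Suc.prems Ck_on_has_derivative that by blast
  qed (use Suc in simp)
qed

text \<open>The product rule again yields bilinear expressions, in functions that are one degree less regular;
this closes the induction.\<close>

lemma Ck_on_bilinear:
  assumes "accessible S" "bounded_bilinear B" "Ck_on k S f" "Ck_on k S g"
  shows "Ck_on k S (\<lambda>x. B (f x) (g x))"
  using assms(3,4)
proof (induction k arbitrary: f g)
  case 0 then show ?case
    using assms(2) by (auto intro: bounded_bilinear.continuous_on)
next
  case (Suc k)
  show ?case
  proof (rule Ck_on_SucI[OF assms(1)])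
    show "((\<lambda>x. B (f x) (g x)) has_derivative (\<lambda>v. B (f x) (frechet_derivative g (at x within S) v) +
        B (frechet_derivative f (at x within S) v) (g x))) (at x within S)" if "x \<in> S" for x
      using bounded_bilinear.FDERIV[OF assms(2) Ck_on_has_derivative Ck_on_has_derivative,
          OF Suc.prems(1) that Suc.prems(2) that] .
    show "Ck_on k S (\<lambda>x. B (f x) (frechet_derivative g (at x within S) v) +
        B (frechet_derivative f (at x within S) v) (g x))" for v
      using Suc.prems Suc.prems[THEN Ck_on_SucD] by (intro Ck_on_add[OF assms(1)] Suc.IH) simp_all
  qed
qed

lemma Ck_on_sum:
  assumes "accessible S" "\<And>i. i \<in> I \<Longrightarrow> Ck_on k S (f i)"
  shows "Ck_on k S (\<lambda>x. \<Sum>i\<in>I. f i x)"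
  using assms(2)
  by (induction I rule: infinite_finite_induct) (auto intro: Ck_on_add simp: assms(1))

text \<open>The chain rule expresses a directional derivative of the composition as a combination of the partial
derivatives of the outer function, composed with the same inner function; so the induction runs over
the outer function.\<close>

lemma Ck_on_compose:
  fixes g :: "'a::euclidean_space \<Rightarrow> 'b::euclidean_space"
  assumes "accessible S" "Ck_on k S g" "Ck_on k T f" "g ` S \<subseteq> T" 
  shows "Ck_on k S (\<lambda>x. f (g x))"
  using assms(2,3)
proof (induction k arbitrary: f)
  case 0 then show ?case using assms(4) continuous_on_compose2 by simp blast
next
  case (Suc k)
  let ?g' = "\<lambda>x. frechet_derivative g (at x within S)"
  let ?f' = "\<lambda>y. frechet_derivative f (at y within T)"
  show ?case
  proof (rule Ck_on_SucI[OF assms(1)])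
    fix x assume x: "x \<in> S"
    have g: "(g has_derivative ?g' x) (at x within S)"
      using Ck_on_has_derivative Suc.prems x by blast
    have f: "(f has_derivative ?f' (g x)) (at (g x) within T)"
      using Ck_on_has_derivative Suc.prems x assms(4) by blast
    have lin: "linear (?f' (g x))" using f has_derivative_linear by blast
    have "((\<lambda>x. f (g x)) has_derivative (\<lambda>v. ?f' (g x) (?g' x v))) (at x within S)"
      using has_derivative_in_compose[OF g] f has_derivative_subset assms(4) by blast
    also have "(\<lambda>v. ?f' (g x) (?g' x v)) = (\<lambda>v. \<Sum>i\<in>Basis. (?g' x v \<bullet> i) *\<^sub>R ?f' (g x) i)"
    proof
      fix v
      have "?f' (g x) (?g' x v) = ?f' (g x) (\<Sum>i\<in>Basis. (?g' x v \<bullet> i) *\<^sub>R i)"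
        by (simp add: euclidean_representation)
      then show "?f' (g x) (?g' x v) = (\<Sum>i\<in>Basis. (?g' x v \<bullet> i) *\<^sub>R ?f' (g x) i)"
        by (simp add: linear_sum[OF lin] linear_cmul[OF lin])
    qed
    finally show "((\<lambda>x. f (g x)) has_derivative
        (\<lambda>v. \<Sum>i\<in>Basis. (?g' x v \<bullet> i) *\<^sub>R ?f' (g x) i)) (at x within S)" .
  next
    fix v
    show "Ck_on k S (\<lambda>x. \<Sum>i\<in>Basis. (?g' x v \<bullet> i) *\<^sub>R ?f' (g x) i)"
    proof (intro Ck_on_sum[OF assms(1)] Ck_on_bilinear[OF assms(1) bounded_bilinear_scaleR])
      fix i :: 'b
      show "Ck_on k S (\<lambda>x. ?g' x v \<bullet> i)"
        using Suc.prems by (intro Ck_on_bounded_linear[OF assms(1) bounded_linear_inner_left]) simp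
      show "Ck_on k S (\<lambda>x. ?f' (g x) i)"
        using Suc.prems Suc.prems[THEN Ck_on_SucD] by (intro Suc.IH) simp_all
    qed
  qed
qed

lemma Ck_on_local:
  assumes "open S" "\<And>x. x \<in> S \<Longrightarrow> \<exists>T. open T \<and> x \<in> T \<and> Ck_on k T f"
  shows "Ck_on k S f"
  using assms(2)
proof (induction k arbitrary: f)
  case 0
  have "isCont f x" if x: "x \<in> S" for x
    using 0[OF x] continuous_on_eq_continuous_at by auto
  then show ?case by (simp add: continuous_at_imp_continuous_on)
next
  case (Suc k)
  have *: "\<exists>T. open T \<and> x \<in> T \<and> Ck_on (Suc k) T f \<and>
      (\<forall>y\<in>T. (f has_derivative frechet_derivative f (at y)) (at y))" if x: "x \<in> S" for x
  proof -
    obtain T where T: "open T" "x \<in> T" "Ck_on (Suc k) T f" using Suc.prems[OF x] by blast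
    have "(f has_derivative frechet_derivative f (at y)) (at y)" if "y \<in> T" for y
      using Ck_on_has_derivative[OF T(3) that] at_within_open[OF that T(1)] by simp
    then show ?thesis using T by blast
  qed
  show ?case
  proof (rule Ck_on_SucI[OF accessible_open[OF assms(1)]])
    show "(f has_derivative frechet_derivative f (at x)) (at x within S)" if "x \<in> S" for x
      using *[OF that] has_derivative_at_withinI by blast
    fix v
    show "Ck_on k S (\<lambda>x. frechet_derivative f (at x) v)"
    proof (rule Suc.IH)
      fix x assume "x \<in> S"
      then obtain T where T: "open T" "x \<in> T" "Ck_on (Suc k) T f" using * by blast
      then have "Ck_on k T (\<lambda>x. frechet_derivative f (at x within T) v)" by simp
      then have "Ck_on k T (\<lambda>x. frechet_derivative f (at x) v)"
        by (subst Ck_on_cong[where g="\<lambda>x. frechet_derivative f (at x within T) v"])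
           (auto simp: at_within_open[OF _ T(1)])
      then show "\<exists>T. open T \<and> x \<in> T \<and> Ck_on k T (\<lambda>x. frechet_derivative f (at x) v)"
        using T by blast
    qed
  qed
qed

lemma smooth_on_cong: "(\<And>x. x \<in> S \<Longrightarrow> f x = g x) \<Longrightarrow> smooth_on S f \<longleftrightarrow> smooth_on S g"
  unfolding smooth_on_def by (intro all_cong1 Ck_on_cong)

lemma smooth_on_subset: "smooth_on S f \<Longrightarrow> T \<subseteq> S \<Longrightarrow> accessible T \<Longrightarrow> smooth_on T f"
  unfolding smooth_on_def by (auto intro: Ck_on_subset)

lemma smooth_on_const [simp]: "accessible S \<Longrightarrow> smooth_on S (\<lambda>x. c)"
  by (simp add: smooth_on_def)

lemma smooth_on_bounded_linear:
  "accessible S \<Longrightarrow> bounded_linear L \<Longrightarrow> smooth_on S f \<Longrightarrow> smooth_on S (\<lambda>x. L (f x))"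
  by (simp add: smooth_on_def Ck_on_bounded_linear)

lemma smooth_on_add:
  "accessible S \<Longrightarrow> smooth_on S f \<Longrightarrow> smooth_on S g \<Longrightarrow> smooth_on S (\<lambda>x. f x + g x)"
  by (simp add: smooth_on_def Ck_on_add)

lemma smooth_on_minus:
  "accessible S \<Longrightarrow> smooth_on S f \<Longrightarrow> smooth_on S (\<lambda>x. - f x)"
  by (rule smooth_on_bounded_linear[where L=uminus]) (auto intro: bounded_linear_minus bounded_linear_ident)

lemma smooth_on_diff:
  "accessible S \<Longrightarrow> smooth_on S f \<Longrightarrow> smooth_on S g \<Longrightarrow> smooth_on S (\<lambda>x. f x - g x)"
  using smooth_on_add[of S f "\<lambda>x. - g x"] smooth_on_minus[of S g] by simp

lemma smooth_on_bilinear: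
  "accessible S \<Longrightarrow> bounded_bilinear B \<Longrightarrow> smooth_on S f \<Longrightarrow> smooth_on S g \<Longrightarrow>
    smooth_on S (\<lambda>x. B (f x) (g x))"
  by (simp add: smooth_on_def Ck_on_bilinear)

lemma smooth_on_mult:
  fixes f g :: "'a::euclidean_space \<Rightarrow> real"
  shows "accessible S \<Longrightarrow> smooth_on S f \<Longrightarrow> smooth_on S g \<Longrightarrow> smooth_on S (\<lambda>x. f x * g x)"
  by (rule smooth_on_bilinear[OF _ bounded_bilinear_mult])

lemma smooth_on_sum:
  "accessible S \<Longrightarrow> (\<And>i. i \<in> I \<Longrightarrow> smooth_on S (f i)) \<Longrightarrow> smooth_on S (\<lambda>x. \<Sum>i\<in>I. f i x)"
  by (simp add: smooth_on_def Ck_on_sum)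

lemma smooth_on_nth:
  fixes f :: "'a::euclidean_space \<Rightarrow> real^'n"
  shows "accessible S \<Longrightarrow> smooth_on S f \<Longrightarrow> smooth_on S (\<lambda>x. f x $ i)"
  by (rule smooth_on_bounded_linear[OF _ bounded_linear_vec_nth])

lemma smooth_on_compose:
  fixes g :: "'a::euclidean_space \<Rightarrow> 'b::euclidean_space"
  shows "accessible S \<Longrightarrow> smooth_on S g \<Longrightarrow> smooth_on T f \<Longrightarrow> g ` S \<subseteq> T \<Longrightarrow>
    smooth_on S (\<lambda>x. f (g x))"
  unfolding smooth_on_def using Ck_on_compose by blast

lemma smooth_on_local:
  assumes "open S" "\<And>x. x \<in> S \<Longrightarrow> \<exists>T. open T \<and> x \<in> T \<and> smooth_on T f"
  shows "smooth_on S f"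
  unfolding smooth_on_def
proof
  fix k show "Ck_on k S f"
    using assms unfolding smooth_on_def by (intro Ck_on_local) blast+
qed

lemma smooth_on_imp_continuous_on: "smooth_on S f \<Longrightarrow> continuous_on S f"
  unfolding smooth_on_def using Ck_on.simps(1) by blast

lemma smooth_on_has_derivative_within:
  "smooth_on S f \<Longrightarrow> x \<in> S \<Longrightarrow> (f has_derivative frechet_derivative f (at x within S)) (at x within S)"
  unfolding smooth_on_def using Ck_on_has_derivative by blast

lemma smooth_on_has_derivative:
  "smooth_on S f \<Longrightarrow> open S \<Longrightarrow> x \<in> S \<Longrightarrow> (f has_derivative frechet_derivative f (at x)) (at x)"
  using smooth_on_has_derivative_within[of S f x] at_within_open[of x S] by simp

lemma smooth_on_frechet_within:
  "smooth_on S f \<Longrightarrow> smooth_on S (\<lambda>x. frechet_derivative f (at x within S) v)"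
  unfolding smooth_on_def using Ck_on.simps(2) by blast

lemma smooth_on_frechet:
  assumes "smooth_on S f" "open S"
  shows "smooth_on S (\<lambda>x. frechet_derivative f (at x) v)"
proof -
  have "smooth_on S (\<lambda>x. frechet_derivative f (at x) v) \<longleftrightarrow>
      smooth_on S (\<lambda>x. frechet_derivative f (at x within S) v)"
    by (rule smooth_on_cong) (simp only: at_within_open[OF _ assms(2)])
  then show ?thesis using smooth_on_frechet_within[OF assms(1)] by simp
qed

lemma smooth_on_I_derivative:
  assumes "accessible S" "\<And>x. x \<in> S \<Longrightarrow> (f has_derivative f' x) (at x within S)"
    and "\<And>v. smooth_on S (\<lambda>x. f' x v)"
  shows "smooth_on S f"
  unfolding smooth_on_def
proof
  fix k show "Ck_on k S f"
    using Ck_on_SucD[OF Ck_on_SucI[OF assms(1,2)]] assms(3) unfolding smooth_on_def by simp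
qed

lemma smooth_on_ident [simp]: "accessible S \<Longrightarrow> smooth_on S (\<lambda>x. x)"
  by (rule smooth_on_I_derivative[where f'="\<lambda>x v. v"]) auto

lemma frechet_derivative_atI: "(f has_derivative D) (at x) \<Longrightarrow> frechet_derivative f (at x) = D"
  using frechet_derivative_at by metis

section \<open>Symmetry of second derivatives\<close>

text \<open>The mean value theorem, applied first in direction \<open>a\<close> and then in direction \<open>b\<close>. The left-hand side is
symmetric in \<open>a\<close> and \<open>b\<close>, which is the source of the symmetry of second derivatives.\<close>

lemma second_difference_mean_value:
  fixes f :: "'a::euclidean_space \<Rightarrow> real"
  assumes f: "smooth_on U f" and U: "open U" and h: "h > 0"
    and box: "\<And>s t. 0 \<le> s \<Longrightarrow> s \<le> h \<Longrightarrow> 0 \<le> t \<Longrightarrow> t \<le> h \<Longrightarrow> x + s *\<^sub>R a + t *\<^sub>R b \<in> U"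
  shows "\<exists>s t. 0 < s \<and> s < h \<and> 0 < t \<and> t < h \<and>
    f (x + h *\<^sub>R a + h *\<^sub>R b) - f (x + h *\<^sub>R a) - f (x + h *\<^sub>R b) + f x =
    h * h * frechet_derivative (\<lambda>y. frechet_derivative f (at y) a) (at (x + s *\<^sub>R a + t *\<^sub>R b)) b"
proof -
  have lin: "(g has_derivative frechet_derivative g (at y)) (at y)"
    if "smooth_on U g" "y \<in> U" for g :: "'a \<Rightarrow> real" and y
    using smooth_on_has_derivative[OF that(1) U that(2)] .
  have path: "((\<lambda>s. g (y + s *\<^sub>R d)) has_real_derivative frechet_derivative g (at (y + s *\<^sub>R d)) d) (at s)"
    if "smooth_on U g" "y + s *\<^sub>R d \<in> U" for g y d s
  proof -
    have "((\<lambda>s. y + s *\<^sub>R d) has_derivative (\<lambda>r. r *\<^sub>R d)) (at s)"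
      by (auto intro!: derivative_eq_intros)
    from has_derivative_compose[OF this lin[OF that]]
    have "((\<lambda>s. g (y + s *\<^sub>R d)) has_derivative
        (\<lambda>r. frechet_derivative g (at (y + s *\<^sub>R d)) (r *\<^sub>R d))) (at s)" .
    moreover have "frechet_derivative g (at (y + s *\<^sub>R d)) (r *\<^sub>R d) =
        r * frechet_derivative g (at (y + s *\<^sub>R d)) d" for r
      using linear_cmul[OF has_derivative_linear[OF lin[OF that]]] by simp
    ultimately show ?thesis
      by (simp add: has_field_derivative_def mult.commute[of _ "frechet_derivative _ _ _"])
  qed
  define \<phi> where "\<phi> s = f ((x + h *\<^sub>R b) + s *\<^sub>R a) - f (x + s *\<^sub>R a)" for s
  define \<phi>' where "\<phi>' s = frechet_derivative f (at ((x + h *\<^sub>R b) + s *\<^sub>R a)) a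
      - frechet_derivative f (at (x + s *\<^sub>R a)) a" for s
  have "(\<phi> has_real_derivative \<phi>' s) (at s)" if "0 \<le> s" "s \<le> h" for s
    unfolding \<phi>_def \<phi>'_def
    using box[of s h] box[of s 0] that h
    by (intro DERIV_diff path f) (auto simp: algebra_simps)
  then obtain s where s: "0 < s" "s < h" "\<phi> h - \<phi> 0 = (h - 0) * \<phi>' s"
    using MVT2[OF h, of \<phi> \<phi>'] by auto
  let ?g = "\<lambda>y. frechet_derivative f (at y) a"
  have "((\<lambda>t. ?g ((x + s *\<^sub>R a) + t *\<^sub>R b)) has_real_derivative
      frechet_derivative ?g (at ((x + s *\<^sub>R a) + t *\<^sub>R b)) b) (at t)" if "0 \<le> t" "t \<le> h" for t
    using box[of s t] that s by (intro path smooth_on_frechet f U) auto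
  from MVT2[OF h, OF this] obtain t where t: "0 < t" "t < h"
    "?g (x + s *\<^sub>R a + h *\<^sub>R b) - ?g (x + s *\<^sub>R a + 0 *\<^sub>R b) =
      (h - 0) * frechet_derivative ?g (at (x + s *\<^sub>R a + t *\<^sub>R b)) b" by blast
  have "\<phi>' s = h * frechet_derivative ?g (at (x + s *\<^sub>R a + t *\<^sub>R b)) b"
    using t(3) unfolding \<phi>'_def by (simp add: algebra_simps)
  with s(3) have "\<phi> h - \<phi> 0 = h * h * frechet_derivative ?g (at (x + s *\<^sub>R a + t *\<^sub>R b)) b"
    by simp
  moreover have "\<phi> h - \<phi> 0 = f (x + h *\<^sub>R a + h *\<^sub>R b) - f (x + h *\<^sub>R a) - f (x + h *\<^sub>R b) + f x"
    unfolding \<phi>_def by (simp add: algebra_simps)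
  ultimately show ?thesis using s t by (intro exI[of _ s] exI[of _ t]) simp
qed

text \<open>Both iterated derivatives are limits of the same second difference quotient over shrinking squares.\<close>

lemma symmetric_second_derivative_real:
  fixes f :: "'a::euclidean_space \<Rightarrow> real"
  assumes f: "smooth_on U f" and U: "open U" and x: "x \<in> U"
  shows "frechet_derivative (\<lambda>y. frechet_derivative f (at y) a) (at x) b =
         frechet_derivative (\<lambda>y. frechet_derivative f (at y) b) (at x) a"
proof -
  let ?D = "\<lambda>a b y. frechet_derivative (\<lambda>y. frechet_derivative f (at y) a) (at y) b"
  have cont: "isCont (?D a b) x" for a b
    using smooth_on_imp_continuous_on[OF smooth_on_frechet[OF smooth_on_frechet[OF f U] U]]
      continuous_on_eq_continuous_at[OF U] x by blast
  have close: "\<bar>?D a b x - ?D b a x\<bar> \<le> e" if e: "e > 0" for e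
  proof -
    have "\<exists>d>0. \<forall>y. dist y x < d \<longrightarrow> \<bar>?D a b y - ?D a b x\<bar> < e/2" for a b
      using cont[of a b] e unfolding continuous_at_eps_delta dist_real_def by (metis half_gt_zero)
    then obtain d1 d2 where d: "d1 > 0" "d2 > 0"
      "\<And>y. dist y x < d1 \<Longrightarrow> \<bar>?D a b y - ?D a b x\<bar> < e/2"
      "\<And>y. dist y x < d2 \<Longrightarrow> \<bar>?D b a y - ?D b a x\<bar> < e/2" by metis
    obtain r where r: "r > 0" "ball x r \<subseteq> U" using U x openE by blast
    define R where "R = Min {d1, d2, r}"
    have R: "R > 0" "R \<le> d1" "R \<le> d2" "R \<le> r" using d r by (auto simp: R_def)
    \<comment> \<open>The square with side \<open>h\<close> and edges along \<open>a\<close> and \<open>b\<close> then lies in the ball of radius \<open>R\<close>.\<close>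
  define h where "h = R / (2 * (norm a + norm b + 1))"
    have h: "h > 0" using R by (auto simp: h_def add_nonneg_pos)
    have near: "dist (x + s *\<^sub>R a + t *\<^sub>R b) x < R"
      if "0 \<le> s" "s \<le> h" "0 \<le> t" "t \<le> h" for s t
    proof -
      have "norm (s *\<^sub>R a + t *\<^sub>R b) \<le> s * norm a + t * norm b"
        using norm_triangle_ineq[of "s *\<^sub>R a" "t *\<^sub>R b"] that by simp
      also have "\<dots> \<le> h * norm a + h * norm b"
        using that by (intro add_mono mult_right_mono) auto
      also have "\<dots> < h * (2 * (norm a + norm b + 1))"
        using h by (simp add: algebra_simps add_nonneg_pos)
      also have "\<dots> = R"
        by (simp add: h_def add_nonneg_pos add_pos_nonneg less_imp_neq[THEN not_sym])
      finally show ?thesis by (simp add: dist_norm add.assoc)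
    qed
    have inU: "x + s *\<^sub>R a + t *\<^sub>R b \<in> U"
      if "0 \<le> s" "s \<le> h" "0 \<le> t" "t \<le> h" for s t
    proof -
      have "x + s *\<^sub>R a + t *\<^sub>R b \<in> ball x r"
        using near[OF that] R by (simp add: dist_commute)
      then show ?thesis using r by blast
    qed
    then have inU': "x + t *\<^sub>R b + s *\<^sub>R a \<in> U"
      if "0 \<le> t" "t \<le> h" "0 \<le> s" "s \<le> h" for s t
      using inU[of s t] that by (simp add: ac_simps)
    obtain s t where st: "0 < s" "s < h" "0 < t" "t < h"
      "f (x + h *\<^sub>R a + h *\<^sub>R b) - f (x + h *\<^sub>R a) - f (x + h *\<^sub>R b) + f x =
        h * h * ?D a b (x + s *\<^sub>R a + t *\<^sub>R b)"
      using second_difference_mean_value[OF f U h inU] by blast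
    obtain t' s' where st': "0 < t'" "t' < h" "0 < s'" "s' < h"
      "f (x + h *\<^sub>R b + h *\<^sub>R a) - f (x + h *\<^sub>R b) - f (x + h *\<^sub>R a) + f x =
        h * h * ?D b a (x + t' *\<^sub>R b + s' *\<^sub>R a)"
      using second_difference_mean_value[OF f U h inU'] by blast
    have "h * h * ?D a b (x + s *\<^sub>R a + t *\<^sub>R b) = h * h * ?D b a (x + t' *\<^sub>R b + s' *\<^sub>R a)"
      using st(5) st'(5) by (simp add: algebra_simps)
    then have "?D a b (x + s *\<^sub>R a + t *\<^sub>R b) = ?D b a (x + s' *\<^sub>R a + t' *\<^sub>R b)"
      using h by (simp add: algebra_simps)
    moreover have "\<bar>?D a b (x + s *\<^sub>R a + t *\<^sub>R b) - ?D a b x\<bar> < e/2"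
      using d(3) near[of s t] st R by (meson less_imp_le order_less_le_trans)
    moreover have "\<bar>?D b a (x + s' *\<^sub>R a + t' *\<^sub>R b) - ?D b a x\<bar> < e/2"
      using d(4) near[of s' t'] st' R by (meson less_imp_le order_less_le_trans)
    ultimately show ?thesis by linarith
  qed
  have "\<bar>?D a b x - ?D b a x\<bar> \<le> 0" by (rule field_le_epsilon) (use close in simp)
  then show ?thesis by simp
qed

lemma symmetric_second_derivative:
  fixes f :: "'a::euclidean_space \<Rightarrow> 'b::euclidean_space"
  assumes f: "smooth_on U f" and U: "open U" and x: "x \<in> U"
  shows "frechet_derivative (\<lambda>y. frechet_derivative f (at y) a) (at x) b =
         frechet_derivative (\<lambda>y. frechet_derivative f (at y) b) (at x) a"
proof (rule euclidean_eqI)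
  fix i :: 'b
  have acc: "accessible U" using U accessible_open by blast
  have 1: "frechet_derivative (\<lambda>y. g y \<bullet> i) (at y) c = frechet_derivative g (at y) c \<bullet> i"
    if "smooth_on U g" "y \<in> U" for g :: "'a \<Rightarrow> 'b" and y c
    using bounded_linear.has_derivative[OF bounded_linear_inner_left
        smooth_on_has_derivative[OF that(1) U that(2)]] frechet_derivative_atI by (metis (no_types))
  have 2: "frechet_derivative (\<lambda>y. frechet_derivative f (at y) c) (at x) d \<bullet> i =
      frechet_derivative (\<lambda>y. frechet_derivative (\<lambda>y. f y \<bullet> i) (at y) c) (at x) d" for c d
  proof -
    have "frechet_derivative (\<lambda>y. frechet_derivative (\<lambda>y. f y \<bullet> i) (at y) c) (at x within U) =
      frechet_derivative (\<lambda>y. frechet_derivative f (at y) c \<bullet> i) (at x within U)"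
      using x by (intro frechet_derivative_within_cong) (auto simp: 1[OF f])
    then show ?thesis
      using 1[OF smooth_on_frechet[OF f U] x] at_within_open[OF x U] by metis
  qed
  show "frechet_derivative (\<lambda>y. frechet_derivative f (at y) a) (at x) b \<bullet> i =
         frechet_derivative (\<lambda>y. frechet_derivative f (at y) b) (at x) a \<bullet> i"
    unfolding 2
    by (rule symmetric_second_derivative_real[OF _ U x])
       (rule smooth_on_bounded_linear[OF acc bounded_linear_inner_left f])
qed

section \<open>One-sided limits of quotients of smooth functions\<close>

definition deriv_on :: "real set \<Rightarrow> (real \<Rightarrow> 'b::real_normed_vector) \<Rightarrow> real \<Rightarrow> 'b" where
  "deriv_on S F t = frechet_derivative F (at t within S) 1"

lemma accessible_half_open: "accessible {0..<\<delta>::real}"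
  by (rule accessible_limpt) (auto intro: islimpt_Ico)

lemma deriv_on_has_vector_derivative:
  assumes "smooth_on S F" "t \<in> S"
  shows "(F has_vector_derivative deriv_on S F t) (at t within S)"
proof -
  have D: "(F has_derivative frechet_derivative F (at t within S)) (at t within S)"
    using smooth_on_has_derivative_within assms by blast
  have "frechet_derivative F (at t within S) = (\<lambda>r. r *\<^sub>R deriv_on S F t)"
  proof
    show "frechet_derivative F (at t within S) r = r *\<^sub>R deriv_on S F t" for r
      using linear_cmul[OF has_derivative_linear[OF D], of r 1] by (simp add: deriv_on_def)
  qed
  with D show ?thesis by (simp add: has_vector_derivative_def)
qed

lemma smooth_on_deriv_on: "smooth_on S F \<Longrightarrow> smooth_on S (deriv_on S F)"
  unfolding deriv_on_def[abs_def] by (rule smooth_on_frechet_within)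

lemma deriv_on_eqI:
  assumes "accessible S" "t \<in> S" "(F has_vector_derivative D) (at t within S)"
  shows "deriv_on S F t = D"
  using frechet_derivative_within_eqI[OF assms(1,2) assms(3)[unfolded has_vector_derivative_def]]
  by (simp add: deriv_on_def)

lemma deriv_on_DERIV:
  fixes F :: "real \<Rightarrow> real"
  assumes "smooth_on {0..<\<delta>} F" "0 < t" "t < \<delta>"
  shows "(F has_real_derivative deriv_on {0..<\<delta>} F t) (at t)"
proof -
  have "(F has_real_derivative deriv_on {0..<\<delta>} F t) (at t within {0..<\<delta>})"
    using deriv_on_has_vector_derivative[OF assms(1), of t] assms(2,3)
    by (simp add: has_real_derivative_iff_has_vector_derivative)
  moreover have "at t within {0..<\<delta>} = at t"
    using assms by (intro at_within_interior) (auto simp: interior_atLeastLessThan)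
  ultimately show ?thesis by simp
qed

lemma smooth_on_tendsto_0:
  assumes "smooth_on {0..<\<delta>} F" "0 < \<delta>"
  shows "(F \<longlongrightarrow> F 0) (at_right 0)"
proof -
  have "(F \<longlongrightarrow> F 0) (at 0 within {0..<\<delta>})"
    using smooth_on_imp_continuous_on[OF assms(1)] assms(2) by (simp add: continuous_on)
  then have "(F \<longlongrightarrow> F 0) (at 0 within {0<..<\<delta>})"
    by (rule tendsto_within_subset) auto
  moreover have "at 0 within {0<..<\<delta>} = at_right 0"
    by (rule at_within_nhd[where S="{..<\<delta>}"]) (use assms(2) in auto)
  ultimately show ?thesis by simp
qed

lemma eventually_at_right_0_less: "0 < (\<delta>::real) \<Longrightarrow> \<forall>\<^sub>F t in at_right 0. 0 < t \<and> t < \<delta>"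
  unfolding eventually_at_right_field by blast

text \<open>This lemma and the three that follow describe, for \<open>X = t m(t)\<close> and \<open>X = t\<^sup>2 h(t)\<close> respectively, the limits
of the cofactor and of its derivative, \<open>m' = (t X' - X) / t\<^sup>2\<close> and \<open>h' = (t X' - 2 X) / t\<^sup>3\<close>. By
l'Hopital's rule, no cofactor that is smooth up to \<open>0\<close> has to be constructed.\<close>

lemma quotient_tendsto_deriv_0:
  fixes X :: "real \<Rightarrow> real" and \<delta> :: real
  assumes X: "smooth_on {0..<\<delta>} X" and \<delta>: "0 < \<delta>" and 0: "X 0 = 0"
  shows "((\<lambda>t. X t / t) \<longlongrightarrow> deriv_on {0..<\<delta>} X 0) (at_right 0)"
proof (rule lhopital_right_0[where f'="deriv_on {0..<\<delta>} X" and g'="\<lambda>_. 1"])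
  show "(X \<longlongrightarrow> 0) (at_right 0)" using smooth_on_tendsto_0[OF X \<delta>] 0 by simp
  show "((\<lambda>t. deriv_on {0..<\<delta>} X t / 1) \<longlongrightarrow> deriv_on {0..<\<delta>} X 0) (at_right 0)"
    using smooth_on_tendsto_0[OF smooth_on_deriv_on[OF X] \<delta>] by simp
  show "\<forall>\<^sub>F t in at_right 0. DERIV X t :> deriv_on {0..<\<delta>} X t"
    using eventually_at_right_0_less[OF \<delta>] by eventually_elim (simp add: deriv_on_DERIV[OF X])
  show "\<forall>\<^sub>F t in at_right 0. (t::real) \<noteq> 0"
    using eventually_at_right_0_less[OF \<delta>] by eventually_elim simp
qed auto

lemma quotient_deriv_tendsto_0:
  fixes X :: "real \<Rightarrow> real" and \<delta> :: real
  defines "D \<equiv> deriv_on {0..<\<delta>}"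
  assumes X: "smooth_on {0..<\<delta>} X" and \<delta>: "0 < \<delta>" and 0: "X 0 = 0"
  shows "((\<lambda>t. (t * D X t - X t) / t\<^sup>2) \<longlongrightarrow> D (D X) 0 / 2) (at_right 0)"
proof (rule lhopital_right_0[where f'="\<lambda>t. t * D (D X) t" and g'="\<lambda>t. 2 * t"])
  have DX: "smooth_on {0..<\<delta>} (D X)" using smooth_on_deriv_on[OF X] by (simp add: D_def)
  have DDX: "smooth_on {0..<\<delta>} (D (D X))" using smooth_on_deriv_on[OF DX] by (simp add: D_def)
  note [tendsto_intros] = smooth_on_tendsto_0[OF X \<delta>] smooth_on_tendsto_0[OF DX \<delta>]
    smooth_on_tendsto_0[OF DDX \<delta>]
  have id: "((\<lambda>t::real. t) \<longlongrightarrow> 0) (at_right 0)" by (rule tendsto_ident_at)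
  have "((\<lambda>t. t * D X t - X t) \<longlongrightarrow> 0 * D X 0 - X 0) (at_right 0)"
    by (intro tendsto_intros)
  then show "((\<lambda>t. t * D X t - X t) \<longlongrightarrow> 0) (at_right 0)" using 0 by simp
  have "((\<lambda>t::real. t\<^sup>2) \<longlongrightarrow> 0\<^sup>2) (at_right 0)" by (intro tendsto_intros)
  then show "((\<lambda>t::real. t\<^sup>2) \<longlongrightarrow> 0) (at_right 0)" by simp
  have "((\<lambda>t. D (D X) t / 2) \<longlongrightarrow> D (D X) 0 / 2) (at_right 0)" by (intro tendsto_intros) simp
  moreover have "\<forall>\<^sub>F t in at_right 0. D (D X) t / 2 = t * D (D X) t / (2 * t)"
    using eventually_at_right_0_less[OF \<delta>] by eventually_elim simp
  ultimately show "((\<lambda>t. t * D (D X) t / (2 * t)) \<longlongrightarrow> D (D X) 0 / 2) (at_right 0)"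
    by (rule Lim_transform_eventually)
  show "\<forall>\<^sub>F t in at_right 0. DERIV (\<lambda>t. t * D X t - X t) t :> t * D (D X) t"
    using eventually_at_right_0_less[OF \<delta>]
  proof eventually_elim
    case (elim t)
    then show ?case
      using deriv_on_DERIV[OF X, of t] deriv_on_DERIV[OF DX, of t]
      by (auto intro!: derivative_eq_intros simp: D_def)
  qed
  show "\<forall>\<^sub>F t in at_right 0. DERIV (\<lambda>t::real. t\<^sup>2) t :> 2 * t"
    by (auto intro!: derivative_eq_intros always_eventually)
  show "\<forall>\<^sub>F t in at_right 0. (t::real)\<^sup>2 \<noteq> 0" "\<forall>\<^sub>F t in at_right 0. 2 * (t::real) \<noteq> 0"
    using eventually_at_right_0_less[OF \<delta>] by (eventually_elim, simp)+
qed

lemma quotient_square_tendsto_0: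
  fixes X :: "real \<Rightarrow> real" and \<delta> :: real
  defines "D \<equiv> deriv_on {0..<\<delta>}"
  assumes X: "smooth_on {0..<\<delta>} X" and \<delta>: "0 < \<delta>" and 0: "X 0 = 0" "D X 0 = 0"
  shows "((\<lambda>t. X t / t\<^sup>2) \<longlongrightarrow> D (D X) 0 / 2) (at_right 0)"
proof (rule lhopital_right_0[where f'="D X" and g'="\<lambda>t. 2 * t"])
  have DX: "smooth_on {0..<\<delta>} (D X)" using smooth_on_deriv_on[OF X] by (simp add: D_def)
  show "(X \<longlongrightarrow> 0) (at_right 0)" using smooth_on_tendsto_0[OF X \<delta>] 0 by simp
  have "((\<lambda>t::real. t\<^sup>2) \<longlongrightarrow> 0\<^sup>2) (at_right 0)" by (intro tendsto_intros)
  then show "((\<lambda>t::real. t\<^sup>2) \<longlongrightarrow> 0) (at_right 0)" by simp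
  have "((\<lambda>t. D X t / t / 2) \<longlongrightarrow> D (D X) 0 / 2) (at_right 0)"
    using quotient_tendsto_deriv_0[OF DX \<delta> 0(2)] by (intro tendsto_intros) (simp_all add: D_def)
  then show "((\<lambda>t. D X t / (2 * t)) \<longlongrightarrow> D (D X) 0 / 2) (at_right 0)"
    by (simp add: field_simps)
  show "\<forall>\<^sub>F t in at_right 0. DERIV X t :> D X t" unfolding D_def
    using eventually_at_right_0_less[OF \<delta>] by eventually_elim (simp add: deriv_on_DERIV[OF X])
  show "\<forall>\<^sub>F t in at_right 0. DERIV (\<lambda>t::real. t\<^sup>2) t :> 2 * t"
    by (auto intro!: derivative_eq_intros always_eventually)
  show "\<forall>\<^sub>F t in at_right 0. (t::real)\<^sup>2 \<noteq> 0" "\<forall>\<^sub>F t in at_right 0. 2 * (t::real) \<noteq> 0"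
    using eventually_at_right_0_less[OF \<delta>] by (eventually_elim, simp)+
qed

lemma quotient_square_deriv_tendsto_0:
  fixes X :: "real \<Rightarrow> real" and \<delta> :: real
  defines "D \<equiv> deriv_on {0..<\<delta>}"
  assumes X: "smooth_on {0..<\<delta>} X" and \<delta>: "0 < \<delta>" and 0: "X 0 = 0" "D X 0 = 0"
  shows "((\<lambda>t. (t * D X t - 2 * X t) / t ^ 3) \<longlongrightarrow> D (D (D X)) 0 / 6) (at_right 0)"
proof (rule lhopital_right_0[where f'="\<lambda>t. t * D (D X) t - D X t" and g'="\<lambda>t. 3 * t\<^sup>2"])
  have DX: "smooth_on {0..<\<delta>} (D X)" using smooth_on_deriv_on[OF X] by (simp add: D_def)
  note [tendsto_intros] = smooth_on_tendsto_0[OF X \<delta>] smooth_on_tendsto_0[OF DX \<delta>]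
  have "((\<lambda>t. t * D X t - 2 * X t) \<longlongrightarrow> 0 * D X 0 - 2 * X 0) (at_right 0)"
    by (intro tendsto_intros)
  then show "((\<lambda>t. t * D X t - 2 * X t) \<longlongrightarrow> 0) (at_right 0)" using 0 by simp
  have "((\<lambda>t::real. t^3) \<longlongrightarrow> 0^3) (at_right 0)" by (intro tendsto_intros)
  then show "((\<lambda>t::real. t^3) \<longlongrightarrow> 0) (at_right 0)" by simp
  have "((\<lambda>t. (t * D (D X) t - D X t) / t\<^sup>2 / 3) \<longlongrightarrow> D (D (D X)) 0 / 2 / 3) (at_right 0)"
    using tendsto_divide[OF quotient_deriv_tendsto_0[OF DX \<delta> 0(2)] tendsto_const, of 3]
    by (simp add: D_def)
  then show "((\<lambda>t. (t * D (D X) t - D X t) / (3 * t\<^sup>2)) \<longlongrightarrow> D (D (D X)) 0 / 6) (at_right 0)"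
    by (simp add: field_simps)
  show "\<forall>\<^sub>F t in at_right 0. DERIV (\<lambda>t. t * D X t - 2 * X t) t :> t * D (D X) t - D X t"
    using eventually_at_right_0_less[OF \<delta>]
  proof eventually_elim
    case (elim t)
    then show ?case
      using deriv_on_DERIV[OF X, of t] deriv_on_DERIV[OF DX, of t]
      by (auto intro!: derivative_eq_intros simp: D_def)
  qed
  show "\<forall>\<^sub>F t in at_right 0. DERIV (\<lambda>t::real. t^3) t :> 3 * t\<^sup>2"
    by (auto intro!: derivative_eq_intros always_eventually)
  show "\<forall>\<^sub>F t in at_right 0. (t::real)^3 \<noteq> 0" "\<forall>\<^sub>F t in at_right 0. 3 * (t::real)\<^sup>2 \<noteq> 0"
    using eventually_at_right_0_less[OF \<delta>] by (eventually_elim, simp)+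
qed

text \<open>The expression is the derivative of the angle of the plane vector \<open>(X, Y)\<close> with \<open>Y = \<surd>\<Lambda> w\<close>. Since
\<open>\<surd>\<Lambda> = t r(t)\<close> with \<open>r(0) > 0\<close>, the vector stays away from \<open>0\<close> if \<open>X(0) \<noteq> 0\<close>; otherwise it is \<open>t\<close> times
a vector with limit \<open>(X'(0), r(0) w(0)) \<noteq> 0\<close>, which has the same angle.\<close>

lemma angle_derivative_converges:
  fixes X w \<Lambda> :: "real \<Rightarrow> real" and \<delta> :: real
  defines "D \<equiv> deriv_on {0..<\<delta>}"
  defines "Y \<equiv> \<lambda>t. sqrt (\<Lambda> t) * w t"
  defines "Y' \<equiv> \<lambda>t. D \<Lambda> t / (2 * sqrt (\<Lambda> t)) * w t + sqrt (\<Lambda> t) * D w t"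
  assumes \<delta>: "0 < \<delta>"
    and X: "smooth_on {0..<\<delta>} X" and w: "smooth_on {0..<\<delta>} w" and \<Lambda>: "smooth_on {0..<\<delta>} \<Lambda>"
    and \<Lambda>0: "\<Lambda> 0 = 0" "D \<Lambda> 0 = 0" "D (D \<Lambda>) 0 > 0"
    and Xw: "X 0 \<noteq> 0 \<or> w 0 \<noteq> 0"
  shows "\<exists>L. ((\<lambda>t. (X t * Y' t - Y t * D X t) / ((X t)\<^sup>2 + (Y t)\<^sup>2)) \<longlongrightarrow> L) (at_right 0)"
proof -
  \<comment> \<open>\<open>r\<close> is the square root of the cofactor \<open>h = \<Lambda> / t\<^sup>2\<close>, and \<open>s\<close> is the derivative of \<open>h\<close>.\<close>
  define r where "r t = sqrt (\<Lambda> t / t\<^sup>2)" for t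
  define s where "s t = (t * D \<Lambda> t - 2 * \<Lambda> t) / t ^ 3" for t
  define r0 where "r0 = sqrt (D (D \<Lambda>) 0 / 2)"
  define s0 where "s0 = D (D (D \<Lambda>)) 0 / 6"
  have r0: "r0 > 0" using \<Lambda>0 by (simp add: r0_def)
  have lim_q: "((\<lambda>t. \<Lambda> t / t\<^sup>2) \<longlongrightarrow> D (D \<Lambda>) 0 / 2) (at_right 0)"
    using quotient_square_tendsto_0[OF \<Lambda> \<delta>] \<Lambda>0 unfolding D_def by simp
  have lim_r: "(r \<longlongrightarrow> r0) (at_right 0)"
    unfolding r_def r0_def using lim_q by (rule tendsto_real_sqrt)
  have lim_s: "(s \<longlongrightarrow> s0) (at_right 0)"
    using quotient_square_deriv_tendsto_0[OF \<Lambda> \<delta>] \<Lambda>0 unfolding D_def s_def s0_def by simp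
  have DX: "smooth_on {0..<\<delta>} (D X)" "smooth_on {0..<\<delta>} (D w)"
    using smooth_on_deriv_on[OF X] smooth_on_deriv_on[OF w] by (simp_all add: D_def)
  note lims = lim_r lim_s smooth_on_tendsto_0[OF X \<delta>] smooth_on_tendsto_0[OF w \<delta>]
    smooth_on_tendsto_0[OF DX(1) \<delta>] smooth_on_tendsto_0[OF DX(2) \<delta>]
  have pos: "\<forall>\<^sub>F t in at_right 0. 0 < t \<and> \<Lambda> t > 0"
    using order_tendstoD(1)[OF lim_q, of 0] eventually_at_right_0_less[OF \<delta>] \<Lambda>0(3)
    by (auto elim: eventually_elim2 simp: zero_less_divide_iff)
  have Yr: "Y t = t * r t * w t" "Y' t = (t * s t / (2 * r t) + r t) * w t + t * r t * D w t"
      "r t > 0" if t: "0 < t \<and> \<Lambda> t > 0" for t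
  proof -
    have sq: "sqrt (\<Lambda> t) = t * r t" "\<Lambda> t = (t * r t)\<^sup>2" and r: "r t > 0"
      using t by (auto simp: r_def real_sqrt_divide power_mult_distrib)
    have DL: "D \<Lambda> t = t\<^sup>2 * s t + 2 * t * (r t)\<^sup>2"
      using t unfolding s_def sq(2) by (simp add: field_simps power2_eq_square power3_eq_cube)
    show "Y t = t * r t * w t" by (simp add: Y_def sq(1))
    show "Y' t = (t * s t / (2 * r t) + r t) * w t + t * r t * D w t"
      unfolding Y'_def sq(1) DL using t r by (simp add: field_simps power2_eq_square)
    show "r t > 0" by (rule r)
  qed
  show ?thesis
  proof (cases "X 0 = 0")
    case False
    let ?f = "\<lambda>t. (X t * ((t * s t / (2 * r t) + r t) * w t + t * r t * D w t) - t * r t * w t * D X t)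
      / ((X t)\<^sup>2 + (t * r t * w t)\<^sup>2)"
    have "(?f \<longlongrightarrow> (X 0 * ((0 * s0 / (2 * r0) + r0) * w 0 + 0 * r0 * D w 0) - 0 * r0 * w 0 * D X 0)
      / ((X 0)\<^sup>2 + (0 * r0 * w 0)\<^sup>2)) (at_right 0)"
      using False r0 by (intro tendsto_intros lims) auto
    moreover have "\<forall>\<^sub>F t in at_right 0. ?f t = (X t * Y' t - Y t * D X t) / ((X t)\<^sup>2 + (Y t)\<^sup>2)"
      using pos by eventually_elim (simp add: Yr)
    ultimately show ?thesis by (blast intro: Lim_transform_eventually)
  next
    case True
    \<comment> \<open>\<open>m\<close> is the cofactor of \<open>X\<close>, and \<open>m'\<close> its derivative; the common factor \<open>t\<^sup>2\<close> cancels.\<close>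
    define m where "m t = X t / t" for t
    define m' where "m' t = (t * D X t - X t) / t\<^sup>2" for t
    have lim_m: "(m \<longlongrightarrow> D X 0) (at_right 0)"
      unfolding m_def D_def by (rule quotient_tendsto_deriv_0[OF X \<delta> True])
    have lim_m': "(m' \<longlongrightarrow> D (D X) 0 / 2) (at_right 0)"
      unfolding m'_def D_def by (rule quotient_deriv_tendsto_0[OF X \<delta> True])
    let ?f = "\<lambda>t. (m t * s t * w t / (2 * r t) + m t * r t * D w t - r t * w t * m' t)
      / ((m t)\<^sup>2 + (r t * w t)\<^sup>2)"
    have "r0 * w 0 \<noteq> 0" using r0 Xw True by simp
    then have "(?f \<longlongrightarrow> (D X 0 * s0 * w 0 / (2 * r0) + D X 0 * r0 * D w 0 - r0 * w 0 * (D (D X) 0 / 2))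
      / ((D X 0)\<^sup>2 + (r0 * w 0)\<^sup>2)) (at_right 0)"
      using r0 by (intro tendsto_intros lims lim_m lim_m') (auto simp: sum_power2_eq_zero_iff)
    moreover have "\<forall>\<^sub>F t in at_right 0. ?f t = (X t * Y' t - Y t * D X t) / ((X t)\<^sup>2 + (Y t)\<^sup>2)"
      using pos
    proof eventually_elim
      case (elim t)
      have Xm: "X t = t * m t" "D X t = m t + t * m' t"
        using elim by (simp_all add: m_def m'_def field_simps power2_eq_square)
      have num: "X t * Y' t - Y t * D X t =
        t\<^sup>2 * (m t * s t * w t / (2 * r t) + m t * r t * D w t - r t * w t * m' t)"
        unfolding Xm Yr[OF elim] using Yr(3)[OF elim]
        by (simp add: field_simps power2_eq_square)
      have den: "(X t)\<^sup>2 + (Y t)\<^sup>2 = t\<^sup>2 * ((m t)\<^sup>2 + (r t * w t)\<^sup>2)"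
        unfolding Xm Yr[OF elim] by (simp add: algebra_simps power2_eq_square)
      show ?case unfolding num den using elim by simp
    qed
    ultimately show ?thesis by (blast intro: Lim_transform_eventually)
  qed
qed

section \<open>The curvature form as derivative of an angle plus a connection form\<close>

text \<open>The frame formula for the curvature form, cleared of denominators by the factor \<open>E \<surd>\<lambda> |\<gamma>'|\<^sup>2\<close>. The
left-hand side is \<open>E\<close> times \<open>\<langle>\<nabla>\<gamma>', N\<rangle>\<close> for the unnormalized normal \<open>N\<close>; the right-hand side consists of the
angle term and the connection term, with \<open>(u, v)\<close> the velocity, \<open>(u2, v2)\<close> the coordinate acceleration, and
\<open>Eu, Ev, \<dots>\<close> the partial derivatives of the coefficients.\<close>

lemma curvature_form_algebra:
  fixes E F G Eu Ev Fu Fv Gu Gv u v u2 v2 :: real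
  defines "\<Lambda> \<equiv> E * G - F\<^sup>2"
  defines "X \<equiv> E * u + F * v"
  defines "E' \<equiv> Eu * u + Ev * v" and "F' \<equiv> Fu * u + Fv * v" and "G' \<equiv> Gu * u + Gv * v"
  shows "E * (\<Lambda> * (u * v2 - v * u2)
      + (- (F * u + G * v)) * (Eu * u\<^sup>2 / 2 + Ev * u * v + (Fv - Gu / 2) * v\<^sup>2)
      + (E * u + F * v) * ((Fu - Ev / 2) * u\<^sup>2 + Gu * u * v + Gv * v\<^sup>2 / 2))
    = (X * ((E' * G + E * G' - 2 * F * F') / 2 * v + \<Lambda> * v2)
        - \<Lambda> * v * (E' * u + E * u2 + F' * v + F * v2))
      + (u * (E * (Fu - Ev / 2) - F * Eu / 2) + v * (E * Gu - F * Ev) / 2)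
        * (E * u\<^sup>2 + 2 * F * u * v + G * v\<^sup>2)"
  unfolding \<Lambda>_def X_def E'_def F'_def G'_def
  by (simp add: field_simps power2_eq_square)

section \<open>Semi-definite metrics in coordinates\<close>

lemma smooth_on_has_derivative_compose:
  assumes "smooth_on U f" "open U" "(x has_derivative x') (at t within S)" "x t \<in> U"
  shows "((\<lambda>s. f (x s)) has_derivative (\<lambda>v. frechet_derivative f (at (x t)) (x' v))) (at t within S)"
  using has_derivative_compose[OF assms(3) smooth_on_has_derivative[OF assms(1,2,4)]] .

lemma linear_expand:
  fixes f :: "'a::euclidean_space \<Rightarrow> 'b::real_vector"
  assumes "linear f" shows "f a = (\<Sum>i\<in>Basis. (a \<bullet> i) *\<^sub>R f i)"
proof -
  have "f a = f (\<Sum>i\<in>Basis. (a \<bullet> i) *\<^sub>R i)" by (simp add: euclidean_representation)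
  then show ?thesis by (simp add: linear_sum[OF assms] linear_cmul[OF assms])
qed

text \<open>A positive semi-definite metric in local coordinates, as a field of bilinear forms. Keeping the
vectors as arguments, instead of passing to coefficients, makes the transformation laws free of
indices.\<close>

locale metric_on =
  fixes U :: "'a::euclidean_space set" and H :: "'a \<Rightarrow> 'a \<Rightarrow> 'a \<Rightarrow> real"
  assumes openU: "open U"
    and bil: "\<And>x. x \<in> U \<Longrightarrow> bilinear (H x)"
    and sym: "\<And>x a b. x \<in> U \<Longrightarrow> H x a b = H x b a"
    and psd: "\<And>x a. x \<in> U \<Longrightarrow> 0 \<le> H x a a"
    and smooth: "\<And>a b. smooth_on U (\<lambda>x. H x a b)"
begin

definition dH :: "'a \<Rightarrow> 'a \<Rightarrow> 'a \<Rightarrow> 'a \<Rightarrow> real" where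
  "dH x e a b = frechet_derivative (\<lambda>y. H y a b) (at x) e"

text \<open>The Christoffel symbols of the first kind, as a trilinear form: the Kossowski pseudo-connection on
vector fields with constant components.\<close>

definition first_kind :: "'a \<Rightarrow> 'a \<Rightarrow> 'a \<Rightarrow> 'a \<Rightarrow> real" where
  "first_kind x a b n = (dH x a b n + dH x b n a - dH x n a b) / 2"

text \<open>The inner product of the covariant acceleration with \<open>n\<close>, for velocity \<open>w\<close> and coordinate acceleration \<open>z\<close>.
Unlike the covariant acceleration itself, this is defined where the metric degenerates.\<close>

definition geodesic_defect :: "'a \<Rightarrow> 'a \<Rightarrow> 'a \<Rightarrow> 'a \<Rightarrow> real" where
  "geodesic_defect x w z n = H x z n + first_kind x w w n"

lemma linear_H1: "x \<in> U \<Longrightarrow> linear (\<lambda>a. H x a b)" and linear_H2: "x \<in> U \<Longrightarrow> linear (H x a)"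
  using bil unfolding bilinear_def by auto

lemmas H_simps = linear_add[OF linear_H1] linear_add[OF linear_H2] linear_diff[OF linear_H1]
  linear_diff[OF linear_H2] linear_cmul[OF linear_H1] linear_cmul[OF linear_H2]
  linear_neg[OF linear_H1] linear_neg[OF linear_H2]

lemma has_derivative_H: "x \<in> U \<Longrightarrow> ((\<lambda>y. H y a b) has_derivative (\<lambda>e. dH x e a b)) (at x)"
  unfolding dH_def using smooth_on_has_derivative[OF smooth openU] by (simp add: eta_contract_eq)

lemma dH_eqI:
  assumes "x \<in> U" "\<And>y. y \<in> U \<Longrightarrow> f y = H y a b" "(f has_derivative D) (at x)"
  shows "dH x e a b = D e"
proof -
  have "((\<lambda>y. H y a b) has_derivative D) (at x)"
    by (rule has_derivative_transform_within_open[OF assms(3) openU assms(1)]) (simp add: assms(2))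
  then show ?thesis using frechet_derivative_atI unfolding dH_def by metis
qed

lemma linear_dH0: "x \<in> U \<Longrightarrow> linear (\<lambda>e. dH x e a b)"
  using has_derivative_H has_derivative_linear by blast

lemma linear_dH1: assumes x: "x \<in> U" shows "linear (\<lambda>a. dH x e a b)"
proof (rule linearI)
  show "dH x e (a + a') b = dH x e a b + dH x e a' b" for a a'
    by (rule dH_eqI[OF x _ has_derivative_add[OF has_derivative_H[OF x] has_derivative_H[OF x]]])
       (simp add: H_simps)
  show "dH x e (c *\<^sub>R a) b = c *\<^sub>R dH x e a b" for a c
    by (rule dH_eqI[OF x _ has_derivative_scaleR_right[OF has_derivative_H[OF x]]])
       (simp add: H_simps)
qed

lemma dH_sym: assumes x: "x \<in> U" shows "dH x e a b = dH x e b a"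
  by (rule dH_eqI[OF x _ has_derivative_H[OF x]]) (simp add: sym)

lemma linear_dH2: assumes x: "x \<in> U" shows "linear (\<lambda>b. dH x e a b)"
  using linear_dH1[OF x] by (simp add: dH_sym[OF x, of e a])

lemmas dH_simps = linear_add[OF linear_dH0] linear_add[OF linear_dH1] linear_add[OF linear_dH2]
  linear_diff[OF linear_dH0] linear_diff[OF linear_dH1] linear_diff[OF linear_dH2]
  linear_cmul[OF linear_dH0] linear_cmul[OF linear_dH1] linear_cmul[OF linear_dH2]
  linear_neg[OF linear_dH0] linear_neg[OF linear_dH1] linear_neg[OF linear_dH2]

lemma linear_first_kind:
  assumes "x \<in> U" shows "linear (first_kind x a b)"
  by (rule linearI) (simp_all add: first_kind_def dH_simps assms field_simps)

lemma linear_geodesic_defect: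
  assumes "x \<in> U" shows "linear (geodesic_defect x w z)"
  by (rule linearI)
     (simp_all add: geodesic_defect_def H_simps assms linear_add[OF linear_first_kind]
        linear_cmul[OF linear_first_kind] field_simps)

lemma H_expand:
  assumes x: "x \<in> U"
  shows "H x a b = (\<Sum>i\<in>Basis. \<Sum>j\<in>Basis. (a \<bullet> i) * (b \<bullet> j) * H x i j)"
  unfolding linear_expand[OF linear_H1[OF x], of a b]
  unfolding linear_expand[OF linear_H2[OF x], of _ b]
  by (simp add: sum_distrib_left mult.assoc)

lemma dH_expand:
  assumes x: "x \<in> U"
  shows "dH x e a b = (\<Sum>i\<in>Basis. \<Sum>j\<in>Basis. (a \<bullet> i) * (b \<bullet> j) * dH x e i j)"
  unfolding linear_expand[OF linear_dH1[OF x], of e a b]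
  unfolding linear_expand[OF linear_dH2[OF x], of e _ b]
  by (simp add: sum_distrib_left mult.assoc)

text \<open>The Leibniz rule when the base point and both vectors vary. It is derived from the constant-vector
case by expanding in a basis.\<close>

lemma has_derivative_H_along:
  assumes \<phi>: "(\<phi> has_derivative \<phi>') (at z within S)" and A: "(A has_derivative A') (at z within S)"
    and B: "(B has_derivative B') (at z within S)" and z: "z \<in> S" and sub: "\<phi> ` S \<subseteq> U"
  shows "((\<lambda>s. H (\<phi> s) (A s) (B s)) has_derivative
    (\<lambda>e. dH (\<phi> z) (\<phi>' e) (A z) (B z) + H (\<phi> z) (A' e) (B z) + H (\<phi> z) (A z) (B' e))) (at z within S)"
proof -
  let ?h = "\<lambda>s. \<Sum>i\<in>Basis. \<Sum>j\<in>Basis. (A s \<bullet> i) * (B s \<bullet> j) * H (\<phi> s) i j"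
  have \<phi>z: "\<phi> z \<in> U" using z sub by blast
  have D: "((\<lambda>s. H (\<phi> s) i j) has_derivative (\<lambda>e. dH (\<phi> z) (\<phi>' e) i j)) (at z within S)" for i j
    using has_derivative_compose[OF \<phi> has_derivative_H[OF \<phi>z]] .
  have "(?h has_derivative (\<lambda>e. \<Sum>i\<in>Basis. \<Sum>j\<in>Basis.
      (A z \<bullet> i) * (B z \<bullet> j) * dH (\<phi> z) (\<phi>' e) i j +
      ((A z \<bullet> i) * (B' e \<bullet> j) + (A' e \<bullet> i) * (B z \<bullet> j)) * H (\<phi> z) i j)) (at z within S)"
    by (intro has_derivative_sum has_derivative_mult D
        has_derivative_inner_left A B)
  moreover have "(\<Sum>i\<in>Basis. \<Sum>j\<in>Basis.
      (A z \<bullet> i) * (B z \<bullet> j) * dH (\<phi> z) (\<phi>' e) i j +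
      ((A z \<bullet> i) * (B' e \<bullet> j) + (A' e \<bullet> i) * (B z \<bullet> j)) * H (\<phi> z) i j) =
    dH (\<phi> z) (\<phi>' e) (A z) (B z) + H (\<phi> z) (A' e) (B z) + H (\<phi> z) (A z) (B' e)" for e
    unfolding dH_expand[OF \<phi>z, of _ "A z"] H_expand[OF \<phi>z, of "A' e"] H_expand[OF \<phi>z, of "A z"]
    by (simp add: algebra_simps sum.distrib)
  ultimately have D: "(?h has_derivative (\<lambda>e. dH (\<phi> z) (\<phi>' e) (A z) (B z) + H (\<phi> z) (A' e) (B z)
      + H (\<phi> z) (A z) (B' e))) (at z within S)" by simp
  show ?thesis
    by (rule has_derivative_transform[OF z _ D]) (use sub H_expand in blast)
qed

lemma smooth_on_H_along:
  assumes "accessible S" "smooth_on S \<phi>" "\<phi> ` S \<subseteq> U"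
  shows "smooth_on S (\<lambda>s. H (\<phi> s) a b)" "smooth_on S (\<lambda>s. dH (\<phi> s) e a b)"
  using smooth_on_compose[OF assms(1,2) smooth assms(3)]
    smooth_on_compose[OF assms(1,2) smooth_on_frechet[OF smooth openU] assms(3)]
  unfolding dH_def by auto

text \<open>The vectors of length zero of a semi-definite form are exactly its null vectors: otherwise the form
would be negative at a suitable combination.\<close>

lemma psd_null:
  assumes x: "x \<in> U" and 0: "H x a a = 0" shows "H x a b = 0"
proof (rule ccontr)
  assume ne: "H x a b \<noteq> 0"
  \<comment> \<open>The value of the form at \<open>s a + b\<close> is affine in \<open>s\<close>, as \<open>a\<close> has length zero; this \<open>s\<close> makes it \<open>-1\<close>.\<close>
  define s where "s = - (H x b b + 1) / (2 * H x a b)"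
  have "0 \<le> H x (s *\<^sub>R a + b) (s *\<^sub>R a + b)" using psd x by blast
  also have "\<dots> = 2 * s * H x a b + H x b b"
    using 0 by (simp add: H_simps x sym[OF x, of b a])
  also have "\<dots> = -1" using ne by (simp add: s_def field_simps)
  finally show False by simp
qed

end

section \<open>Coordinate changes\<close>

text \<open>The direction of the second differentiation comes first: \<open>b\<close> is the direction of the inner derivative.\<close>

definition second_derivative :: "('a::real_normed_vector \<Rightarrow> 'b::real_normed_vector) \<Rightarrow> 'a \<Rightarrow> 'a \<Rightarrow> 'a \<Rightarrow> 'b" where
  "second_derivative f x a b = frechet_derivative (\<lambda>y. frechet_derivative f (at y) b) (at x) a"

locale coordinate_change =
  M: metric_on U H + N: metric_on V K
    for U :: "'a::euclidean_space set" and H and V :: "'a set" and K +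
  fixes \<phi> :: "'a \<Rightarrow> 'a" and W
  assumes \<phi>: "smooth_on W \<phi>" and openW: "open W" and WU: "W \<subseteq> U" and WV: "\<phi> ` W \<subseteq> V"
    and pullback: "\<And>x a b. x \<in> W \<Longrightarrow>
      H x a b = K (\<phi> x) (frechet_derivative \<phi> (at x) a) (frechet_derivative \<phi> (at x) b)"
begin

abbreviation "J x \<equiv> frechet_derivative \<phi> (at x)"

lemma linear_J: "x \<in> W \<Longrightarrow> linear (J x)"
  using smooth_on_has_derivative[OF \<phi> openW] has_derivative_linear by blast

text \<open>The derivative of the pulled back metric has an inhomogeneous part, in which the second derivative
of the coordinate change acts on either vector.\<close>

lemma dH_transform:
  assumes x: "x \<in> W"
  shows "M.dH x e a b = N.dH (\<phi> x) (J x e) (J x a) (J x b)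
    + K (\<phi> x) (second_derivative \<phi> x e a) (J x b) + K (\<phi> x) (J x a) (second_derivative \<phi> x e b)"
proof -
  have D2: "((\<lambda>s. J s c) has_derivative frechet_derivative (\<lambda>y. J y c) (at x)) (at x within W)" for c
    by (rule has_derivative_at_withinI[OF smooth_on_has_derivative[OF smooth_on_frechet[OF \<phi> openW] openW x]])
  have "((\<lambda>s. K (\<phi> s) (J s a) (J s b)) has_derivative
    (\<lambda>e. N.dH (\<phi> x) (J x e) (J x a) (J x b)
    + K (\<phi> x) (second_derivative \<phi> x e a) (J x b) + K (\<phi> x) (J x a) (second_derivative \<phi> x e b)))
     (at x within W)"
    unfolding second_derivative_def
    by (rule N.has_derivative_H_along[OF has_derivative_at_withinI[OF smooth_on_has_derivative[OF \<phi> openW x]]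
          D2 D2 x WV])
  then have "((\<lambda>s. K (\<phi> s) (J s a) (J s b)) has_derivative
    (\<lambda>e. N.dH (\<phi> x) (J x e) (J x a) (J x b)
    + K (\<phi> x) (second_derivative \<phi> x e a) (J x b) + K (\<phi> x) (J x a) (second_derivative \<phi> x e b)))
     (at x)" by (simp add: at_within_open[OF x openW])
  then have "((\<lambda>y. H y a b) has_derivative
    (\<lambda>e. N.dH (\<phi> x) (J x e) (J x a) (J x b)
    + K (\<phi> x) (second_derivative \<phi> x e a) (J x b) + K (\<phi> x) (J x a) (second_derivative \<phi> x e b)))
     (at x)"
    by (rule has_derivative_transform_within_open[OF _ openW x]) (simp add: pullback)
  from frechet_derivative_atI[OF this] show ?thesis unfolding M.dH_def by (rule fun_cong)
qed

text \<open>Of the six inhomogeneous terms coming from the three derivatives of the metric, four cancel by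
symmetry of the second derivative, and the remaining two coincide.\<close>

lemma first_kind_transform:
  assumes x: "x \<in> W"
  shows "M.first_kind x a b n =
    N.first_kind (\<phi> x) (J x a) (J x b) (J x n) + K (\<phi> x) (second_derivative \<phi> x a b) (J x n)"
proof -
  have sym: "second_derivative \<phi> x c d = second_derivative \<phi> x d c" for c d
    unfolding second_derivative_def by (rule symmetric_second_derivative[OF \<phi> openW x])
  have V: "\<phi> x \<in> V" using x WV by blast
  show ?thesis
    unfolding M.first_kind_def N.first_kind_def dH_transform[OF x]
    using N.sym[OF V] sym[of b n] sym[of a n] sym[of a b] by (simp add: field_simps)
qed

text \<open>The inhomogeneous term of the Christoffel symbols is absorbed by that of the acceleration: the
covector \<open>geodesic_defect\<close> is tensorial.\<close>

lemma geodesic_defect_transform: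
  assumes x: "x \<in> W"
  shows "M.geodesic_defect x w z n =
    N.geodesic_defect (\<phi> x) (J x w) (J x z + second_derivative \<phi> x w w) (J x n)"
  using x WV unfolding M.geodesic_defect_def N.geodesic_defect_def first_kind_transform[OF x]
  by (auto simp: N.H_simps pullback image_subset_iff)

end

section \<open>Metrics and coordinate changes in the plane\<close>

abbreviation e1 :: "real^2" where "e1 \<equiv> axis 1 1"
abbreviation e2 :: "real^2" where "e2 \<equiv> axis 2 1"

lemma axis2_nth [simp]: "e1 $ 1 = 1" "e1 $ 2 = 0" "e2 $ 1 = 0" "e2 $ 2 = 1"
  by (simp_all add: axis_def)

lemma vec2_expand: "(a::real^2) = a$1 *\<^sub>R e1 + a$2 *\<^sub>R e2"
  by (simp add: vec_eq_iff forall_2 axis_def)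

definition gram_det :: "(real^2 \<Rightarrow> real^2 \<Rightarrow> real^2 \<Rightarrow> real) \<Rightarrow> real^2 \<Rightarrow> real" where
  "gram_det H x = H x e1 e1 * H x e2 e2 - (H x e1 e2)\<^sup>2"

text \<open>The normal of the curve before normalization: it is orthogonal to the velocity \<open>w\<close>, and it is a smooth
function of the point and the velocity even where the metric degenerates.\<close>

definition conormal :: "(real^2 \<Rightarrow> real^2 \<Rightarrow> real^2 \<Rightarrow> real) \<Rightarrow> real^2 \<Rightarrow> real^2 \<Rightarrow> real^2" where
  "conormal H x w = - (H x w e2) *\<^sub>R e1 + H x w e1 *\<^sub>R e2"

locale metric2_on = metric_on U H for U and H :: "real^2 \<Rightarrow> real^2 \<Rightarrow> real^2 \<Rightarrow> real"
begin

definition curvature_density :: "real^2 \<Rightarrow> real^2 \<Rightarrow> real^2 \<Rightarrow> real" where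
  "curvature_density x w z =
    geodesic_defect x w z (conormal H x w) / (sqrt (gram_det H x) * H x w w)"

lemma H_components:
  assumes "x \<in> U"
  shows "H x a b = a$1 * b$1 * H x e1 e1 + (a$1 * b$2 + a$2 * b$1) * H x e1 e2 + a$2 * b$2 * H x e2 e2"
proof -
  have "H x a b = H x (a$1 *\<^sub>R e1 + a$2 *\<^sub>R e2) (b$1 *\<^sub>R e1 + b$2 *\<^sub>R e2)"
    using vec2_expand by metis
  then show ?thesis
    by (simp add: H_simps assms sym[OF assms, of e2 e1] algebra_simps)
qed

lemma dH_components:
  assumes "x \<in> U"
  shows "dH x e a b = e$1 * (a$1 * b$1 * dH x e1 e1 e1 + (a$1 * b$2 + a$2 * b$1) * dH x e1 e1 e2 + a$2 * b$2 * dH x e1 e2 e2)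
   + e$2 * (a$1 * b$1 * dH x e2 e1 e1 + (a$1 * b$2 + a$2 * b$1) * dH x e2 e1 e2 + a$2 * b$2 * dH x e2 e2 e2)"
proof -
  have "dH x e a b = dH x (e$1 *\<^sub>R e1 + e$2 *\<^sub>R e2) (a$1 *\<^sub>R e1 + a$2 *\<^sub>R e2) (b$1 *\<^sub>R e1 + b$2 *\<^sub>R e2)"
    using vec2_expand by metis
  then show ?thesis
    by (simp add: dH_simps assms dH_sym[OF assms, of _ e2 e1] algebra_simps)
qed

text \<open>For \<open>E \<noteq> 0\<close> the vector \<open>E \<partial>\<^sub>v - F \<partial>\<^sub>u\<close> has squared length \<open>E \<lambda>\<close>.\<close>

lemma gram_det_nonneg:
  assumes x: "x \<in> U" shows "gram_det H x \<ge> 0"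
proof (cases "H x e1 e1 = 0")
  case True
  then show ?thesis using psd_null[OF x True, of e2] by (simp add: gram_det_def)
next
  case False
  let ?n = "H x e1 e1 *\<^sub>R e2 - H x e1 e2 *\<^sub>R e1"
  have "0 \<le> H x ?n ?n" using psd x by blast
  also have "\<dots> = H x e1 e1 * gram_det H x"
    by (simp add: H_simps x sym[OF x, of e2 e1] gram_det_def power2_eq_square algebra_simps)
  finally show ?thesis using False psd[OF x, of e1] by (simp add: zero_le_mult_iff)
qed

lemma gram_det_eq_0_if_null_vector:
  assumes x: "x \<in> U" and n: "n \<noteq> 0" "\<And>w. H x n w = 0"
  shows "gram_det H x = 0"
proof -
  have eqs: "n$1 * H x e1 e1 + n$2 * H x e1 e2 = 0" "n$1 * H x e1 e2 + n$2 * H x e2 e2 = 0"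
    using n(2)[of e1] n(2)[of e2] unfolding H_components[OF x, of n] by simp_all
  \<comment> \<open>Cramer's rule\<close>
  have "n$1 * gram_det H x =
      H x e2 e2 * (n$1 * H x e1 e1 + n$2 * H x e1 e2) - H x e1 e2 * (n$1 * H x e1 e2 + n$2 * H x e2 e2)"
    "n$2 * gram_det H x =
      H x e1 e1 * (n$1 * H x e1 e2 + n$2 * H x e2 e2) - H x e1 e2 * (n$1 * H x e1 e1 + n$2 * H x e1 e2)"
    by (simp_all add: gram_det_def power2_eq_square algebra_simps)
  then have "n$1 * gram_det H x = 0" "n$2 * gram_det H x = 0" unfolding eqs by simp_all
  then show ?thesis using n(1) by (auto simp: vec_eq_iff forall_2)
qed

lemma smooth_gram_det: "smooth_on U (gram_det H)"
  unfolding gram_det_def[abs_def] power2_eq_square using accessible_open[OF openU]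
  by (intro smooth_on_diff smooth_on_mult smooth)

end

locale coordinate_change2 = M: metric2_on U H + N: metric2_on V K + coordinate_change U H V K \<phi> W
  for U H V K \<phi> W
begin

lemma J_det: 
  assumes x: "x \<in> W"
  shows "det (matrix (J x)) = J x e1 $ 1 * J x e2 $ 2 - J x e1 $ 2 * J x e2 $ 1"
  by (simp add: det_2 matrix_def)

lemma gram_det_transform:
  assumes x: "x \<in> W"
  shows "gram_det H x = (det (matrix (J x)))\<^sup>2 * gram_det K (\<phi> x)"
proof -
  have V: "\<phi> x \<in> V" using x WV by blast
  show ?thesis
    unfolding gram_det_def pullback[OF x] J_det[OF x]
      N.H_components[OF V, of "J x e1"] N.H_components[OF V, of "J x e2"]
    by (simp add: power2_eq_square algebra_simps)
qed

text \<open>The conormal is the rotation of the velocity by a right angle, multiplied by the square root of the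
Gram determinant and therefore a tensor density: this is where the Jacobian enters.\<close>

lemma conormal_transform:
  assumes x: "x \<in> W"
  shows "J x (conormal H x w) = det (matrix (J x)) *\<^sub>R conormal K (\<phi> x) (J x w)"
proof -
  have V: "\<phi> x \<in> V" using x WV by blast
  have "K (\<phi> x) a b = b$1 * K (\<phi> x) a e1 + b$2 * K (\<phi> x) a e2" for a b
  proof -
    have "K (\<phi> x) a b = K (\<phi> x) a (b$1 *\<^sub>R e1 + b$2 *\<^sub>R e2)" using vec2_expand by metis
    then show ?thesis by (simp add: N.H_simps V)
  qed
  note K = this[of "J x w" "J x e1"] this[of "J x w" "J x e2"]
  have lin: "linear (J x)" using linear_J x by blast
  show ?thesis
    unfolding conormal_def pullback[OF x] linear_add[OF lin] linear_cmul[OF lin] J_det[OF x] K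
    by (simp add: vec_eq_iff forall_2 axis_def algebra_simps)
qed

text \<open>The conormal contributes the Jacobian and the square root of the Gram determinant its absolute
value; only the sign remains.\<close>

lemma curvature_density_transform:
  assumes x: "x \<in> W"
  shows "M.curvature_density x w z = sgn (det (matrix (J x))) *
    N.curvature_density (\<phi> x) (J x w) (J x z + second_derivative \<phi> x w w)"
proof -
  have V: "\<phi> x \<in> V" using x WV by blast
  let ?d = "det (matrix (J x))"
  have "M.geodesic_defect x w z (conormal H x w) =
    ?d * N.geodesic_defect (\<phi> x) (J x w) (J x z + second_derivative \<phi> x w w) (conormal K (\<phi> x) (J x w))"
    unfolding geodesic_defect_transform[OF x] conormal_transform[OF x]
    using linear_cmul[OF N.linear_geodesic_defect[OF V]] by simp
  moreover have "sqrt (gram_det H x) = \<bar>?d\<bar> * sqrt (gram_det K (\<phi> x))"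
    unfolding gram_det_transform[OF x] by (simp add: real_sqrt_mult)
  ultimately show ?thesis
    unfolding M.curvature_density_def N.curvature_density_def pullback[OF x, of w w]
    by (simp add: sgn_if abs_if)
qed

end

text \<open>The analytic core, stated for functions of the curve parameter so that it can be applied with the
roles of the two coordinates exchanged: \<open>\<Lambda>\<close> is the Gram determinant along the curve, \<open>Q\<close> the squared
speed, \<open>num\<close> the pairing of the covariant acceleration with the conormal, and \<open>W\<close> the numerator of the
connection form, which vanishes at \<open>0\<close> by admissibility.\<close>

lemma scalar_curvature_converges:
  fixes E F G Eu Ev Fu Fv Gu Gv u v :: "real \<Rightarrow> real" and \<delta> :: real
  defines "D \<equiv> deriv_on {0..<\<delta>}"
  defines "\<Lambda> \<equiv> \<lambda>t. E t * G t - (F t)\<^sup>2"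
  defines "W \<equiv> \<lambda>t. u t * (E t * (Fu t - Ev t / 2) - F t * Eu t / 2) + v t * (E t * Gu t - F t * Ev t) / 2"
  defines "Q \<equiv> \<lambda>t. E t * (u t)\<^sup>2 + 2 * F t * u t * v t + G t * (v t)\<^sup>2"
  defines "num \<equiv> \<lambda>t. \<Lambda> t * (u t * D v t - v t * D u t)
      + (- (F t * u t + G t * v t)) * (Eu t * (u t)\<^sup>2 / 2 + Ev t * u t * v t + (Fv t - Gu t / 2) * (v t)\<^sup>2)
      + (E t * u t + F t * v t) * ((Fu t - Ev t / 2) * (u t)\<^sup>2 + Gu t * u t * v t + Gv t * (v t)\<^sup>2 / 2)"
  assumes \<delta>: "0 < \<delta>"
    and smooth: "smooth_on {0..<\<delta>} E" "smooth_on {0..<\<delta>} F" "smooth_on {0..<\<delta>} G"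
      "smooth_on {0..<\<delta>} Eu" "smooth_on {0..<\<delta>} Ev" "smooth_on {0..<\<delta>} Fu" "smooth_on {0..<\<delta>} Gu"
      "smooth_on {0..<\<delta>} u" "smooth_on {0..<\<delta>} v"
    and DE: "\<And>t. 0 < t \<Longrightarrow> t < \<delta> \<Longrightarrow> D E t = Eu t * u t + Ev t * v t"
    and DF: "\<And>t. 0 < t \<Longrightarrow> t < \<delta> \<Longrightarrow> D F t = Fu t * u t + Fv t * v t"
    and DG: "\<And>t. 0 < t \<Longrightarrow> t < \<delta> \<Longrightarrow> D G t = Gu t * u t + Gv t * v t"
    and \<Lambda>0: "\<Lambda> 0 = 0" "D \<Lambda> 0 = 0" "D (D \<Lambda>) 0 > 0"
    and E0: "E 0 > 0" and uv0: "u 0 \<noteq> 0 \<or> v 0 \<noteq> 0" and W0: "W 0 = 0"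
  shows "\<exists>L. ((\<lambda>t. num t / (sqrt (\<Lambda> t) * Q t)) \<longlongrightarrow> L) (at_right 0)"
proof -
  note acc = accessible_half_open[of \<delta>]
  \<comment> \<open>The components of the velocity in the frame that starts with the first coordinate vector, up to a common factor.\<close>
  define X where "X t = E t * u t + F t * v t" for t
  define Y where "Y t = sqrt (\<Lambda> t) * v t" for t
  define Y' where "Y' t = D \<Lambda> t / (2 * sqrt (\<Lambda> t)) * v t + sqrt (\<Lambda> t) * D v t" for t
  have sX: "smooth_on {0..<\<delta>} X" and s\<Lambda>: "smooth_on {0..<\<delta>} \<Lambda>"
    unfolding X_def[abs_def] \<Lambda>_def power2_eq_square
    by (intro smooth_on_add smooth_on_diff smooth_on_mult acc smooth)+
  have sW: "smooth_on {0..<\<delta>} W"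
  proof -
    have "W = (\<lambda>t. u t * (E t * (Fu t - 1/2 * Ev t) - 1/2 * (F t * Eu t)) + 1/2 * (v t * (E t * Gu t - F t * Ev t)))"
      by (simp add: W_def fun_eq_iff)
    then show ?thesis
      by (simp only:) (intro smooth_on_add smooth_on_diff smooth_on_mult acc smooth smooth_on_const)
  qed
  have "X 0 \<noteq> 0 \<or> v 0 \<noteq> 0" using E0 uv0 by (auto simp: X_def)
  from angle_derivative_converges[OF \<delta> sX smooth(9) s\<Lambda> \<Lambda>0[unfolded D_def] this, folded D_def]
  obtain L1 where L1: "((\<lambda>t. (X t * Y' t - Y t * D X t) / ((X t)\<^sup>2 + (Y t)\<^sup>2)) \<longlongrightarrow> L1) (at_right 0)"
    unfolding Y_def Y'_def by blast
  define r0 where "r0 = sqrt (D (D \<Lambda>) 0 / 2)"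
  have r0: "r0 > 0" using \<Lambda>0 by (simp add: r0_def)
  have lim_q: "((\<lambda>t. \<Lambda> t / t\<^sup>2) \<longlongrightarrow> D (D \<Lambda>) 0 / 2) (at_right 0)"
    using quotient_square_tendsto_0[OF s\<Lambda> \<delta>] \<Lambda>0 unfolding D_def by simp
  have pos: "\<forall>\<^sub>F t in at_right 0. (0 < t \<and> t < \<delta>) \<and> \<Lambda> t > 0"
    using order_tendstoD(1)[OF lim_q, of 0] eventually_at_right_0_less[OF \<delta>] \<Lambda>0(3)
    by (auto elim: eventually_elim2 simp: zero_less_divide_iff)
  have posE: "\<forall>\<^sub>F t in at_right 0. E t > 0"
    using order_tendstoD(1)[OF smooth_on_tendsto_0[OF smooth(1) \<delta>] E0] .
  have uv: "\<forall>\<^sub>F t in at_right 0. u t \<noteq> 0 \<or> v t \<noteq> 0"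
    using uv0
  proof
    assume "u 0 \<noteq> 0"
    from tendsto_imp_eventually_ne[OF smooth_on_tendsto_0[OF smooth(8) \<delta>] this]
    show ?thesis by eventually_elim simp
  next
    assume "v 0 \<noteq> 0"
    from tendsto_imp_eventually_ne[OF smooth_on_tendsto_0[OF smooth(9) \<delta>] this]
    show ?thesis by eventually_elim simp
  qed
  have "((\<lambda>t. (W t / t) / (E t * sqrt (\<Lambda> t / t\<^sup>2))) \<longlongrightarrow> D W 0 / (E 0 * r0)) (at_right 0)"
    unfolding r0_def using E0 r0[unfolded r0_def]
    by (intro tendsto_intros lim_q smooth_on_tendsto_0[OF smooth(1) \<delta>]
        quotient_tendsto_deriv_0[OF sW \<delta> W0, folded D_def]) simp
  from tendsto_add[OF L1 this]
  have lim: "((\<lambda>t. (X t * Y' t - Y t * D X t) / ((X t)\<^sup>2 + (Y t)\<^sup>2) + (W t / t) / (E t * sqrt (\<Lambda> t / t\<^sup>2)))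
     \<longlongrightarrow> L1 + D W 0 / (E 0 * r0)) (at_right 0)" .
  have "\<forall>\<^sub>F t in at_right 0. (X t * Y' t - Y t * D X t) / ((X t)\<^sup>2 + (Y t)\<^sup>2)
      + (W t / t) / (E t * sqrt (\<Lambda> t / t\<^sup>2)) = num t / (sqrt (\<Lambda> t) * Q t)"
    using pos posE uv
  proof eventually_elim
    case (elim t)
    define q where "q = sqrt (\<Lambda> t)"
    have q: "q > 0" "\<Lambda> t = q\<^sup>2" using elim by (auto simp: q_def)
    have t: "t > 0" "t < \<delta>" using elim by auto
    note der = deriv_on_DERIV[OF _ t, folded D_def]
    note ders = der[OF smooth(1)] der[OF smooth(2)] der[OF smooth(3)] der[OF smooth(8)] der[OF smooth(9)]
    have DX: "D X t = D E t * u t + E t * D u t + D F t * v t + F t * D v t"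
    proof (rule DERIV_unique[OF der[OF sX]])
      show "(X has_real_derivative D E t * u t + E t * D u t + D F t * v t + F t * D v t) (at t)"
        unfolding X_def[abs_def] by (rule derivative_eq_intros ders refl)+ (simp add: algebra_simps)
    qed
    have D\<Lambda>: "D \<Lambda> t = D E t * G t + E t * D G t - 2 * F t * D F t"
    proof (rule DERIV_unique[OF der[OF s\<Lambda>]])
      show "(\<Lambda> has_real_derivative D E t * G t + E t * D G t - 2 * F t * D F t) (at t)"
        unfolding \<Lambda>_def by (rule derivative_eq_intros ders refl)+ (simp add: algebra_simps)
    qed
    have EQ: "(X t)\<^sup>2 + (Y t)\<^sup>2 = E t * Q t"
    proof -
      have "(Y t)\<^sup>2 = (E t * G t - (F t)\<^sup>2) * (v t)\<^sup>2"
        using elim by (simp add: Y_def power_mult_distrib \<Lambda>_def)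
      then show ?thesis by (simp add: X_def Q_def power2_eq_square algebra_simps)
    qed
    have "(X t)\<^sup>2 + (Y t)\<^sup>2 \<noteq> 0"
    proof
      assume "(X t)\<^sup>2 + (Y t)\<^sup>2 = 0"
      then have "X t = 0" "Y t = 0" by (simp_all add: sum_power2_eq_zero_iff)
      then show False using elim by (auto simp: X_def Y_def)
    qed
    then have Q: "Q t \<noteq> 0" using EQ by auto
    have "E t * num t = (X t * (D \<Lambda> t / 2 * v t + \<Lambda> t * D v t) - \<Lambda> t * v t * D X t) + W t * Q t"
      unfolding DX D\<Lambda> DE[OF t] DF[OF t] DG[OF t]
      unfolding num_def \<Lambda>_def W_def Q_def X_def
      by (rule curvature_form_algebra)
    also have "X t * (D \<Lambda> t / 2 * v t + \<Lambda> t * D v t) - \<Lambda> t * v t * D X t = q * (X t * Y' t - Y t * D X t)"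
      unfolding Y_def Y'_def q_def[symmetric] q(2) using q(1)
      by (simp add: field_simps power2_eq_square)
    finally have key: "E t * num t = q * (X t * Y' t - Y t * D X t) + W t * Q t" .
    have "sqrt (\<Lambda> t / t\<^sup>2) = q / t" using t by (simp add: q_def real_sqrt_divide)
    then have "(X t * Y' t - Y t * D X t) / ((X t)\<^sup>2 + (Y t)\<^sup>2) + (W t / t) / (E t * sqrt (\<Lambda> t / t\<^sup>2))
      = (q * (X t * Y' t - Y t * D X t) + W t * Q t) / (E t * q * Q t)"
      unfolding EQ using t q Q elim by (simp add: field_simps)
    also have "\<dots> = num t / (q * Q t)"
      unfolding key[symmetric] using elim q Q by (simp add: field_simps)
    finally show ?case by (simp add: q_def)
  qed
  from Lim_transform_eventually[OF lim this] show ?thesis by blast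
qed

section \<open>Second derivatives along curves and at minima\<close>

lemma deriv_on_compose:
  assumes "smooth_on U f" "open U" "smooth_on S x" "accessible S" "x ` S \<subseteq> U" "t \<in> S"
  shows "deriv_on S (\<lambda>s. f (x s)) t = frechet_derivative f (at (x t)) (deriv_on S x t)"
proof (rule deriv_on_eqI[OF assms(4,6)])
  have xt: "x t \<in> U" using assms by blast
  have "linear (frechet_derivative f (at (x t)))"
    using smooth_on_has_derivative[OF assms(1,2) xt] has_derivative_linear by blast
  then show "((\<lambda>s. f (x s)) has_vector_derivative frechet_derivative f (at (x t)) (deriv_on S x t)) (at t within S)"
    using smooth_on_has_derivative_compose[OF assms(1,2)
        deriv_on_has_vector_derivative[OF assms(3,6), unfolded has_vector_derivative_def] xt]
    by (simp add: has_vector_derivative_def linear_cmul)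
qed

lemma deriv_on_bounded_linear:
  assumes "bounded_linear L" "smooth_on S x" "accessible S" "t \<in> S"
  shows "deriv_on S (\<lambda>s. L (x s)) t = L (deriv_on S x t)"
  using deriv_on_eqI[OF assms(3,4) bounded_linear.has_vector_derivative[OF assms(1) deriv_on_has_vector_derivative[OF assms(2,4)]]] .

lemma deriv_on_cong:
  "(\<And>s. s \<in> S \<Longrightarrow> f s = g s) \<Longrightarrow> t \<in> S \<Longrightarrow> deriv_on S f t = deriv_on S g t"
  unfolding deriv_on_def using frechet_derivative_within_cong by metis

lemma linear_second_derivative1:
  assumes "smooth_on U f" "open U" "x \<in> U"
  shows "linear (\<lambda>a. second_derivative f x a b)"
  unfolding second_derivative_def
  by (rule has_derivative_linear[OF smooth_on_has_derivative[OF smooth_on_frechet[OF assms(1,2)] assms(2,3)]])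

lemma second_derivative_sym:
  fixes f :: "'a::euclidean_space \<Rightarrow> 'b::euclidean_space"
  assumes "smooth_on U f" "open U" "x \<in> U"
  shows "second_derivative f x a b = second_derivative f x b a"
  unfolding second_derivative_def by (rule symmetric_second_derivative[OF assms])

lemma deriv_on_compose2:
  fixes f :: "'a::euclidean_space \<Rightarrow> 'b::euclidean_space"
  assumes f: "smooth_on U f" and U: "open U" and x: "smooth_on S x" and S: "accessible S" "x ` S \<subseteq> U" "t \<in> S"
  shows "deriv_on S (deriv_on S (\<lambda>s. f (x s))) t =
    second_derivative f (x t) (deriv_on S x t) (deriv_on S x t) +
    frechet_derivative f (at (x t)) (deriv_on S (deriv_on S x) t)"
proof -
  let ?x' = "deriv_on S x" let ?P = "\<lambda>i y. frechet_derivative f (at y) i"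
  have lin: "linear (frechet_derivative f (at (x s)))" if "s \<in> S" for s
    using smooth_on_has_derivative[OF f U] has_derivative_linear S that by blast
  have xt: "x t \<in> U" using S by blast
  have "deriv_on S (deriv_on S (\<lambda>s. f (x s))) t = deriv_on S (\<lambda>s. \<Sum>i\<in>Basis. (?x' s \<bullet> i) *\<^sub>R ?P i (x s)) t"
    using deriv_on_compose[OF f U x S(1,2)] linear_expand[OF lin]
    by (intro deriv_on_cong S) metis
  also have "\<dots> = (\<Sum>i\<in>Basis. (?x' t \<bullet> i) *\<^sub>R frechet_derivative (?P i) (at (x t)) (?x' t)
      + (deriv_on S ?x' t \<bullet> i) *\<^sub>R ?P i (x t))"
  proof (rule deriv_on_eqI[OF S(1,3)])
    have sP: "smooth_on U (?P i)" for i using smooth_on_frechet[OF f U] .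
    have "((\<lambda>s. ?P i (x s)) has_vector_derivative frechet_derivative (?P i) (at (x t)) (?x' t)) (at t within S)" for i
      using deriv_on_has_vector_derivative[OF smooth_on_compose[OF S(1) x sP S(2)] S(3)]
        deriv_on_compose[OF sP U x S] by metis
    moreover have "((\<lambda>s. ?x' s \<bullet> i) has_vector_derivative deriv_on S ?x' t \<bullet> i) (at t within S)" for i
      by (rule bounded_linear.has_vector_derivative[OF bounded_linear_inner_left])
         (rule deriv_on_has_vector_derivative[OF smooth_on_deriv_on[OF x] S(3)])
    ultimately show "((\<lambda>s. \<Sum>i\<in>Basis. (?x' s \<bullet> i) *\<^sub>R ?P i (x s)) has_vector_derivative
      (\<Sum>i\<in>Basis. (?x' t \<bullet> i) *\<^sub>R frechet_derivative (?P i) (at (x t)) (?x' t)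
      + (deriv_on S ?x' t \<bullet> i) *\<^sub>R ?P i (x t))) (at t within S)"
      by (intro has_vector_derivative_sum has_vector_derivative_scaleR)
         (auto simp: has_real_derivative_iff_has_vector_derivative)
  qed
  also have "\<dots> = (\<Sum>i\<in>Basis. (?x' t \<bullet> i) *\<^sub>R second_derivative f (x t) (?x' t) i)
      + (\<Sum>i\<in>Basis. (deriv_on S ?x' t \<bullet> i) *\<^sub>R ?P i (x t))"
    by (simp add: sum.distrib second_derivative_def)
  also have "(\<Sum>i\<in>Basis. (?x' t \<bullet> i) *\<^sub>R second_derivative f (x t) (?x' t) i) =
      second_derivative f (x t) (?x' t) (?x' t)"
  proof -
    have "second_derivative f (x t) (?x' t) i = second_derivative f (x t) i (?x' t)" for i
      by (rule second_derivative_sym[OF f U xt])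
    then have "(\<Sum>i\<in>Basis. (?x' t \<bullet> i) *\<^sub>R second_derivative f (x t) (?x' t) i) =
        (\<Sum>i\<in>Basis. (?x' t \<bullet> i) *\<^sub>R second_derivative f (x t) i (?x' t))"
      by (intro sum.cong refl arg_cong2[where f="(*\<^sub>R)"])
    also have "\<dots> = second_derivative f (x t) (?x' t) (?x' t)"
      by (rule linear_expand[OF linear_second_derivative1[OF f U xt], symmetric])
    finally show ?thesis .
  qed
  also have "(\<Sum>i\<in>Basis. (deriv_on S ?x' t \<bullet> i) *\<^sub>R ?P i (x t)) =
      frechet_derivative f (at (x t)) (deriv_on S ?x' t)"
    by (rule linear_expand[OF lin[OF S(3)], symmetric])
  finally show ?thesis .
qed

lemma frechet_derivative_zero_at_min:
  fixes f :: "'a::euclidean_space \<Rightarrow> real"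
  assumes f: "smooth_on U f" and U: "open U" and x: "x \<in> U" and min: "\<And>y. y \<in> U \<Longrightarrow> f x \<le> f y"
  shows "frechet_derivative f (at x) v = 0"
  using differential_zero_maxmin[OF x U smooth_on_has_derivative[OF f U x]] min by metis

text \<open>Along the straight line in direction \<open>v\<close>, the value of the function divided by \<open>s\<^sup>2\<close> is nonnegative and
converges to half the second derivative.\<close>

lemma second_derivative_nonneg_at_min:
  fixes f :: "'a::euclidean_space \<Rightarrow> real"
  assumes f: "smooth_on U f" and U: "open U" and x: "x \<in> U" and nonneg: "\<And>y. y \<in> U \<Longrightarrow> 0 \<le> f y" and 0: "f x = 0"
  shows "second_derivative f x v v \<ge> 0"
proof -
  obtain r where r: "r > 0" "ball x r \<subseteq> U" using U x openE by blast
  define \<delta> where "\<delta> = r / (norm v + 1)"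
  have \<delta>: "\<delta> > 0" using r by (simp add: \<delta>_def add_nonneg_pos)
  let ?S = "{0..<\<delta>}" and ?c = "\<lambda>s. x + s *\<^sub>R v"
  have sub: "?c ` ?S \<subseteq> U"
  proof (rule image_subsetI)
    fix s assume s: "s \<in> ?S"
    have "s * norm v \<le> s * (norm v + 1)" using s by (intro mult_left_mono) auto
    also have "\<dots> < r" using s by (simp add: \<delta>_def pos_less_divide_eq add_nonneg_pos)
    finally have "?c s \<in> ball x r" using s by (simp add: dist_norm)
    then show "?c s \<in> U" using r by blast
  qed
  note acc = accessible_half_open[of \<delta>]
  have c: "smooth_on ?S ?c"
    by (intro smooth_on_add smooth_on_const smooth_on_bounded_linear[OF _ bounded_linear_scaleR_left]
        smooth_on_ident acc)
  have Dc: "deriv_on ?S ?c t = v" if "t \<in> ?S" for t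
    by (rule deriv_on_eqI[OF acc that]) (auto intro!: derivative_eq_intros simp: has_vector_derivative_def)
  have DDc: "deriv_on ?S (deriv_on ?S ?c) t = 0" if "t \<in> ?S" for t
  proof -
    have "deriv_on ?S (deriv_on ?S ?c) t = deriv_on ?S (\<lambda>_. v) t"
      by (rule deriv_on_cong[OF Dc that])
    also have "\<dots> = 0" by (rule deriv_on_eqI[OF acc that]) simp
    finally show ?thesis .
  qed
  have S0: "0 \<in> ?S" using \<delta> by simp
  let ?g = "\<lambda>s. f (?c s)"
  have g: "smooth_on ?S ?g" by (rule smooth_on_compose[OF acc c f sub])
  have "f x \<le> f y" if "y \<in> U" for y using nonneg[OF that] 0 by simp
  note min = frechet_derivative_zero_at_min[OF f U x this]
  have D1: "deriv_on ?S ?g 0 = 0"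
    using deriv_on_compose[OF f U c acc sub S0] min by simp
  have D2: "deriv_on ?S (deriv_on ?S ?g) 0 = second_derivative f x v v"
    using deriv_on_compose2[OF f U c acc sub S0] min Dc[OF S0] by simp
  have "((\<lambda>t. ?g t / t\<^sup>2) \<longlongrightarrow> second_derivative f x v v / 2) (at_right 0)"
    using quotient_square_tendsto_0[OF g \<delta> _ D1] D2 0 by simp
  moreover have "\<forall>\<^sub>F t in at_right 0. 0 \<le> ?g t / t\<^sup>2"
    using eventually_at_right_0_less[OF \<delta>]
  proof eventually_elim
    case (elim t)
    then have "t \<in> ?S" using elim by simp
    then have "?c t \<in> U" using sub by blast
    then show ?case using nonneg by simp
  qed
  ultimately have "0 \<le> second_derivative f x v v / 2"
    by (rule tendsto_lowerbound) simp
  then show ?thesis by simp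
qed

lemma psd_quadratic_form_pos:
  fixes p q r :: real
  assumes psd: "\<And>a b. 0 \<le> p * a\<^sup>2 + 2 * q * a * b + r * b\<^sup>2" and det: "p * r - q\<^sup>2 \<noteq> 0"
    and ab: "a \<noteq> 0 \<or> b \<noteq> 0"
  shows "0 < p * a\<^sup>2 + 2 * q * a * b + r * b\<^sup>2"
proof -
  have p: "p > 0"
  proof (rule ccontr)
    assume "\<not> p > 0"
    then have p0: "p = 0" using psd[of 1 0] by simp
    then have "q \<noteq> 0" using det by auto
    then show False using psd[of "- (r + 1) / (2 * q)" 1] p0 by (simp add: field_simps)
  qed
  \<comment> \<open>The form at \<open>(-q, p)\<close> is \<open>p\<close> times the determinant.\<close>
  have "0 \<le> p * (- q)\<^sup>2 + 2 * q * (- q) * p + r * p\<^sup>2" by (rule psd)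
  also have "\<dots> = p * (p * r - q\<^sup>2)" by (simp add: power2_eq_square algebra_simps)
  finally have d: "p * r - q\<^sup>2 > 0" using p det by (simp add: zero_le_mult_iff)
  have "p * (p * a\<^sup>2 + 2 * q * a * b + r * b\<^sup>2) = (p * a + q * b)\<^sup>2 + (p * r - q\<^sup>2) * b\<^sup>2"
    by (simp add: power2_eq_square algebra_simps)
  also have "\<dots> > 0"
  proof (cases "b = 0")
    case True then show ?thesis using ab p by simp
  next
    case False then show ?thesis using d by (intro add_nonneg_pos) auto
  qed
  finally show ?thesis using p by (simp add: zero_less_mult_iff)
qed

section \<open>The limit at a cross cap in coordinates\<close>

context metric2_on begin

text \<open>At a zero of the metric also \<open>dE = 0\<close> and \<open>dG = 0\<close>, because \<open>E\<close> and \<open>G\<close> are nonnegative. The Hessian of the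
Gram determinant is then \<open>-2 dF \<otimes> dF\<close>, which is degenerate; so a metric does not vanish at a cross cap.\<close>

lemma second_derivative_gram_det_zero:
  assumes q: "q \<in> U" and 0: "H q e1 e1 = 0" "H q e2 e2 = 0"
  shows "second_derivative (gram_det H) q a b = - 2 * dH q a e1 e2 * dH q b e1 e2"
proof -
  have F0: "H q e1 e2 = 0" using psd_null[OF q 0(1)] .
  have min: "dH q v e e = 0" if "H q e e = 0" for e v
    unfolding dH_def using frechet_derivative_zero_at_min[OF smooth openU q] psd that by metis
  have D: "(gram_det H has_derivative (\<lambda>b. dH y b e1 e1 * H y e2 e2 + H y e1 e1 * dH y b e2 e2
      - 2 * H y e1 e2 * dH y b e1 e2)) (at y)" if "y \<in> U" for y
    unfolding gram_det_def[abs_def]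
    by (rule has_derivative_eq_rhs)
       (rule derivative_intros has_derivative_H[OF that] refl | simp add: fun_eq_iff)+
  let ?f = "\<lambda>y. dH y b e1 e1 * H y e2 e2 + H y e1 e1 * dH y b e2 e2 - 2 * (H y e1 e2 * dH y b e1 e2)"
  have DdH: "((\<lambda>y. dH y b c d) has_derivative frechet_derivative (\<lambda>y. dH y b c d) (at q)) (at q)" for c d
    unfolding dH_def by (rule smooth_on_has_derivative[OF smooth_on_frechet[OF smooth openU] openU q])
  let ?dd = "\<lambda>c d. frechet_derivative (\<lambda>y. dH y b c d) (at q) a"
  have "(?f has_derivative (\<lambda>a.
     (dH q b e1 e1 * dH q a e2 e2 + frechet_derivative (\<lambda>y. dH y b e1 e1) (at q) a * H q e2 e2)
     + (H q e1 e1 * frechet_derivative (\<lambda>y. dH y b e2 e2) (at q) a + dH q a e1 e1 * dH q b e2 e2)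
     - 2 * (H q e1 e2 * frechet_derivative (\<lambda>y. dH y b e1 e2) (at q) a + dH q a e1 e2 * dH q b e1 e2))) (at q)"
    by (intro has_derivative_diff has_derivative_add has_derivative_mult has_derivative_mult_right
        DdH has_derivative_H[OF q])
  then have "((\<lambda>y. frechet_derivative (gram_det H) (at y) b) has_derivative (\<lambda>a.
     (dH q b e1 e1 * dH q a e2 e2 + frechet_derivative (\<lambda>y. dH y b e1 e1) (at q) a * H q e2 e2)
     + (H q e1 e1 * frechet_derivative (\<lambda>y. dH y b e2 e2) (at q) a + dH q a e1 e1 * dH q b e2 e2)
     - 2 * (H q e1 e2 * frechet_derivative (\<lambda>y. dH y b e1 e2) (at q) a + dH q a e1 e2 * dH q b e1 e2))) (at q)"
    by (rule has_derivative_transform_within_open[OF _ openU q])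
       (simp add: frechet_derivative_atI[OF D])
  from frechet_derivative_atI[OF this] show ?thesis
    unfolding second_derivative_def by (simp add: 0 F0 min)
qed

lemma geodesic_defect_conormal:
  fixes w z :: "real^2"
  assumes y: "y \<in> U"
  defines "E \<equiv> H y e1 e1" and "F \<equiv> H y e1 e2" and "G \<equiv> H y e2 e2"
  defines "u \<equiv> w$1" and "v \<equiv> w$2"
  defines "Eu \<equiv> dH y e1 e1 e1" and "Ev \<equiv> dH y e2 e1 e1" and "Fu \<equiv> dH y e1 e1 e2" and "Fv \<equiv> dH y e2 e1 e2"
    and "Gu \<equiv> dH y e1 e2 e2" and "Gv \<equiv> dH y e2 e2 e2"
  shows "geodesic_defect y w z (conormal H y w) = (E * G - F\<^sup>2) * (u * z$2 - v * z$1)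
      + (- (F * u + G * v)) * (Eu * u\<^sup>2 / 2 + Ev * u * v + (Fv - Gu / 2) * v\<^sup>2)
      + (E * u + F * v) * ((Fu - Ev / 2) * u\<^sup>2 + Gu * u * v + Gv * v\<^sup>2 / 2)"
proof -
  have c: "conormal H y w $ 1 = - (F * u + G * v)" "conormal H y w $ 2 = E * u + F * v"
    unfolding conormal_def H_components[OF y, of w]
    by (simp_all add: axis_def E_def F_def G_def u_def v_def algebra_simps)
  show ?thesis
    unfolding geodesic_defect_def first_kind_def H_components[OF y, of z] dH_components[OF y, of _ w]
      dH_components[OF y, of w] dH_components[OF y, of "conormal H y w"] c
    unfolding E_def[symmetric] F_def[symmetric] G_def[symmetric] u_def[symmetric] v_def[symmetric]
      Eu_def[symmetric] Ev_def[symmetric] Fu_def[symmetric] Fv_def[symmetric] Gu_def[symmetric] Gv_def[symmetric]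
    by (simp add: field_simps power2_eq_square)
qed

text \<open>With \<open>c = E\<close>, \<open>d = F\<close> and \<open>c = G\<close>, \<open>d = F\<close> respectively, these are the numerators of the connection forms of
the frames that start with \<open>\<partial>\<^sub>u\<close> and with \<open>\<partial>\<^sub>v\<close>.\<close>

lemma first_kind_frame:
  assumes "y \<in> U"
  shows "first_kind y (a *\<^sub>R e1 + b *\<^sub>R e2) e1 (c *\<^sub>R e2 - d *\<^sub>R e1) =
      a * (c * (dH y e1 e1 e2 - dH y e2 e1 e1 / 2) - d * dH y e1 e1 e1 / 2)
      + b * (c * dH y e1 e2 e2 - d * dH y e2 e1 e1) / 2"
    and "first_kind y (a *\<^sub>R e1 + b *\<^sub>R e2) e2 (c *\<^sub>R e1 - d *\<^sub>R e2) =
      b * (c * (dH y e2 e1 e2 - dH y e1 e2 e2 / 2) - d * dH y e2 e2 e2 / 2)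
      + a * (c * dH y e2 e1 e1 - d * dH y e1 e2 e2) / 2"
  by (simp_all add: first_kind_def dH_simps assms dH_sym[OF assms, of _ e2 e1] field_simps)

text \<open>The Hessian of the Gram determinant is positive semi-definite at its minimum \<open>q\<close> and nondegenerate,
hence positive definite, so the Gram determinant grows quadratically along the curve. One of the two
coordinate vectors is not null at \<open>q\<close>; it starts the frame to which \<open>scalar_curvature_converges\<close> is applied.\<close>

lemma curvature_density_converges:
  fixes x :: "real \<Rightarrow> real^2" and \<delta> :: real
  defines "D \<equiv> deriv_on {0..<\<delta>}" 
  assumes q: "q \<in> U" "gram_det H q = 0"
    and hess: "second_derivative (gram_det H) q e1 e1 * second_derivative (gram_det H) q e2 e2
        - (second_derivative (gram_det H) q e2 e1)\<^sup>2 \<noteq> 0"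
    and adm: "\<And>a b n. (\<And>w. H q n w = 0) \<Longrightarrow> first_kind q a b n = 0"
    and \<delta>: "0 < \<delta>" and x: "smooth_on {0..<\<delta>} x" "x ` {0..<\<delta>} \<subseteq> U" "x 0 = q" "D x 0 \<noteq> 0"
  shows "\<exists>L. ((\<lambda>t. curvature_density (x t) (D x t) (D (D x) t)) \<longlongrightarrow> L) (at_right 0)"
    and "\<forall>\<^sub>F t in at_right 0. gram_det H (x t) > 0"
proof -
  define d where "d = (deriv_on {0..<\<delta>} :: (real \<Rightarrow> real) \<Rightarrow> _)"
  note acc = accessible_half_open[of \<delta>]
  let ?S = "{0..<\<delta>}"
  have 0: "0 \<in> ?S" using \<delta> by simp
  let ?l = "gram_det H" let ?\<Lambda> = "\<lambda>t. ?l (x t)"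
  note sl = smooth_gram_det
  have "?l q \<le> ?l y" if "y \<in> U" for y using gram_det_nonneg[OF that] q by simp
  note dl = frechet_derivative_zero_at_min[OF sl openU q(1) this]
  have \<Lambda>: "smooth_on ?S ?\<Lambda>" by (rule smooth_on_compose[OF acc x(1) sl x(2)])
  have \<Lambda>0: "?\<Lambda> 0 = 0" "d ?\<Lambda> 0 = 0"
    using q x(3) deriv_on_compose[OF sl openU x(1) acc x(2) 0] dl by (simp_all add: D_def d_def)
  let ?h = "second_derivative ?l q"
  have hess_comp: "?h w w = ?h e1 e1 * (w$1)\<^sup>2 + 2 * ?h e2 e1 * w$1 * w$2 + ?h e2 e2 * (w$2)\<^sup>2" for w
  proof -
    note lin = linear_second_derivative1[OF sl openU q(1)]
    note sym = second_derivative_sym[OF sl openU q(1)]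
    have 1: "?h a b = a$1 * ?h e1 b + a$2 * ?h e2 b" for a b
    proof -
      have "?h a b = ?h (a$1 *\<^sub>R e1 + a$2 *\<^sub>R e2) b" using vec2_expand by metis
      then show ?thesis by (simp add: linear_add[OF lin] linear_cmul[OF lin])
    qed
    have "?h w w = w$1 * ?h w e1 + w$2 * ?h w e2" using 1[of w w] sym by metis
    then show ?thesis
      unfolding 1[of w e1] 1[of w e2] sym[of e1 e2] by (simp add: power2_eq_square algebra_simps)
  qed
  have psd_hess: "0 \<le> ?h e1 e1 * a\<^sup>2 + 2 * ?h e2 e1 * a * b + ?h e2 e2 * b\<^sup>2" for a b
  proof -
    let ?w = "a *\<^sub>R e1 + b *\<^sub>R e2"
    show ?thesis
      using second_derivative_nonneg_at_min[OF sl openU q(1) gram_det_nonneg q(2), of ?w] hess_comp[of ?w]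
      by simp
  qed
  have "D x 0 $ 1 \<noteq> 0 \<or> D x 0 $ 2 \<noteq> 0" using x(4) by (simp add: vec_eq_iff forall_2)
  from psd_quadratic_form_pos[OF psd_hess hess this] have "0 < ?h (D x 0) (D x 0)"
    using hess_comp[of "D x 0"] by simp
  then have \<Lambda>2: "d (d ?\<Lambda>) 0 > 0"
    using deriv_on_compose2[OF sl openU x(1) acc x(2) 0] dl x(3) by (simp add: D_def d_def)
  have "((\<lambda>t. ?\<Lambda> t / t\<^sup>2) \<longlongrightarrow> d (d ?\<Lambda>) 0 / 2) (at_right 0)"
    using quotient_square_tendsto_0[OF \<Lambda> \<delta>] \<Lambda>0 unfolding D_def d_def by simp
  from order_tendstoD(1)[OF this, of 0] eventually_at_right_0_less[OF \<delta>] \<Lambda>2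
  show "\<forall>\<^sub>F t in at_right 0. ?\<Lambda> t > 0"
    by (auto elim: eventually_elim2 simp: zero_less_divide_iff)
  define E where "E t = H (x t) e1 e1" for t
  define F where "F t = H (x t) e1 e2" for t
  define G where "G t = H (x t) e2 e2" for t
  define Eu where "Eu t = dH (x t) e1 e1 e1" for t
  define Ev where "Ev t = dH (x t) e2 e1 e1" for t
  define Fu where "Fu t = dH (x t) e1 e1 e2" for t
  define Fv where "Fv t = dH (x t) e2 e1 e2" for t
  define Gu where "Gu t = dH (x t) e1 e2 e2" for t
  define Gv where "Gv t = dH (x t) e2 e2 e2" for t
  define u where "u t = D x t $ 1" for t
  define v where "v t = D x t $ 2" for t
  note sm = smooth_on_H_along[OF acc x(1,2)]
  have sEFG: "smooth_on ?S E" "smooth_on ?S F" "smooth_on ?S G" "smooth_on ?S Eu" "smooth_on ?S Ev"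
    "smooth_on ?S Fu" "smooth_on ?S Fv" "smooth_on ?S Gu" "smooth_on ?S Gv"
    unfolding E_def[abs_def] F_def[abs_def] G_def[abs_def] Eu_def[abs_def] Ev_def[abs_def] Fu_def[abs_def]
      Fv_def[abs_def] Gu_def[abs_def] Gv_def[abs_def] by (rule sm)+
  have sDx: "smooth_on ?S (D x)" unfolding D_def d_def by (rule smooth_on_deriv_on[OF x(1)])
  have suv: "smooth_on ?S u" "smooth_on ?S v"
    unfolding u_def[abs_def] v_def[abs_def] by (intro smooth_on_nth acc sDx)+
  have DH: "d (\<lambda>t. H (x t) a b) t = dH (x t) e1 a b * u t + dH (x t) e2 a b * v t" if "0 < t" "t < \<delta>" for a b t
  proof -
    have t: "t \<in> ?S" "x t \<in> U" using that x(2) by auto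
    have "d (\<lambda>t. H (x t) a b) t = dH (x t) (D x t) a b"
      unfolding D_def d_def dH_def by (rule deriv_on_compose[OF smooth openU x(1) acc x(2) t(1)])
    also have "\<dots> = dH (x t) (D x t $ 1 *\<^sub>R e1 + D x t $ 2 *\<^sub>R e2) a b" using vec2_expand by metis
    finally show ?thesis by (simp add: dH_simps t u_def v_def algebra_simps)
  qed
  have Duv: "d u t = D (D x) t $ 1" "d v t = D (D x) t $ 2" if "t \<in> ?S" for t
    unfolding u_def[abs_def] v_def[abs_def] D_def d_def
    using deriv_on_bounded_linear[OF bounded_linear_vec_nth sDx[unfolded D_def d_def] acc that] by auto
  \<comment> \<open>The columns of the adjugate Gram matrix are null vectors at \<open>q\<close>, where the determinant vanishes.\<close>
  have null1: "H q (E 0 *\<^sub>R e2 - F 0 *\<^sub>R e1) w = 0" and null2: "H q (G 0 *\<^sub>R e1 - F 0 *\<^sub>R e2) w = 0" for w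
    using q(2) unfolding H_components[OF q(1), of _ w] E_def F_def G_def x(3)
    by (simp_all add: axis_def gram_det_def power2_eq_square algebra_simps)
  have Dx0: "D x 0 = u 0 *\<^sub>R e1 + v 0 *\<^sub>R e2" unfolding u_def v_def by (rule vec2_expand)
  have W1: "u 0 * (E 0 * (Fu 0 - Ev 0 / 2) - F 0 * Eu 0 / 2) + v 0 * (E 0 * Gu 0 - F 0 * Ev 0) / 2 = 0"
    using adm[OF null1, of "D x 0" e1] unfolding Dx0 first_kind_frame[OF q(1)]
    by (simp only: Eu_def Ev_def Fu_def Gu_def x(3))
  have W2: "v 0 * (G 0 * (Fv 0 - Gu 0 / 2) - F 0 * Gv 0 / 2) + u 0 * (G 0 * Ev 0 - F 0 * Gu 0) / 2 = 0"
    using adm[OF null2, of "D x 0" e2] unfolding Dx0 first_kind_frame[OF q(1)]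
    by (simp only: Gu_def Ev_def Fv_def Gv_def x(3))
  have \<Lambda>eq: "?\<Lambda> = (\<lambda>t. E t * G t - (F t)\<^sup>2)" "?\<Lambda> = (\<lambda>t. G t * E t - (F t)\<^sup>2)"
    by (auto simp: gram_det_def E_def F_def G_def)
  have \<Lambda>0': "E 0 * G 0 - (F 0)\<^sup>2 = 0" "G 0 * E 0 - (F 0)\<^sup>2 = 0"
    using \<Lambda>0(1) by (simp_all add: gram_det_def E_def F_def G_def mult.commute)
  have uv0: "u 0 \<noteq> 0 \<or> v 0 \<noteq> 0" "v 0 \<noteq> 0 \<or> u 0 \<noteq> 0"
    using x(4) by (auto simp: u_def v_def vec_eq_iff forall_2)
  have density: "curvature_density (x t) (D x t) (D (D x) t) =
      ((E t * G t - (F t)\<^sup>2) * (u t * d v t - v t * d u t)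
      + (- (F t * u t + G t * v t)) * (Eu t * (u t)\<^sup>2 / 2 + Ev t * u t * v t + (Fv t - Gu t / 2) * (v t)\<^sup>2)
      + (E t * u t + F t * v t) * ((Fu t - Ev t / 2) * (u t)\<^sup>2 + Gu t * u t * v t + Gv t * (v t)\<^sup>2 / 2))
      / (sqrt (E t * G t - (F t)\<^sup>2) * (E t * (u t)\<^sup>2 + 2 * F t * u t * v t + G t * (v t)\<^sup>2))"
    if "0 < t" "t < \<delta>" for t
  proof -
    have t: "t \<in> ?S" "x t \<in> U" using that x(2) by auto
    have Q: "H (x t) (D x t) (D x t) = E t * (u t)\<^sup>2 + 2 * F t * u t * v t + G t * (v t)\<^sup>2"
      unfolding H_components[OF t(2), of "D x t"]
      by (simp add: E_def F_def G_def u_def v_def power2_eq_square algebra_simps)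
    show ?thesis
      unfolding curvature_density_def geodesic_defect_conormal[OF t(2)] Q Duv[OF t(1)]
      by (simp only: gram_det_def E_def F_def G_def u_def v_def Eu_def Ev_def Fu_def Fv_def Gu_def Gv_def)
  qed
  have "E 0 > 0 \<or> G 0 > 0"
  proof (rule ccontr)
    assume "\<not> ?thesis"
    then have "H q e1 e1 = 0" "H q e2 e2 = 0"
      using psd[OF q(1), of e1] psd[OF q(1), of e2] by (auto simp: E_def G_def x(3))
    from second_derivative_gram_det_zero[OF q(1) this] hess show False
      by (simp add: power2_eq_square)
  qed
  then show "\<exists>L. ((\<lambda>t. curvature_density (x t) (D x t) (D (D x) t)) \<longlongrightarrow> L) (at_right 0)"
  proof
    assume pos: "E 0 > 0"
    have DEFG: "\<And>t. 0 < t \<Longrightarrow> t < \<delta> \<Longrightarrow> d E t = Eu t * u t + Ev t * v t"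
      "\<And>t. 0 < t \<Longrightarrow> t < \<delta> \<Longrightarrow> d F t = Fu t * u t + Fv t * v t"
      "\<And>t. 0 < t \<Longrightarrow> t < \<delta> \<Longrightarrow> d G t = Gu t * u t + Gv t * v t"
      using DH unfolding E_def[abs_def] F_def[abs_def] G_def[abs_def] Eu_def Ev_def Fu_def Fv_def Gu_def Gv_def
      by blast+
    obtain L where L: "((\<lambda>t. ((E t * G t - (F t)\<^sup>2) * (u t * d v t - v t * d u t)
      + (- (F t * u t + G t * v t)) * (Eu t * (u t)\<^sup>2 / 2 + Ev t * u t * v t + (Fv t - Gu t / 2) * (v t)\<^sup>2)
      + (E t * u t + F t * v t) * ((Fu t - Ev t / 2) * (u t)\<^sup>2 + Gu t * u t * v t + Gv t * (v t)\<^sup>2 / 2))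
      / (sqrt (E t * G t - (F t)\<^sup>2) * (E t * (u t)\<^sup>2 + 2 * F t * u t * v t + G t * (v t)\<^sup>2))) \<longlongrightarrow> L) (at_right 0)"
      using scalar_curvature_converges[OF \<delta> sEFG(1,2,3,4,5,6,8) suv DEFG[unfolded D_def d_def]
        \<Lambda>0'(1) \<Lambda>0(2)[unfolded \<Lambda>eq(1) D_def d_def] \<Lambda>2[unfolded \<Lambda>eq(1) D_def d_def] pos uv0(1) W1] unfolding D_def d_def by blast
    have "\<forall>\<^sub>F t in at_right 0. ((E t * G t - (F t)\<^sup>2) * (u t * d v t - v t * d u t)
      + (- (F t * u t + G t * v t)) * (Eu t * (u t)\<^sup>2 / 2 + Ev t * u t * v t + (Fv t - Gu t / 2) * (v t)\<^sup>2)
      + (E t * u t + F t * v t) * ((Fu t - Ev t / 2) * (u t)\<^sup>2 + Gu t * u t * v t + Gv t * (v t)\<^sup>2 / 2))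
      / (sqrt (E t * G t - (F t)\<^sup>2) * (E t * (u t)\<^sup>2 + 2 * F t * u t * v t + G t * (v t)\<^sup>2)) =
      curvature_density (x t) (D x t) (D (D x) t)"
      using eventually_at_right_0_less[OF \<delta>] by eventually_elim (simp only: density)
    from Lim_transform_eventually[OF L this] show ?thesis by blast
  next
    assume pos: "G 0 > 0"
    have DEFG: "\<And>t. 0 < t \<Longrightarrow> t < \<delta> \<Longrightarrow> d G t = Gv t * v t + Gu t * u t"
      "\<And>t. 0 < t \<Longrightarrow> t < \<delta> \<Longrightarrow> d F t = Fv t * v t + Fu t * u t"
      "\<And>t. 0 < t \<Longrightarrow> t < \<delta> \<Longrightarrow> d E t = Ev t * v t + Eu t * u t"
      using DH unfolding E_def[abs_def] F_def[abs_def] G_def[abs_def] Eu_def Ev_def Fu_def Fv_def Gu_def Gv_def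
      by (simp_all add: add.commute)
    obtain L where L: "((\<lambda>t. ((G t * E t - (F t)\<^sup>2) * (v t * d u t - u t * d v t)
      + (- (F t * v t + E t * u t)) * (Gv t * (v t)\<^sup>2 / 2 + Gu t * v t * u t + (Fu t - Ev t / 2) * (u t)\<^sup>2)
      + (G t * v t + F t * u t) * ((Fv t - Gu t / 2) * (v t)\<^sup>2 + Ev t * v t * u t + Eu t * (u t)\<^sup>2 / 2))
      / (sqrt (G t * E t - (F t)\<^sup>2) * (G t * (v t)\<^sup>2 + 2 * F t * v t * u t + E t * (u t)\<^sup>2))) \<longlongrightarrow> L) (at_right 0)"
      using scalar_curvature_converges[OF \<delta> sEFG(3,2,1,9,8,7,5) suv(2,1) DEFG[unfolded D_def d_def]
        \<Lambda>0'(2) \<Lambda>0(2)[unfolded \<Lambda>eq(2) D_def d_def] \<Lambda>2[unfolded \<Lambda>eq(2) D_def d_def] pos uv0(2) W2] unfolding D_def d_def by blast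
    \<comment> \<open>Exchanging the coordinates reverses the orientation, whence the sign.\<close>
    have "\<forall>\<^sub>F t in at_right 0. - (((G t * E t - (F t)\<^sup>2) * (v t * d u t - u t * d v t)
      + (- (F t * v t + E t * u t)) * (Gv t * (v t)\<^sup>2 / 2 + Gu t * v t * u t + (Fu t - Ev t / 2) * (u t)\<^sup>2)
      + (G t * v t + F t * u t) * ((Fv t - Gu t / 2) * (v t)\<^sup>2 + Ev t * v t * u t + Eu t * (u t)\<^sup>2 / 2))
      / (sqrt (G t * E t - (F t)\<^sup>2) * (G t * (v t)\<^sup>2 + 2 * F t * v t * u t + E t * (u t)\<^sup>2))) =
      curvature_density (x t) (D x t) (D (D x) t)"
      using eventually_at_right_0_less[OF \<delta>]
    proof eventually_elim
      case (elim t)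
      then show ?case unfolding density[OF conjunct1[OF elim] conjunct2[OF elim]] minus_divide_left
        by (intro arg_cong2[where f="(/)"] arg_cong2[where f="(*)"] arg_cong[where f=sqrt])
           (simp_all add: field_simps)
    qed
    from Lim_transform_eventually[OF tendsto_minus[OF L] this] show ?thesis by blast
  qed
qed

end

section \<open>Smooth bump functions\<close>

text \<open>These functions are closed under differentiation up to linear combinations, which gives smoothness
of all of them by one induction.\<close>

definition flat_exp :: "nat \<Rightarrow> real \<Rightarrow> real" where
  "flat_exp n t = (if t \<le> 0 then 0 else (1 / t) ^ n * exp (- (1 / t)))"

lemma flat_exp_tendsto_0: "(flat_exp n \<longlongrightarrow> 0) (at 0)"
proof -
  have "((\<lambda>t. (inverse t) ^ n / exp (inverse t)) \<longlongrightarrow> 0) (at_right (0::real))"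
    using filterlim_compose[OF tendsto_power_div_exp_0 filterlim_inverse_at_top_right] .
  moreover have "\<forall>\<^sub>F t in at_right 0. (inverse t) ^ n / exp (inverse t) = flat_exp n t"
    using eventually_at_right_0_less[OF zero_less_one]
    by eventually_elim (simp add: flat_exp_def exp_minus field_simps)
  ultimately have "((\<lambda>t. flat_exp n t) \<longlongrightarrow> 0) (at_right 0)"
    by (rule Lim_transform_eventually)
  moreover have "((\<lambda>t. flat_exp n t) \<longlongrightarrow> 0) (at_left 0)"
    by (rule tendsto_eventually) (auto simp: eventually_at_left_field flat_exp_def intro: exI[of _ "-1"])
  ultimately show ?thesis by (simp add: filterlim_split_at)
qed

lemma flat_exp_DERIV:
  "(flat_exp n has_real_derivative flat_exp (n + 2) t - real n * flat_exp (n + 1) t) (at t)"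
proof -
  consider "t < 0" | "t = 0" | "t > 0" by linarith
  then show ?thesis
  proof cases
    case 1
    have "((\<lambda>_. 0) has_real_derivative 0) (at t)" by simp
    then have "(flat_exp n has_real_derivative 0) (at t)"
      by (rule has_field_derivative_transform_within_open[of _ _ _ "{..<0}"])
         (use 1 in \<open>auto simp: flat_exp_def\<close>)
    then show ?thesis using 1 by (simp add: flat_exp_def)
  next
    case 2
    have "((\<lambda>h. (flat_exp n (0 + h) - flat_exp n 0) / h) \<longlongrightarrow> 0) (at 0)"
      by (rule Lim_transform_eventually[OF flat_exp_tendsto_0[of "n + 1"]])
         (auto simp: flat_exp_def eventually_at_filter)
    then show ?thesis using 2 by (simp add: DERIV_def flat_exp_def)
  next
    case 3
    have "((\<lambda>t. (1 / t) ^ n * exp (- (1 / t))) has_real_derivative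
        (1 / t) ^ (n + 2) * exp (- (1 / t)) - real n * ((1 / t) ^ (n + 1) * exp (- (1 / t)))) (at t)"
    proof (rule DERIV_cong)
      have "((\<lambda>s. s ^ n * exp (- s)) has_real_derivative
          real n * s ^ (n - 1) * exp (- s) - s ^ n * exp (- s)) (at s)" for s :: real
        by (auto intro!: derivative_eq_intros)
      moreover have "((\<lambda>t. 1 / t) has_real_derivative - ((1 / t)\<^sup>2)) (at t)"
        using 3 by (auto intro!: derivative_eq_intros simp: power2_eq_square)
      ultimately show "((\<lambda>t. (1 / t) ^ n * exp (- (1 / t))) has_real_derivative
          (real n * (1 / t) ^ (n - 1) * exp (- (1 / t)) - (1 / t) ^ n * exp (- (1 / t))) * - ((1 / t)\<^sup>2)) (at t)"
        by (rule DERIV_chain2)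
      show "(real n * (1 / t) ^ (n - 1) * exp (- (1 / t)) - (1 / t) ^ n * exp (- (1 / t))) * - ((1 / t)\<^sup>2) =
          (1 / t) ^ (n + 2) * exp (- (1 / t)) - real n * ((1 / t) ^ (n + 1) * exp (- (1 / t)))"
        by (cases n) (simp_all add: power2_eq_square algebra_simps add_divide_distrib)
    qed
    then have "(flat_exp n has_real_derivative
        (1 / t) ^ (n + 2) * exp (- (1 / t)) - real n * ((1 / t) ^ (n + 1) * exp (- (1 / t)))) (at t)"
      by (rule has_field_derivative_transform_within_open[of _ _ _ "{0<..}"])
         (use 3 in \<open>auto simp: flat_exp_def\<close>)
    then show ?thesis using 3 by (simp add: flat_exp_def)
  qed
qed

lemma smooth_on_flat_exp: "smooth_on UNIV (flat_exp n)"
proof -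
  have acc: "accessible (UNIV :: real set)" by (simp add: accessible_open)
  have "Ck_on k UNIV (flat_exp n)" for k
  proof (induction k arbitrary: n)
    case 0
    have "isCont (flat_exp n) t" for t by (rule DERIV_isCont[OF flat_exp_DERIV])
    then show ?case by (simp add: continuous_at_imp_continuous_on)
  next
    case (Suc k)
    show ?case
    proof (rule Ck_on_SucI[OF acc])
      show "(flat_exp n has_derivative (\<lambda>v. (flat_exp (n + 2) t + - real n * flat_exp (n + 1) t) * v))
          (at t within UNIV)" for t
        using flat_exp_DERIV[of n t] by (simp add: has_field_derivative_def)
      show "Ck_on k UNIV (\<lambda>t. (flat_exp (n + 2) t + - real n * flat_exp (n + 1) t) * v)" for v
        by (intro Ck_on_add[OF acc] Ck_on_bilinear[OF acc bounded_bilinear_mult] Ck_on_const[OF acc] Suc)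
    qed
  qed
  then show ?thesis by (simp add: smooth_on_def)
qed

text \<open>The derivative of the bump function at its centre is required to vanish, so that multiplication by it
does not change first derivatives there.\<close>

lemma smooth_bump:
  fixes x0 :: "'a::euclidean_space"
  assumes "r > 0"
  obtains \<beta> :: "'a \<Rightarrow> real" where "smooth_on UNIV \<beta>" "\<beta> x0 = 1" "(\<beta> has_derivative (\<lambda>_. 0)) (at x0)"
    "\<And>x. x \<notin> ball x0 r \<Longrightarrow> \<beta> x = 0"
proof
  have acc: "accessible (UNIV :: 'a set)" by (simp add: accessible_open)
  define k where "k = flat_exp 0 (r\<^sup>2)"
  define \<beta> where "\<beta> x = flat_exp 0 (r\<^sup>2 - (x - x0) \<bullet> (x - x0)) * (1 / k)" for x
  have k: "k > 0" using assms by (simp add: k_def flat_exp_def)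
  show "smooth_on UNIV \<beta>"
    unfolding \<beta>_def
    by (intro smooth_on_mult smooth_on_compose[OF acc _ smooth_on_flat_exp] smooth_on_diff smooth_on_const
        smooth_on_bilinear[OF acc bounded_bilinear_inner] smooth_on_ident acc) auto
  show "\<beta> x0 = 1" using k by (simp add: \<beta>_def k_def)
  have "((\<lambda>x. r\<^sup>2 - (x - x0) \<bullet> (x - x0)) has_derivative (\<lambda>_. 0)) (at x0)"
    by (auto intro!: derivative_eq_intros)
  moreover have "(flat_exp 0 has_derivative (*) (flat_exp 2 t)) (at t)" for t
    using flat_exp_DERIV[of 0 t] by (simp add: has_field_derivative_def numeral_2_eq_2)
  ultimately have "((\<lambda>x. flat_exp 0 (r\<^sup>2 - (x - x0) \<bullet> (x - x0))) has_derivative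
      (\<lambda>_. flat_exp 2 (r\<^sup>2 - (x0 - x0) \<bullet> (x0 - x0)) * 0)) (at x0)"
    by (rule has_derivative_compose)
  from has_derivative_mult_left[OF this, of "1 / k"]
  show "(\<beta> has_derivative (\<lambda>_. 0)) (at x0)" unfolding \<beta>_def by simp
  show "\<beta> x = 0" if "x \<notin> ball x0 r" for x
  proof -
    have "r\<^sup>2 \<le> (norm (x - x0))\<^sup>2"
      using that assms by (intro power_mono) (auto simp: dist_norm norm_minus_commute)
    then show ?thesis by (simp add: \<beta>_def flat_exp_def power2_norm_eq_inner)
  qed
qed

section \<open>Charts of a surface\<close>

locale smooth_surface =
  fixes A :: "'m::{t2_space,second_countable_topology} chart set"
  assumes smooth_structure: "smooth_structure A"
begin

lemma chart: 
  assumes "c \<in> A"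
  shows open_cdom: "open (cdom c)" and open_cimg: "open (cimg c)"
    and cinv_cmap: "q \<in> cdom c \<Longrightarrow> cinv c (cmap c q) = q"
    and cmap_cinv: "x \<in> cimg c \<Longrightarrow> cmap c (cinv c x) = x"
    and cinv_in: "x \<in> cimg c \<Longrightarrow> cinv c x \<in> cdom c"
    and cmap_in: "q \<in> cdom c \<Longrightarrow> cmap c q \<in> cimg c"
    and continuous_cmap: "continuous_on (cdom c) (cmap c)"
    and continuous_cinv: "continuous_on (cimg c) (cinv c)"
proof -
  have "is_chart c" using smooth_structure assms unfolding smooth_structure_def by blast
  then have o: "open (cdom c)" "open (cimg c)" and h: "homeomorphism (cdom c) (cimg c) (cmap c) (cinv c)"
    unfolding is_chart_def by auto
  show "open (cdom c)" "open (cimg c)" by (rule o)+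
  show "q \<in> cdom c \<Longrightarrow> cinv c (cmap c q) = q" "x \<in> cimg c \<Longrightarrow> cmap c (cinv c x) = x"
    "x \<in> cimg c \<Longrightarrow> cinv c x \<in> cdom c" "q \<in> cdom c \<Longrightarrow> cmap c q \<in> cimg c"
    "continuous_on (cdom c) (cmap c)" "continuous_on (cimg c) (cinv c)"
    using h unfolding homeomorphism_def by auto
qed

definition overlap :: "'m chart \<Rightarrow> 'm chart \<Rightarrow> (real^2) set" where
  "overlap c d = cmap c ` (cdom c \<inter> cdom d)"

lemma overlap_eq: "c \<in> A \<Longrightarrow> overlap c d = cimg c \<inter> cinv c -` cdom d"
  unfolding overlap_def using cinv_cmap cmap_cinv cinv_in by force

lemma open_overlap: "c \<in> A \<Longrightarrow> d \<in> A \<Longrightarrow> open (overlap c d)"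
  unfolding overlap_eq
  by (rule continuous_open_preimage[OF continuous_cinv open_cimg open_cdom])

lemma smooth_transition: "c \<in> A \<Longrightarrow> d \<in> A \<Longrightarrow> smooth_on (overlap c d) (transition c d)"
  using smooth_structure unfolding smooth_structure_def compatible_def overlap_def by blast

lemma transition_cmap: "c \<in> A \<Longrightarrow> q \<in> cdom c \<Longrightarrow> transition c d (cmap c q) = cmap d q"
  by (simp add: transition_def cinv_cmap)

abbreviation jac :: "'m chart \<Rightarrow> 'm chart \<Rightarrow> 'm \<Rightarrow> real^2 \<Rightarrow> real^2" where
  "jac c d q \<equiv> frechet_derivative (transition c d) (at (cmap c q))"

lemma has_derivative_transition:
  assumes "c \<in> A" "d \<in> A" "q \<in> cdom c" "q \<in> cdom d"
  shows "(transition c d has_derivative jac c d q) (at (cmap c q))"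
  by (rule smooth_on_has_derivative[OF smooth_transition[OF assms(1,2)] open_overlap[OF assms(1,2)]])
     (use assms in \<open>auto simp: overlap_def\<close>)

lemma linear_jac:
  assumes "c \<in> A" "d \<in> A" "q \<in> cdom c" "q \<in> cdom d"
  shows "linear (jac c d q)"
  using has_derivative_transition[OF assms] has_derivative_linear by blast

lemma jac_compose:
  assumes "c \<in> A" "d \<in> A" "e \<in> A" "q \<in> cdom c" "q \<in> cdom d" "q \<in> cdom e"
  shows "jac d e q (jac c d q a) = jac c e q a"
proof -
  have "(transition d e has_derivative jac d e q) (at (transition c d (cmap c q)))"
    using has_derivative_transition[OF assms(2,3,5,6)] by (simp add: transition_cmap assms)
  from has_derivative_compose[OF has_derivative_transition[OF assms(1,2,4,5)] this]
  have "((\<lambda>x. transition d e (transition c d x)) has_derivative (\<lambda>a. jac d e q (jac c d q a))) (at (cmap c q))" .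
  then have "(transition c e has_derivative (\<lambda>a. jac d e q (jac c d q a))) (at (cmap c q))"
  proof (rule has_derivative_transform_within_open)
    show "open (overlap c d)" by (rule open_overlap[OF assms(1,2)])
    show "cmap c q \<in> overlap c d" using assms by (auto simp: overlap_def)
    show "transition d e (transition c d x) = transition c e x" if "x \<in> overlap c d" for x
      using that assms by (auto simp: overlap_def transition_cmap)
  qed
  from frechet_derivative_atI[OF this] show ?thesis by simp
qed

lemma jac_same:
  assumes "c \<in> A" "q \<in> cdom c" shows "jac c c q a = a"
proof -
  have "((\<lambda>x. x) has_derivative (\<lambda>a. a)) (at (cmap c q))" by simp
  then have "(transition c c has_derivative (\<lambda>a. a)) (at (cmap c q))"
    by (rule has_derivative_transform_within_open[OF _ open_cimg[OF assms(1)]])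
       (use assms in \<open>auto simp: transition_cmap\<close>)
  from frechet_derivative_atI[OF this] show ?thesis by simp
qed

lemma jac_inverse:
  assumes "c \<in> A" "d \<in> A" "q \<in> cdom c" "q \<in> cdom d"
  shows "jac d c q (jac c d q a) = a"
  using jac_compose[OF assms(1,2,1,3,4,3)] jac_same[OF assms(1,3)] by simp

lemma det_jac_nonzero:
  assumes "c \<in> A" "d \<in> A" "q \<in> cdom c" "q \<in> cdom d"
  shows "det (matrix (jac c d q)) \<noteq> 0"
proof -
  have "matrix (jac d c q) ** matrix (jac c d q) = matrix (jac d c q \<circ> jac c d q)"
    by (rule matrix_compose[symmetric]) (use linear_jac assms in auto)
  also have "jac d c q \<circ> jac c d q = (\<lambda>a. a)" using jac_inverse[OF assms] by (simp add: fun_eq_iff)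
  also have "matrix (\<lambda>a::real^2. a) = mat 1" by (simp add: matrix_def mat_def axis_def vec_eq_iff)
  finally have "det (matrix (jac d c q)) * det (matrix (jac c d q)) = 1"
    by (metis det_mul det_I)
  then show ?thesis by auto
qed

lemma chart_at: "chart_at A q \<in> A" "q \<in> cdom (chart_at A q)"
proof -
  have "\<exists>c. c \<in> A \<and> q \<in> cdom c" using smooth_structure unfolding smooth_structure_def by blast
  from someI_ex[OF this] show "chart_at A q \<in> A" "q \<in> cdom (chart_at A q)"
    unfolding chart_at_def by auto
qed

lemma tangent_vector_jac: "tangent_vector A c q = jac c (chart_at A q) q"
  by (simp add: tangent_vector_def fun_eq_iff)

lemma components_jac: "components A c q = jac (chart_at A q) c q"
  by (simp add: components_def fun_eq_iff)

lemma linear_tangent_vector: "c \<in> A \<Longrightarrow> q \<in> cdom c \<Longrightarrow> linear (tangent_vector A c q)"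
  unfolding tangent_vector_jac using linear_jac chart_at by blast

lemma linear_components: "c \<in> A \<Longrightarrow> q \<in> cdom c \<Longrightarrow> linear (components A c q)"
  unfolding components_jac using linear_jac chart_at by blast

lemma components_tangent_vector:
  "c \<in> A \<Longrightarrow> d \<in> A \<Longrightarrow> q \<in> cdom c \<Longrightarrow> q \<in> cdom d \<Longrightarrow>
    components A d q (tangent_vector A c q a) = jac c d q a"
  unfolding components_jac tangent_vector_jac using jac_compose chart_at by blast

lemma tangent_vector_components:
  "c \<in> A \<Longrightarrow> q \<in> cdom c \<Longrightarrow> tangent_vector A c q (components A c q v) = v"
  unfolding components_jac tangent_vector_jac using jac_inverse chart_at by blast

lemma tangent_vector_jac_transform:
  "c \<in> A \<Longrightarrow> d \<in> A \<Longrightarrow> q \<in> cdom c \<Longrightarrow> q \<in> cdom d \<Longrightarrow>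
    tangent_vector A d q (jac c d q a) = tangent_vector A c q a"
  unfolding tangent_vector_jac using jac_compose chart_at by blast

lemma tangent_vector_chart_at: "tangent_vector A (chart_at A q) q a = a"
  unfolding tangent_vector_jac using jac_same chart_at by blast

end

section \<open>Metrics on a surface\<close>

definition chart_metric ::
  "'m chart set \<Rightarrow> 'm metric_tensor \<Rightarrow> 'm chart \<Rightarrow> real^2 \<Rightarrow> real^2 \<Rightarrow> real^2 \<Rightarrow> real" where
  "chart_metric A g c x a b =
    g (cinv c x) (tangent_vector A c (cinv c x) a) (tangent_vector A c (cinv c x) b)"

locale psd_surface = smooth_surface A for A :: "'m::{t2_space,second_countable_topology} chart set" +
  fixes g :: "'m metric_tensor"
  assumes psd_metric: "psd_metric A g"
begin

abbreviation "CM \<equiv> chart_metric A g"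

lemma chart_metric_cmap:
  "c \<in> A \<Longrightarrow> q \<in> cdom c \<Longrightarrow> CM c (cmap c q) a b = g q (tangent_vector A c q a) (tangent_vector A c q b)"
  by (simp add: chart_metric_def cinv_cmap)

lemma coeff_eq: "coeff A g c i j = (\<lambda>x. CM c x (axis i 1) (axis j 1))"
  by (simp add: coeff_def chart_metric_def coord_vector_def fun_eq_iff Let_def)

lemma lam_eq: "lam A g c = gram_det (CM c)"
  by (simp add: lam_def gram_det_def coeff_eq fun_eq_iff)

lemma linear_g1: "linear (\<lambda>v. g q v w)" and linear_g2: "linear (g q v)"
  and g_sym: "g q v w = g q w v" and g_psd: "0 \<le> g q v v"
  using psd_metric unfolding psd_metric_def bilinear_def by auto

lemma metric2_on_chart:
  assumes c: "c \<in> A" shows "metric2_on (cimg c) (CM c)"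
proof unfold_locales
  show "open (cimg c)" by (rule open_cimg[OF c])
  show bil: "bilinear (CM c x)" if "x \<in> cimg c" for x
  proof -
    have lin: "linear (tangent_vector A c (cinv c x))"
      using linear_tangent_vector cinv_in c that by blast
    show ?thesis unfolding bilinear_def chart_metric_def
      using linear_compose[OF lin linear_g1] linear_compose[OF lin linear_g2] by (simp add: o_def)
  qed
  show "CM c x a b = CM c x b a" for x a b by (simp add: chart_metric_def g_sym)
  show "0 \<le> CM c x a a" for x a by (simp add: chart_metric_def g_psd)
  fix a b
  have acc: "accessible (cimg c)" using accessible_open open_cimg c by blast
  have "smooth_on (cimg c) (\<lambda>x. \<Sum>i\<in>UNIV. \<Sum>j\<in>UNIV. (a$i * b$j) * coeff A g c i j x)"
    using psd_metric c unfolding psd_metric_def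
    by (intro smooth_on_sum smooth_on_mult smooth_on_const acc) blast
  moreover have "CM c x a b = (\<Sum>i\<in>UNIV. \<Sum>j\<in>UNIV. (a$i * b$j) * coeff A g c i j x)" if "x \<in> cimg c" for x
  proof -
    have l: "linear (\<lambda>a. CM c x a b)" "linear (CM c x a)" for a b using bil[OF that] unfolding bilinear_def by auto
    have "CM c x a b = CM c x (a$1 *\<^sub>R e1 + a$2 *\<^sub>R e2) (b$1 *\<^sub>R e1 + b$2 *\<^sub>R e2)"
      using vec2_expand by metis
    then show ?thesis
      by (simp add: sum_2 coeff_eq linear_add[OF l(1)] linear_add[OF l(2)] linear_cmul[OF l(1)]
          linear_cmul[OF l(2)] algebra_simps)
  qed
  ultimately show "smooth_on (cimg c) (\<lambda>x. CM c x a b)"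
    by (subst smooth_on_cong[where g="\<lambda>x. \<Sum>i\<in>UNIV. \<Sum>j\<in>UNIV. (a$i * b$j) * coeff A g c i j x"]) auto
qed

text \<open>The components of a tangent vector in two charts are related by the Jacobian of the transition map, so
the metric in one chart is the pullback of the metric in the other.\<close>

lemma coordinate_change2_transition:
  assumes c: "c \<in> A" and d: "d \<in> A"
  shows "coordinate_change2 (cimg c) (CM c) (cimg d) (CM d) (transition c d) (overlap c d)"
proof -
  interpret M: metric2_on "cimg c" "CM c" by (rule metric2_on_chart[OF c])
  interpret N: metric2_on "cimg d" "CM d" by (rule metric2_on_chart[OF d])
  show ?thesis
  proof unfold_locales
    show "smooth_on (overlap c d) (transition c d)" by (rule smooth_transition[OF c d])
    show "open (overlap c d)" by (rule open_overlap[OF c d])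
    show "overlap c d \<subseteq> cimg c" by (auto simp: overlap_def)
    show "transition c d ` overlap c d \<subseteq> cimg d" by (auto simp: overlap_def transition_cmap c)
    fix x a b assume "x \<in> overlap c d"
    then obtain q where q: "q \<in> cdom c" "q \<in> cdom d" "x = cmap c q" by (auto simp: overlap_def)
    show "CM c x a b = CM d (transition c d x) (frechet_derivative (transition c d) (at x) a)
        (frechet_derivative (transition c d) (at x) b)"
      unfolding q(3) transition_cmap[OF c q(1)] chart_metric_cmap[OF c q(1)] chart_metric_cmap[OF d q(2)]
        tangent_vector_jac_transform[OF c d q(1,2)] ..
  qed
qed

text \<open>Null vectors of the metric correspond to null vectors of its Gram matrix; the matrix is symmetric of
size two, and if its determinant vanishes, then \<open>E \<partial>\<^sub>v - F \<partial>\<^sub>u\<close> or, for \<open>E = 0\<close>, \<open>\<partial>\<^sub>u\<close> is null.\<close>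

lemma singular_point_iff:
  assumes c: "c \<in> A" and q: "q \<in> cdom c"
  shows "singular_point g q \<longleftrightarrow> gram_det (CM c) (cmap c q) = 0"
proof -
  interpret M: metric2_on "cimg c" "CM c" by (rule metric2_on_chart[OF c])
  let ?x = "cmap c q" let ?H = "CM c ?x"
  have x: "?x \<in> cimg c" using q by blast
  have lin: "linear (tangent_vector A c q)" using linear_tangent_vector c q by blast
  have "0 \<in> null_space g q" by (simp add: null_space_def linear_0[OF linear_g1])
  then have "singular_point g q \<longleftrightarrow> (\<exists>v. v \<noteq> 0 \<and> (\<forall>w. g q v w = 0))"
    unfolding singular_point_def null_space_def by blast
  also have "\<dots> \<longleftrightarrow> (\<exists>n. n \<noteq> 0 \<and> (\<forall>w. ?H n w = 0))"
  proof
    assume "\<exists>v. v \<noteq> 0 \<and> (\<forall>w. g q v w = 0)"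
    then obtain v where v: "v \<noteq> 0" "\<forall>w. g q v w = 0" by blast
    let ?n = "components A c q v"
    have vn: "v = tangent_vector A c q ?n" by (simp add: tangent_vector_components c q)
    have "?n \<noteq> 0" using v(1) vn linear_0[OF lin] by metis
    moreover have "?H ?n w = 0" for w
      using v(2) vn by (simp add: chart_metric_cmap c q)
    ultimately show "\<exists>n. n \<noteq> 0 \<and> (\<forall>w. ?H n w = 0)" by blast
  next
    assume "\<exists>n. n \<noteq> 0 \<and> (\<forall>w. ?H n w = 0)"
    then obtain n where n: "n \<noteq> 0" "\<forall>w. ?H n w = 0" by blast
    let ?v = "tangent_vector A c q n"
    have "components A c q ?v = n" by (simp add: components_tangent_vector c q jac_same)
    then have "?v \<noteq> 0" using n(1) linear_0[OF linear_components[OF c q]] by metis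
    moreover have "g q ?v w = 0" for w
      using n(2) chart_metric_cmap[OF c q, of n "components A c q w"]
      by (simp add: tangent_vector_components c q)
    ultimately show "\<exists>v. v \<noteq> 0 \<and> (\<forall>w. g q v w = 0)" by blast
  qed
  also have "\<dots> \<longleftrightarrow> gram_det (CM c) ?x = 0"
  proof
    assume "\<exists>n. n \<noteq> 0 \<and> (\<forall>w. ?H n w = 0)"
    then obtain n where n: "n \<noteq> 0" "\<forall>w. ?H n w = 0" by blast
    show "gram_det (CM c) ?x = 0"
      by (rule M.gram_det_eq_0_if_null_vector[OF x n(1)]) (use n(2) in blast)
  next
    assume 0: "gram_det (CM c) ?x = 0"
    show "\<exists>n. n \<noteq> 0 \<and> (\<forall>w. ?H n w = 0)"
    proof (cases "?H e1 e1 = 0")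
      case True
      then show ?thesis using M.psd_null[OF x True] by (intro exI[of _ e1]) (auto simp: axis_eq_0_iff)
    next
      case False
      let ?n = "?H e1 e1 *\<^sub>R e2 - ?H e1 e2 *\<^sub>R e1"
      have "?n $ 2 \<noteq> 0" using False by simp
      then have "?n \<noteq> 0" by (metis zero_index)
      moreover have "?H ?n w = w$2 * gram_det (CM c) ?x" for w
        unfolding M.H_components[OF x, of ?n] by (simp add: gram_det_def power2_eq_square algebra_simps)
      ultimately show ?thesis using 0 by (intro exI[of _ ?n]) simp
    qed
  qed
  finally show ?thesis .
qed

end

section \<open>Admissibility in terms of Christoffel symbols\<close>

context psd_surface begin

abbreviation "first_kind_in c \<equiv> metric_on.first_kind (CM c)"

definition localized_field :: "'m chart \<Rightarrow> (real^2 \<Rightarrow> real) \<Rightarrow> real^2 \<Rightarrow> 'm \<Rightarrow> real^2" where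
  "localized_field c \<beta> b q = (if q \<in> cdom c then \<beta> (cmap c q) *\<^sub>R tangent_vector A c q b else 0)"

lemma local_rep_localized_field:
  assumes "c \<in> A" "d \<in> A" "q \<in> cdom c" "q \<in> cdom d"
  shows "local_rep A d (localized_field c \<beta> b) (cmap d q) = \<beta> (cmap c q) *\<^sub>R jac c d q b"
  using linear_cmul[OF linear_components[OF assms(2,4)]] components_tangent_vector[OF assms]
  by (simp add: local_rep_def localized_field_def cinv_cmap assms)

text \<open>Outside the chart domain the field vanishes near every point, because the compact set that carries
it is closed in the Hausdorff space.\<close>

lemma smooth_localized_field:
  assumes c: "c \<in> A" and \<beta>: "smooth_on UNIV \<beta>"
    and K: "compact K" "K \<subseteq> cimg c" "\<And>x. x \<notin> K \<Longrightarrow> \<beta> x = 0"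
  shows "smooth_vector_field A (localized_field c \<beta> b)"
  unfolding smooth_vector_field_def
proof
  fix d assume d: "d \<in> A"
  let ?f = "local_rep A d (localized_field c \<beta> b)"
  show "smooth_on (cimg d) ?f"
  proof (rule smooth_on_local[OF open_cimg[OF d]])
    fix y assume y: "y \<in> cimg d"
    show "\<exists>T. open T \<and> y \<in> T \<and> smooth_on T ?f"
    proof (cases "cinv d y \<in> cdom c")
      case True
      let ?T = "overlap d c" let ?\<tau> = "transition d c"
      have y': "y \<in> ?T" using y True overlap_eq[OF d] by auto
      have acc: "accessible ?T" using open_overlap[OF d c] accessible_open by blast
      have \<tau>: "smooth_on ?T ?\<tau>" by (rule smooth_transition[OF d c])
      have img: "?\<tau> ` ?T \<subseteq> overlap c d" by (auto simp: overlap_def transition_cmap d)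
      have "smooth_on (overlap c d) (\<lambda>x. frechet_derivative (transition c d) (at x) b)"
        by (rule smooth_on_frechet[OF smooth_transition[OF c d] open_overlap[OF c d]])
      then have "smooth_on ?T (\<lambda>z. \<beta> (?\<tau> z) *\<^sub>R frechet_derivative (transition c d) (at (?\<tau> z)) b)"
        by (intro smooth_on_bilinear[OF acc bounded_bilinear_scaleR] smooth_on_compose[OF acc \<tau> \<beta>]
            smooth_on_compose[OF acc \<tau> _ img]) auto
      moreover have "?f z = \<beta> (?\<tau> z) *\<^sub>R frechet_derivative (transition c d) (at (?\<tau> z)) b" if z: "z \<in> ?T" for z
      proof -
        obtain q where q: "q \<in> cdom d" "q \<in> cdom c" "z = cmap d q" using z by (auto simp: overlap_def)
        show ?thesis unfolding q(3) transition_cmap[OF d q(1)]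
          by (rule local_rep_localized_field[OF c d q(2,1)])
      qed
      ultimately have "smooth_on ?T ?f"
        by (subst smooth_on_cong[where g="\<lambda>z. \<beta> (?\<tau> z) *\<^sub>R frechet_derivative (transition c d) (at (?\<tau> z)) b"])
      then show ?thesis using y' open_overlap[OF d c] by blast
    next
      case False
      have "compact (cinv c ` K)"
        by (rule compact_continuous_image[OF continuous_on_subset[OF continuous_cinv[OF c] K(2)] K(1)])
      then have "open (- (cinv c ` K))" using compact_imp_closed open_Compl by blast
      let ?T = "cimg d \<inter> cinv d -` (- (cinv c ` K))"
      have T: "open ?T"
        by (rule continuous_open_preimage[OF continuous_cinv[OF d] open_cimg[OF d]]) fact
      have sub: "cinv c ` K \<subseteq> cdom c" using K(2) cinv_in[OF c] by blast
      then have "y \<in> ?T" using y False by blast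
      moreover have "?f z = 0" if z: "z \<in> ?T" for z
      proof -
        let ?q = "cinv d z"
        have q: "?q \<in> cdom d" using z cinv_in[OF d] by blast
        have "localized_field c \<beta> b ?q = 0"
        proof (cases "?q \<in> cdom c")
          case True
          have "cmap c ?q \<notin> K"
          proof
            assume "cmap c ?q \<in> K"
            then have "cinv c (cmap c ?q) \<in> cinv c ` K" by blast
            then show False using z True by (simp add: cinv_cmap c)
          qed
          then show ?thesis by (simp add: localized_field_def K(3))
        qed (simp add: localized_field_def)
        then show ?thesis using linear_0[OF linear_components[OF d q]] by (simp add: local_rep_def)
      qed
      moreover have "smooth_on ?T (\<lambda>z. 0 :: real^2)" using T accessible_open smooth_on_const by blast
      ultimately have "smooth_on ?T ?f" by (subst smooth_on_cong[where g="\<lambda>z. 0"])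
      then show ?thesis using T \<open>y \<in> ?T\<close> by blast
    qed
  qed
qed

text \<open>Tangent vectors and Lie brackets at \<open>p\<close> are represented in the preferred chart at \<open>p\<close>; so the Kossowski
pseudo-connection of cut-off coordinate fields is evaluated there. As the cut-off function has value
one and derivative zero at \<open>p\<close>, the Lie brackets vanish, and the Christoffel symbols of the first kind
remain.\<close>

lemma admissible_first_kind_chart_at:
  assumes adm: "admissible_point A g p"
  defines "c \<equiv> chart_at A p"
  assumes n: "\<And>w. CM c (cmap c p) n w = 0"
  shows "first_kind_in c (cmap c p) a b n = 0"
proof -
  have c: "c \<in> A" "p \<in> cdom c" unfolding c_def by (rule chart_at)+
  interpret M: metric2_on "cimg c" "CM c" by (rule metric2_on_chart[OF c(1)])
  let ?x = "cmap c p"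
  have x: "?x \<in> cimg c" using c by blast
  then obtain r where r: "r > 0" "cball ?x r \<subseteq> cimg c"
    using open_cimg[OF c(1)] open_contains_cball by blast
  obtain \<beta> :: "real^2 \<Rightarrow> real" where \<beta>: "smooth_on UNIV \<beta>" "\<beta> ?x = 1"
    "(\<beta> has_derivative (\<lambda>_. 0)) (at ?x)" "\<And>z. z \<notin> ball ?x r \<Longrightarrow> \<beta> z = 0"
    using smooth_bump[OF r(1), of ?x] by blast
  let ?V = "localized_field c \<beta>"
  have smooth: "smooth_vector_field A (?V v)" for v
    using smooth_localized_field[OF c(1) \<beta>(1) compact_cball r(2)] \<beta>(4) ball_subset_cball by blast
  have V_p: "?V v p = v" for v
    using tangent_vector_chart_at[of p v] by (simp add: localized_field_def c \<beta>(2) c_def[symmetric])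
  \<comment> \<open>As \<open>\<beta>\<close> is one to first order at \<open>p\<close>, the cut-off does not affect derivatives of inner products there.\<close>
  have D_inner: "dir_deriv A (?V u) (inner_fields g (?V v) (?V w)) p = M.dH ?x u v w" for u v w
  proof -
    have "((\<lambda>z. \<beta> z * \<beta> z * CM c z v w) has_derivative (\<lambda>e. M.dH ?x e v w)) (at ?x)"
      by (rule has_derivative_eq_rhs, rule has_derivative_mult[OF has_derivative_mult[OF \<beta>(3) \<beta>(3)] M.has_derivative_H[OF x]])
         (simp add: \<beta>(2))
    then have "(inner_fields g (?V v) (?V w) \<circ> cinv c has_derivative (\<lambda>e. M.dH ?x e v w)) (at ?x)"
    proof (rule has_derivative_transform_within_open[OF _ open_cimg[OF c(1)] x])
      fix z assume "z \<in> cimg c"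
      then have "cinv c z \<in> cdom c" "cmap c (cinv c z) = z" using cinv_in cmap_cinv c(1) by blast+
      then show "\<beta> z * \<beta> z * CM c z v w = (inner_fields g (?V v) (?V w) \<circ> cinv c) z"
        by (simp add: inner_fields_def localized_field_def chart_metric_def
            linear_cmul[OF linear_g1] linear_cmul[OF linear_g2])
    qed
    from frechet_derivative_atI[OF this] show ?thesis
      by (simp add: dir_deriv_def c_def[symmetric] V_p)
  qed
  have D_rep: "frechet_derivative (local_rep A c (?V v)) (at ?x) e = 0" for v e
  proof -
    have "((\<lambda>z. \<beta> z *\<^sub>R v) has_derivative (\<lambda>e. 0)) (at ?x)"
      using has_derivative_scaleR_left[OF \<beta>(3), of v] by simp
    then have "(local_rep A c (?V v) has_derivative (\<lambda>e. 0)) (at ?x)"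
    proof (rule has_derivative_transform_within_open[OF _ open_cimg[OF c(1)] x])
      fix z assume "z \<in> cimg c"
      then obtain q where q: "q \<in> cdom c" "z = cmap c q" by blast
      show "\<beta> z *\<^sub>R v = local_rep A c (?V v) z"
        unfolding q(2) local_rep_localized_field[OF c(1,1) q(1,1)] jac_same[OF c(1) q(1)] ..
    qed
    from frechet_derivative_atI[OF this] show ?thesis by simp
  qed
  have lie: "lie_bracket A (?V u) (?V v) p = 0" for u v
    by (simp add: lie_bracket_def c_def[symmetric] Let_def D_rep)
  have "n \<in> null_space g p"
  proof -
    have "g p n w = 0" for w
      using n[of w] unfolding chart_metric_cmap[OF c] unfolding c_def tangent_vector_chart_at .
    then show ?thesis by (simp add: null_space_def)
  qed
  then have "kossowski A g (?V a) (?V b) (?V n) p = 0"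
    using adm smooth V_p unfolding admissible_point_def by blast
  then show ?thesis
    by (simp add: kossowski_def D_inner lie inner_fields_def linear_0[OF linear_g1] M.first_kind_def)
qed

text \<open>The inhomogeneous term of the transformation law is an inner product with the null vector, so the
condition carries over from the preferred chart to all others.\<close>

lemma admissible_first_kind:
  assumes adm: "admissible_point A g p" and c: "c \<in> A" "p \<in> cdom c"
    and n: "\<And>w. CM c (cmap c p) n w = 0"
  shows "first_kind_in c (cmap c p) a b n = 0"
proof -
  let ?d = "chart_at A p"
  note d = chart_at[of p]
  interpret T: coordinate_change2 "cimg c" "CM c" "cimg ?d" "CM ?d" "transition c ?d" "overlap c ?d"
    by (rule coordinate_change2_transition[OF c(1) d(1)])
  have x: "cmap c p \<in> overlap c ?d" using c(2) d(2) by (auto simp: overlap_def)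
  have null: "CM ?d (cmap ?d p) (jac c ?d p n) w = 0" for w
    using n[of "jac ?d c p w"] T.pullback[OF x, of n "jac ?d c p w"]
    by (simp add: transition_cmap c jac_inverse[OF d(1) c(1) d(2) c(2)])
  show ?thesis
    unfolding T.first_kind_transform[OF x] transition_cmap[OF c]
    using admissible_first_kind_chart_at[OF adm null] null T.N.sym[of "cmap ?d p"] cmap_in[OF d] by simp
qed

end

section \<open>Curves and their geodesic curvature\<close>

locale surface_curve = psd_surface A g
  for A :: "'m::{t2_space,second_countable_topology} chart set" and g +
  fixes \<gamma> :: "real \<Rightarrow> 'm" and \<epsilon> :: real
  assumes curve: "smooth_curve A {0..<\<epsilon>} \<gamma>" and regular: "regular_curve A {0..<\<epsilon>} \<gamma>"
begin

abbreviation "I \<equiv> {0..<\<epsilon>}"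
abbreviation "vel c \<equiv> coord_velocity c I \<gamma>"

definition coord_acceleration :: "'m chart \<Rightarrow> real \<Rightarrow> real^2" where
  "coord_acceleration c t = vector_derivative (vel c) (at t within I)"

text \<open>A relatively open part of the parameter interval on which the curve stays in the domain of the chart.
One-sided and two-sided derivatives along the curve are then derivatives within this set.\<close>

definition chart_arc :: "'m chart \<Rightarrow> real set \<Rightarrow> bool" where
  "chart_arc c S \<longleftrightarrow> c \<in> A \<and> (\<exists>T. open T \<and> S = I \<inter> T) \<and> \<gamma> ` S \<subseteq> cdom c"

lemma chart_arc_preimage:
  assumes "c \<in> A" "open B" "B \<subseteq> cdom c" shows "chart_arc c (I \<inter> \<gamma> -` B)"
proof -
  have "continuous_on I \<gamma>" using curve unfolding smooth_curve_def by blast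
  then obtain T where "open T" "T \<inter> I = \<gamma> -` B \<inter> I"
    using assms(2) unfolding continuous_on_open_invariant by blast
  then show ?thesis using assms unfolding chart_arc_def by blast
qed

lemma chart_arc_initial:
  assumes "c \<in> A" "\<delta> \<le> \<epsilon>" "\<gamma> ` {0..<\<delta>} \<subseteq> cdom c" shows "chart_arc c {0..<\<delta>}"
proof -
  have "{0..<\<delta>} = I \<inter> {..<\<delta>}" using assms(2) by auto
  then show ?thesis using assms open_lessThan unfolding chart_arc_def by blast
qed

lemma chart_arc_at_within: "chart_arc c S \<Longrightarrow> t \<in> S \<Longrightarrow> at t within S = at t within I"
  unfolding chart_arc_def by (auto intro: at_within_nhd)

lemma at_within_I: "t \<in> I \<Longrightarrow> at t within I \<noteq> bot"
  by (auto simp: trivial_limit_within intro: islimpt_Ico)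

lemma accessible_chart_arc: assumes "chart_arc c S" shows "accessible S"
proof (rule accessible_limpt)
  fix t assume t: "t \<in> S"
  then have "at t within S \<noteq> bot"
    using chart_arc_at_within[OF assms] at_within_I assms unfolding chart_arc_def by auto
  then show "t islimpt S" by (simp add: trivial_limit_within)
qed

lemma smooth_chart_arc: assumes "chart_arc c S" shows "smooth_on S (cmap c \<circ> \<gamma>)"
proof (rule smooth_on_subset[OF _ _ accessible_chart_arc[OF assms]])
  show "smooth_on (I \<inter> \<gamma> -` cdom c) (cmap c \<circ> \<gamma>)" "S \<subseteq> I \<inter> \<gamma> -` cdom c"
    using curve assms unfolding smooth_curve_def chart_arc_def by auto
qed

lemma vel_eq: assumes S: "chart_arc c S" "t \<in> S" shows "vel c t = deriv_on S (cmap c \<circ> \<gamma>) t"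
  unfolding coord_velocity_def chart_arc_at_within[OF S, symmetric]
proof (rule vector_derivative_within)
  show "at t within S \<noteq> bot"
    using chart_arc_at_within[OF S] at_within_I S unfolding chart_arc_def by auto
  show "((cmap c \<circ> \<gamma>) has_vector_derivative deriv_on S (cmap c \<circ> \<gamma>) t) (at t within S)"
    by (rule deriv_on_has_vector_derivative[OF smooth_chart_arc S(2)]) fact
qed

lemma coord_acceleration_eq:
  assumes S: "chart_arc c S" "t \<in> S" shows "coord_acceleration c t = deriv_on S (deriv_on S (cmap c \<circ> \<gamma>)) t"
  unfolding coord_acceleration_def chart_arc_at_within[OF S, symmetric]
proof (rule vector_derivative_within)
  show "at t within S \<noteq> bot"
    using chart_arc_at_within[OF S] at_within_I S unfolding chart_arc_def by auto
  have "(deriv_on S (cmap c \<circ> \<gamma>) has_vector_derivative deriv_on S (deriv_on S (cmap c \<circ> \<gamma>)) t) (at t within S)"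
    by (rule deriv_on_has_vector_derivative[OF smooth_on_deriv_on[OF smooth_chart_arc] S(2)]) fact
  then show "(vel c has_vector_derivative deriv_on S (deriv_on S (cmap c \<circ> \<gamma>)) t) (at t within S)"
    by (rule has_vector_derivative_transform[OF S(2), rotated]) (simp add: vel_eq[OF S(1)])
qed

lemma chart_change_along_curve:
  assumes c: "c \<in> A" and d: "d \<in> A" and t: "t \<in> I" "\<gamma> t \<in> cdom c" "\<gamma> t \<in> cdom d"
  shows "vel d t = jac c d (\<gamma> t) (vel c t)"
    and "coord_acceleration d t = jac c d (\<gamma> t) (coord_acceleration c t) + second_derivative (transition c d) (cmap c (\<gamma> t)) (vel c t) (vel c t)"
proof -
  let ?S = "I \<inter> \<gamma> -` (cdom c \<inter> cdom d)"
  have o: "open (cdom c \<inter> cdom d)" using open_cdom c d by blast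
  have Sc: "chart_arc c ?S" and Sd: "chart_arc d ?S"
    using chart_arc_preimage[OF c o] chart_arc_preimage[OF d o] by auto
  have tS: "t \<in> ?S" using t by auto
  note a = accessible_chart_arc[OF Sc]
  let ?x = "cmap c \<circ> \<gamma>"
  have img: "?x ` ?S \<subseteq> overlap c d" by (auto simp: overlap_def)
  have d_eq: "(cmap d \<circ> \<gamma>) s = transition c d (?x s)" if "s \<in> ?S" for s
    using that by (simp add: transition_cmap c)
  note T = smooth_transition[OF c d] open_overlap[OF c d] smooth_chart_arc[OF Sc] 
  have 1: "deriv_on ?S (cmap d \<circ> \<gamma>) s = deriv_on ?S (\<lambda>s. transition c d (?x s)) s" if "s \<in> ?S" for s
    by (rule deriv_on_cong[OF d_eq that])
  show "vel d t = jac c d (\<gamma> t) (vel c t)"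
    unfolding vel_eq[OF Sc tS] vel_eq[OF Sd tS] 1[OF tS] deriv_on_compose[OF T a img tS] by simp
  have "coord_acceleration d t = deriv_on ?S (deriv_on ?S (\<lambda>s. transition c d (?x s))) t"
    unfolding coord_acceleration_eq[OF Sd tS] by (rule deriv_on_cong[OF 1 tS])
  then show "coord_acceleration d t = jac c d (\<gamma> t) (coord_acceleration c t) + second_derivative (transition c d) (cmap c (\<gamma> t)) (vel c t) (vel c t)"
    unfolding deriv_on_compose2[OF T a img tS] vel_eq[OF Sc tS] coord_acceleration_eq[OF Sc tS] by simp
qed

lemma velocity_eq:
  assumes "c \<in> A" "t \<in> I" "\<gamma> t \<in> cdom c"
  shows "velocity A I \<gamma> t = tangent_vector A c (\<gamma> t) (vel c t)"
  unfolding velocity_def tangent_vector_jac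
  using chart_change_along_curve(1)[OF assms(1) chart_at(1) assms(2,3) chart_at(2)] .

lemma vel_nonzero:
  assumes "c \<in> A" "t \<in> I" "\<gamma> t \<in> cdom c" shows "vel c t \<noteq> 0"
proof -
  have "velocity A I \<gamma> t \<noteq> 0" using regular assms unfolding regular_curve_def by blast
  then show ?thesis
    using velocity_eq[OF assms] linear_0[OF linear_tangent_vector[OF assms(1,3)]] by auto
qed

text \<open>The coefficient of \<open>dt\<close> in the geodesic curvature measure, computed in the chart \<open>c\<close>.\<close>

definition density :: "'m chart \<Rightarrow> real \<Rightarrow> real" where
  "density c t = metric2_on.curvature_density (CM c) (cmap c (\<gamma> t)) (vel c t) (coord_acceleration c t)"

lemma density_chart_change:
  assumes c: "c \<in> A" and d: "d \<in> A" and t: "t \<in> I" "\<gamma> t \<in> cdom c" "\<gamma> t \<in> cdom d"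
  shows "density c t = sgn (det (matrix (jac c d (\<gamma> t)))) * density d t"
proof -
  interpret T: coordinate_change2 "cimg c" "CM c" "cimg d" "CM d" "transition c d" "overlap c d"
    by (rule coordinate_change2_transition[OF c d])
  have x: "cmap c (\<gamma> t) \<in> overlap c d" using t by (auto simp: overlap_def)
  show ?thesis
    unfolding density_def T.curvature_density_transform[OF x] transition_cmap[OF c t(2)]
      chart_change_along_curve[OF c d t] ..
qed

text \<open>Lowering the index turns the Christoffel symbols of the second kind into those of the first kind;
this is the only place where the Gram matrix is inverted.\<close>

lemma christoffel_first_kind:
  assumes c: "c \<in> A" and x: "x \<in> cimg c" and ns: "gram_det (CM c) x \<noteq> 0"
  shows "CM c x (\<chi> k. \<Sum>i\<in>UNIV. \<Sum>j\<in>UNIV. christoffel A g c k i j x * w$i * w$j) n = first_kind_in c x w w n"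
proof -
  interpret M: metric2_on "cimg c" "CM c" by (rule metric2_on_chart[OF c])
  let ?M = "\<chi> a b. coeff A g c a b x" let ?f = "\<chi> l. first_kind_in c x w w (axis l 1)"
  have pd: "partial_deriv i (coeff A g c j l) x = M.dH x (axis i 1) (axis j 1) (axis l 1)" for i j l
    by (simp add: partial_deriv_def M.dH_def coeff_eq)
  have fk: "first_kind_in c x w w (axis l 1) = (\<Sum>i\<in>UNIV. \<Sum>j\<in>UNIV. w$i * w$j *
      (M.dH x (axis i 1) (axis j 1) (axis l 1) + M.dH x (axis j 1) (axis i 1) (axis l 1)
        - M.dH x (axis l 1) (axis i 1) (axis j 1)) / 2)" for l
  proof -
    have "first_kind_in c x w w n = first_kind_in c x (w$1 *\<^sub>R e1 + w$2 *\<^sub>R e2) (w$1 *\<^sub>R e1 + w$2 *\<^sub>R e2) n" for n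
      using vec2_expand by metis
    note this[of "axis l 1"]
    also have "first_kind_in c x (w$1 *\<^sub>R e1 + w$2 *\<^sub>R e2) (w$1 *\<^sub>R e1 + w$2 *\<^sub>R e2) (axis l 1) =
      (\<Sum>i\<in>UNIV. \<Sum>j\<in>UNIV. w$i * w$j *
        (M.dH x (axis i 1) (axis j 1) (axis l 1) + M.dH x (axis j 1) (axis i 1) (axis l 1)
          - M.dH x (axis l 1) (axis i 1) (axis j 1)) / 2)"
      by (simp add: M.first_kind_def M.dH_simps x sum_2 M.dH_sym[OF x, of _ "axis l 1" e1]
          M.dH_sym[OF x, of _ "axis l 1" e2] M.dH_sym[OF x, of _ e2 e1] field_simps)
    finally show ?thesis .
  qed
  have v: "(\<chi> k. \<Sum>i\<in>UNIV. \<Sum>j\<in>UNIV. christoffel A g c k i j x * w$i * w$j) = matrix_inv ?M *v ?f"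
    unfolding vec_eq_iff
  proof
    fix k
    show "(\<chi> k. \<Sum>i\<in>UNIV. \<Sum>j\<in>UNIV. christoffel A g c k i j x * w$i * w$j) $ k = (matrix_inv ?M *v ?f) $ k"
      unfolding matrix_vector_mult_def christoffel_def pd by (simp add: fk sum_2 field_simps)
  qed
  have "det ?M = gram_det (CM c) x"
    by (simp add: det_2 coeff_eq gram_det_def power2_eq_square M.sym[OF x, of e2 e1])
  then have "invertible ?M" using ns by (simp add: invertible_det_nz)
  then have "?M ** matrix_inv ?M = mat 1"
    unfolding invertible_def matrix_inv_def by (rule someI2_ex) simp
  then have Mf: "?M *v (matrix_inv ?M *v ?f) = ?f"
    by (simp add: matrix_vector_mul_assoc)
  have H: "CM c x v n = (?M *v v)$1 * n$1 + (?M *v v)$2 * n$2" for v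
    unfolding M.H_components[OF x, of v] 
    by (simp add: matrix_vector_mult_def sum_2 coeff_eq M.sym[OF x, of e2 e1] algebra_simps)
  have "first_kind_in c x w w n = first_kind_in c x w w (n$1 *\<^sub>R e1 + n$2 *\<^sub>R e2)" using vec2_expand by metis
  then have "first_kind_in c x w w n = ?f$1 * n$1 + ?f$2 * n$2"
    by (simp add: linear_add[OF M.linear_first_kind[OF x]] linear_cmul[OF M.linear_first_kind[OF x]])
  then show ?thesis unfolding v H Mf by simp
qed

lemma curvature_measure_eq_density:
  assumes c: "C t \<in> A" and t: "t \<in> I" "\<gamma> t \<in> cdom (C t)" and ns: "\<not> singular_point g (\<gamma> t)"
  shows "geodesic_curvature_measure A g C I \<gamma> t = density (C t) t"
proof -
  let ?c = "C t"
  interpret M: metric2_on "cimg ?c" "CM ?c" by (rule metric2_on_chart[OF c])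
  let ?x = "cmap ?c (\<gamma> t)" let ?w = "vel ?c t" let ?L = "tangent_vector A ?c (\<gamma> t)"
  have x: "?x \<in> cimg ?c" using t by blast
  have ns': "gram_det (CM ?c) ?x \<noteq> 0" using ns singular_point_iff[OF c t(2)] by blast
  have lin: "linear ?L" using linear_tangent_vector[OF c t(2)] .
  define \<Gamma> where "\<Gamma> = (\<chi> k. \<Sum>i\<in>UNIV. \<Sum>j\<in>UNIV. christoffel A g ?c k i j ?x * ?w$i * ?w$j)"
  have accel: "acceleration A g ?c I \<gamma> t = ?L (coord_acceleration ?c t + \<Gamma>)"
    by (simp add: acceleration_def Let_def coord_acceleration_def \<Gamma>_def plus_vec_def)
  have defect: "CM ?c ?x (coord_acceleration ?c t + \<Gamma>) n = M.geodesic_defect ?x ?w (coord_acceleration ?c t) n" for n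
    unfolding M.geodesic_defect_def \<Gamma>_def
    by (simp add: M.H_simps x christoffel_first_kind[OF c x ns'])
  define Q where "Q = CM ?c ?x ?w ?w"
  have Q: "(?w$1)\<^sup>2 * coeff A g ?c 1 1 ?x + 2 * ?w$1 * ?w$2 * coeff A g ?c 1 2 ?x + (?w$2)\<^sup>2 * coeff A g ?c 2 2 ?x = Q"
    unfolding Q_def M.H_components[OF x, of ?w] coeff_eq by (simp add: power2_eq_square algebra_simps)
  have normal: "unit_normal A g ?c I \<gamma> t =
      (1 / (sqrt (gram_det (CM ?c) ?x) * sqrt Q)) *\<^sub>R ?L (conormal (CM ?c) ?x ?w)"
  proof -
    have "conormal (CM ?c) ?x ?w =
      - (?w$1 * coeff A g ?c 1 2 ?x + ?w$2 * coeff A g ?c 2 2 ?x) *\<^sub>R e1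
      + (?w$1 * coeff A g ?c 1 1 ?x + ?w$2 * coeff A g ?c 1 2 ?x) *\<^sub>R e2"
      unfolding conormal_def M.H_components[OF x, of ?w] coeff_eq by simp
    then have "?L (conormal (CM ?c) ?x ?w) =
      - (?w$1 * coeff A g ?c 1 2 ?x + ?w$2 * coeff A g ?c 2 2 ?x) *\<^sub>R coord_vector A ?c 1 (\<gamma> t)
      + (?w$1 * coeff A g ?c 1 1 ?x + ?w$2 * coeff A g ?c 1 2 ?x) *\<^sub>R coord_vector A ?c 2 (\<gamma> t)"
      by (simp only: linear_add[OF lin] linear_cmul[OF lin] coord_vector_def)
    then show ?thesis
      unfolding unit_normal_def Let_def Q by (simp only: gram_det_def coeff_eq)
  qed
  have speed: "speed A g I \<gamma> t = sqrt Q"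
    unfolding speed_def velocity_eq[OF c t] chart_metric_cmap[OF c t(2), symmetric] Q_def ..
  have gL: "g (\<gamma> t) (?L a) (?L b) = CM ?c ?x a b" for a b by (rule chart_metric_cmap[OF c t(2), symmetric])
  have Qn: "Q \<ge> 0" unfolding Q_def by (rule M.psd[OF x])
  show ?thesis
    unfolding geodesic_curvature_measure_def geodesic_curvature_def accel normal speed density_def
      M.curvature_density_def linear_cmul[OF linear_g2] gL defect
    using Qn by (cases "Q = 0") (auto simp: Q_def[symmetric] field_simps power2_eq_square)
qed

text \<open>At nonsingular points the metric is definite, so neither the Gram determinant nor the speed of the regular
curve vanishes; the density is then a quotient of continuous functions.\<close>

lemma continuous_on_density:
  assumes c: "c \<in> A"
  shows "continuous_on {t \<in> I. \<gamma> t \<in> cdom c \<and> \<not> singular_point g (\<gamma> t)} (density c)"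
proof -
  interpret M: metric2_on "cimg c" "CM c" by (rule metric2_on_chart[OF c])
  let ?S = "I \<inter> \<gamma> -` cdom c"
  have S: "chart_arc c ?S" by (rule chart_arc_preimage[OF c open_cdom[OF c] order_refl])
  note a = accessible_chart_arc[OF S]
  let ?x = "cmap c \<circ> \<gamma>" let ?w = "deriv_on ?S ?x" let ?z = "deriv_on ?S ?w"
  have sx: "smooth_on ?S ?x" by (rule smooth_chart_arc[OF S])
  note sw = smooth_on_deriv_on[OF sx]
  note sz = smooth_on_deriv_on[OF sw]
  have img: "?x ` ?S \<subseteq> cimg c" by auto
  let ?T = "{t \<in> I. \<gamma> t \<in> cdom c \<and> \<not> singular_point g (\<gamma> t)}"
  have sub: "?T \<subseteq> ?S" by auto
  note cont = continuous_on_subset[OF smooth_on_imp_continuous_on sub]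
  note sH = M.smooth_on_H_along[OF a sx img]
  note conts = cont[OF sH(1)] cont[OF sH(2)] cont[OF smooth_on_nth[OF a sw]] cont[OF smooth_on_nth[OF a sz]]
  have eq: "density c t = M.geodesic_defect (?x t) (?w t) (?z t) (conormal (CM c) (?x t) (?w t)) /
     (sqrt (gram_det (CM c) (?x t)) * CM c (?x t) (?w t) (?w t))" if "t \<in> ?T" for t
    using that vel_eq[OF S, of t] coord_acceleration_eq[OF S, of t] by (simp add: density_def M.curvature_density_def)
  have nonzero: "sqrt (gram_det (CM c) (?x t)) * CM c (?x t) (?w t) (?w t) \<noteq> 0" if t: "t \<in> ?T" for t
  proof -
    have x: "?x t \<in> cimg c" using t by auto
    have gd: "gram_det (CM c) (?x t) \<noteq> 0" using t singular_point_iff[OF c, of "\<gamma> t"] by simp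
    have w: "?w t \<noteq> 0" using vel_nonzero[OF c, of t] vel_eq[OF S, of t] t by simp
    have "CM c (?x t) (?w t) (?w t) \<noteq> 0"
      using M.psd_null[OF x] M.gram_det_eq_0_if_null_vector[OF x w] gd by blast
    then show ?thesis using gd by simp
  qed
  define E where "E t = CM c (?x t) e1 e1" for t
  define F where "F t = CM c (?x t) e1 e2" for t
  define G where "G t = CM c (?x t) e2 e2" for t
  define Eu where "Eu t = M.dH (?x t) e1 e1 e1" for t
  define Ev where "Ev t = M.dH (?x t) e2 e1 e1" for t
  define Fu where "Fu t = M.dH (?x t) e1 e1 e2" for t
  define Fv where "Fv t = M.dH (?x t) e2 e1 e2" for t
  define Gu where "Gu t = M.dH (?x t) e1 e2 e2" for t
  define Gv where "Gv t = M.dH (?x t) e2 e2 e2" for t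
  define u where "u t = ?w t $ 1" for t
  define v where "v t = ?w t $ 2" for t
  define u2 where "u2 t = ?z t $ 1" for t
  define v2 where "v2 t = ?z t $ 2" for t
  note defs = E_def F_def G_def Eu_def Ev_def Fu_def Fv_def Gu_def Gv_def u_def v_def u2_def v2_def
  have atoms: "continuous_on ?T E" "continuous_on ?T F" "continuous_on ?T G" "continuous_on ?T Eu"
    "continuous_on ?T Ev" "continuous_on ?T Fu" "continuous_on ?T Fv" "continuous_on ?T Gu" "continuous_on ?T Gv"
    "continuous_on ?T u" "continuous_on ?T v" "continuous_on ?T u2" "continuous_on ?T v2"
    unfolding E_def[abs_def] F_def[abs_def] G_def[abs_def] Eu_def[abs_def] Ev_def[abs_def] Fu_def[abs_def]
      Fv_def[abs_def] Gu_def[abs_def] Gv_def[abs_def] u_def[abs_def] v_def[abs_def] u2_def[abs_def] v2_def[abs_def]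
    by (rule conts)+
  define num where "num t = (E t * G t - (F t)\<^sup>2) * (u t * v2 t - v t * u2 t)
      + (- (F t * u t + G t * v t)) * (Eu t * (u t)\<^sup>2 / 2 + Ev t * u t * v t + (Fv t - Gu t / 2) * (v t)\<^sup>2)
      + (E t * u t + F t * v t) * ((Fu t - Ev t / 2) * (u t)\<^sup>2 + Gu t * u t * v t + Gv t * (v t)\<^sup>2 / 2)" for t
  define den where "den t = sqrt (E t * G t - (F t)\<^sup>2) *
      (u t * u t * E t + (u t * v t + v t * u t) * F t + v t * v t * G t)" for t
  have den: "den t = sqrt (gram_det (CM c) (?x t)) * CM c (?x t) (?w t) (?w t)" if t: "t \<in> ?T" for t
  proof -
    have x: "?x t \<in> cimg c" using t by auto
    show ?thesis unfolding den_def gram_det_def M.H_components[OF x, of "?w t"] defs ..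
  qed
  have num: "num t = M.geodesic_defect (?x t) (?w t) (?z t) (conormal (CM c) (?x t) (?w t))" if t: "t \<in> ?T" for t
  proof -
    have x: "?x t \<in> cimg c" using t by auto
    show ?thesis unfolding num_def M.geodesic_defect_conormal[OF x] defs ..
  qed
  have "continuous_on ?T num" "continuous_on ?T den"
    unfolding num_def[abs_def] den_def[abs_def] by (intro continuous_intros atoms; simp)+
  then have "continuous_on ?T (\<lambda>t. num t / den t)"
    by (rule continuous_on_divide) (use den nonzero in auto)
  moreover have "density c t = num t / den t" if t: "t \<in> ?T" for t
    unfolding eq[OF t] num[OF t] den[OF t] ..
  ultimately show ?thesis by (metis (no_types, lifting) continuous_on_cong)
qed

end

section \<open>Continuity up to the cross cap\<close>

context surface_curve begin

lemma initial_segment_in_open: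
  assumes "open B" "\<gamma> 0 \<in> B" "0 < \<epsilon>"
  obtains \<delta> where "0 < \<delta>" "\<delta> \<le> \<epsilon>" "\<gamma> ` {0..<\<delta>} \<subseteq> B"
proof -
  have "continuous_on I \<gamma>" using curve unfolding smooth_curve_def by blast
  then obtain T where T: "open T" "T \<inter> I = \<gamma> -` B \<inter> I"
    using assms(1) unfolding continuous_on_open_invariant by blast
  then have "0 \<in> T" using assms by auto
  then obtain r where r: "r > 0" "ball 0 r \<subseteq> T" using T(1) openE by blast
  have "{0..<min r \<epsilon>} \<subseteq> T \<inter> I" using r(2) by (auto simp: subset_iff dist_real_def)
  then have "\<gamma> ` {0..<min r \<epsilon>} \<subseteq> B" using T(2) by auto
  then show ?thesis using that[of "min r \<epsilon>"] r(1) assms(3) by simp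
qed

text \<open>An initial piece of the curve lies in the chart, and there the coordinate result applies.\<close>

lemma density_converges:
  assumes c: "c \<in> A" "\<gamma> 0 \<in> cdom c" and \<epsilon>: "0 < \<epsilon>"
    and sing: "singular_point g (\<gamma> 0)" and adm: "admissible_point A g (\<gamma> 0)"
    and hess: "let h = second_derivative (gram_det (CM c)) (cmap c (\<gamma> 0))
        in h e1 e1 * h e2 e2 - (h e2 e1)\<^sup>2 \<noteq> 0"
  shows "\<exists>L. (density c \<longlongrightarrow> L) (at_right 0)"
    and "\<forall>\<^sub>F t in at_right 0. \<not> singular_point g (\<gamma> t)"
proof -
  interpret M: metric2_on "cimg c" "CM c" by (rule metric2_on_chart[OF c(1)])
  obtain \<delta> where \<delta>: "0 < \<delta>" "\<delta> \<le> \<epsilon>" "\<gamma> ` {0..<\<delta>} \<subseteq> cdom c"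
    using initial_segment_in_open[OF open_cdom[OF c(1)] c(2) \<epsilon>] .
  have S: "chart_arc c {0..<\<delta>}" by (rule chart_arc_initial[OF c(1) \<delta>(2,3)])
  let ?x = "cmap c \<circ> \<gamma>" let ?D = "deriv_on {0..<\<delta>}"
  have x0: "cmap c (\<gamma> 0) \<in> cimg c" "gram_det (CM c) (cmap c (\<gamma> 0)) = 0"
    using c sing singular_point_iff by auto
  have "vel c 0 \<noteq> 0" using vel_nonzero[OF c(1) _ c(2)] \<epsilon> by simp
  then have v0: "?D ?x 0 \<noteq> 0" using vel_eq[OF S, of 0] \<delta>(1) by simp
  have img: "?x ` {0..<\<delta>} \<subseteq> cimg c" using \<delta>(3) by auto
  have h: "second_derivative (gram_det (CM c)) (cmap c (\<gamma> 0)) e1 e1 * second_derivative (gram_det (CM c)) (cmap c (\<gamma> 0)) e2 e2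
      - (second_derivative (gram_det (CM c)) (cmap c (\<gamma> 0)) e2 e1)\<^sup>2 \<noteq> 0"
    using hess by (simp add: Let_def)
  have start: "?x 0 = cmap c (\<gamma> 0)" by simp
  have "\<exists>L. ((\<lambda>t. M.curvature_density (?x t) (?D ?x t) (?D (?D ?x) t)) \<longlongrightarrow> L) (at_right 0)"
    by (rule M.curvature_density_converges(1)[OF x0 h _ \<delta>(1) smooth_chart_arc[OF S] img start v0])
       (rule admissible_first_kind[OF adm c])
  then obtain L where L: "((\<lambda>t. M.curvature_density (?x t) (?D ?x t) (?D (?D ?x) t)) \<longlongrightarrow> L) (at_right 0)"
    by blast
  have pos: "\<forall>\<^sub>F t in at_right 0. gram_det (CM c) (?x t) > 0"
    by (rule M.curvature_density_converges(2)[OF x0 h _ \<delta>(1) smooth_chart_arc[OF S] img start v0])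
       (rule admissible_first_kind[OF adm c])
  have "\<forall>\<^sub>F t in at_right 0. M.curvature_density (?x t) (?D ?x t) (?D (?D ?x) t) = density c t"
    using eventually_at_right_0_less[OF \<delta>(1)]
  proof eventually_elim
    case (elim t)
    then have t: "t \<in> {0..<\<delta>}" by simp
    show ?case unfolding density_def vel_eq[OF S t] coord_acceleration_eq[OF S t] by simp
  qed
  from Lim_transform_eventually[OF L this] show "\<exists>L. (density c \<longlongrightarrow> L) (at_right 0)" by blast
  show "\<forall>\<^sub>F t in at_right 0. \<not> singular_point g (\<gamma> t)"
    using pos eventually_at_right_0_less[OF \<delta>(1)]
  proof eventually_elim
    case (elim t)
    then have "t \<in> {0..<\<delta>}" by simp
    then have "\<gamma> t \<in> cdom c" using \<delta>(3) by blast
    then show ?case using singular_point_iff[OF c(1)] elim(1) by auto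
  qed
qed

text \<open>The chart in which the Hessian is nondegenerate need not be the one chosen along the curve. The
densities differ by the sign of a Jacobian that is continuous and nonzero up to \<open>t = 0\<close>.\<close>

lemma density_converges_in_any_chart:
  assumes c: "c \<in> A" "\<gamma> 0 \<in> cdom c" and d: "d \<in> A" "\<gamma> 0 \<in> cdom d" and \<epsilon>: "0 < \<epsilon>"
    and L: "(density c \<longlongrightarrow> L) (at_right 0)"
  shows "\<exists>L. (density d \<longlongrightarrow> L) (at_right 0)"
proof -
  have o: "open (cdom d \<inter> cdom c)" "\<gamma> 0 \<in> cdom d \<inter> cdom c" 
    using c d by (simp_all add: open_cdom[OF c(1)] open_cdom[OF d(1)] open_Int)
  obtain \<delta> where \<delta>: "0 < \<delta>" "\<delta> \<le> \<epsilon>" "\<gamma> ` {0..<\<delta>} \<subseteq> cdom d \<inter> cdom c"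
    using initial_segment_in_open[OF o \<epsilon>] .
  have S: "chart_arc d {0..<\<delta>}" using \<delta>(3) by (intro chart_arc_initial[OF d(1) \<delta>(2)]) auto
  let ?\<Delta> = "\<lambda>t. det (matrix (jac d c (\<gamma> t)))"
  have img: "(cmap d \<circ> \<gamma>) ` {0..<\<delta>} \<subseteq> overlap d c" using \<delta>(3) by (auto simp: overlap_def)
  note a = accessible_half_open[of \<delta>]
  have "smooth_on {0..<\<delta>} (\<lambda>t. frechet_derivative (transition d c) (at ((cmap d \<circ> \<gamma>) t)) v)" for v
    by (rule smooth_on_compose[OF a smooth_chart_arc[OF S] smooth_on_frechet[OF smooth_transition[OF d(1) c(1)]
          open_overlap[OF d(1) c(1)]] img])
  then have "smooth_on {0..<\<delta>} (\<lambda>t. jac d c (\<gamma> t) v $ i)" for v i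
    by (intro smooth_on_nth[OF a]) simp
  then have "smooth_on {0..<\<delta>} ?\<Delta>"
    unfolding det_2 matrix_def by (simp add: smooth_on_diff smooth_on_mult a)
  from smooth_on_tendsto_0[OF this \<delta>(1)] have "(?\<Delta> \<longlongrightarrow> ?\<Delta> 0) (at_right 0)" .
  then have "((\<lambda>t. sgn (?\<Delta> t) * density c t) \<longlongrightarrow> sgn (?\<Delta> 0) * L) (at_right 0)"
    using det_jac_nonzero[OF d(1) c(1) d(2) c(2)] by (intro tendsto_mult tendsto_sgn L)
  moreover have "\<forall>\<^sub>F t in at_right 0. sgn (?\<Delta> t) * density c t = density d t"
    using eventually_at_right_0_less[OF \<delta>(1)]
  proof eventually_elim
    case (elim t)
    then have "t \<in> {0..<\<delta>}" "t \<in> I" using \<delta>(2) by auto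
    moreover from this have "\<gamma> t \<in> cdom d" "\<gamma> t \<in> cdom c" using \<delta>(3) by blast+
    ultimately show ?case using density_chart_change[OF d(1) c(1)] by simp
  qed
  ultimately show ?thesis by (blast intro: Lim_transform_eventually)
qed

text \<open>Near \<open>t\<close>, the varying chart \<open>C s\<close> may be replaced by \<open>C t\<close>, since the transition maps have positive Jacobian.\<close>

lemma curvature_measure_eventually_eq:
  assumes C: "coherent_charts A I \<gamma> C" and t: "t \<in> I"
  shows "\<forall>\<^sub>F s in at t within I. s \<in> I \<longrightarrow> \<not> singular_point g (\<gamma> s) \<longrightarrow>
    geodesic_curvature_measure A g C I \<gamma> s = density (C t) s"
proof -
  have "\<forall>\<^sub>F s in at t within I. \<gamma> s \<in> cdom (C t) \<and> 0 < det (matrix (jac (C s) (C t) (\<gamma> s)))"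
    using C t unfolding coherent_charts_def by blast
  then show ?thesis
  proof eventually_elim
    case (elim s)
    show ?case
    proof (intro impI)
      assume s: "s \<in> I" and ns: "\<not> singular_point g (\<gamma> s)"
      have CA: "C s \<in> A" "\<gamma> s \<in> cdom (C s)" "C t \<in> A" using C s t unfolding coherent_charts_def by blast+
      show "geodesic_curvature_measure A g C I \<gamma> s = density (C t) s"
        unfolding curvature_measure_eq_density[of C s, OF CA(1) s CA(2) ns]
        using density_chart_change[OF CA(1,3) s CA(2)] elim by simp
    qed
  qed
qed

text \<open>Away from \<open>0\<close> the measure agrees locally with the density in one chart; at \<open>0\<close> it is extended by the
limit.\<close>

lemma curvature_measure_extends_continuously:
  assumes \<epsilon>: "0 < \<epsilon>" and C: "coherent_charts A I \<gamma> C"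
    and L: "(density (C 0) \<longlongrightarrow> L) (at_right 0)"
    and ns: "\<forall>\<^sub>F t in at_right 0. \<not> singular_point g (\<gamma> t)"
  shows "continuous_on ({0} \<union> {t \<in> {0<..<\<epsilon>}. \<not> singular_point g (\<gamma> t)})
    (\<lambda>t. if t = 0 then L else geodesic_curvature_measure A g C I \<gamma> t)" (is "continuous_on ?Z ?\<omega>")
  unfolding continuous_on
proof
  fix t assume t: "t \<in> ?Z"
  have tI: "t \<in> I" using t \<epsilon> by auto
  note eq = curvature_measure_eventually_eq[OF C tI]
  have ZI: "?Z \<subseteq> I" using \<epsilon> by auto
  show "(?\<omega> \<longlongrightarrow> ?\<omega> t) (at t within ?Z)"
  proof (cases "t = 0")
    case True
    have "at_right 0 \<le> at 0 within {0::real..}" by (rule at_le) auto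
    also have "at 0 within {0::real..} = at 0 within I"
      by (rule at_within_nhd[where S="{..<\<epsilon>}"]) (use \<epsilon> in auto)
    finally have "at_right 0 \<le> at t within I" using True by simp
    from filter_leD[OF this eq]
    have "\<forall>\<^sub>F s in at_right 0. s \<in> I \<longrightarrow> \<not> singular_point g (\<gamma> s) \<longrightarrow>
        geodesic_curvature_measure A g C I \<gamma> s = density (C 0) s"
      using True by simp
    then have "\<forall>\<^sub>F s in at_right 0. density (C 0) s = ?\<omega> s"
      using ns eventually_at_right_0_less[OF \<epsilon>] by eventually_elim auto
    then have "(?\<omega> \<longlongrightarrow> L) (at_right 0)" by (rule Lim_transform_eventually[OF L])
    moreover have "at 0 within ?Z \<le> at_right 0"
    proof -
      have "at 0 within ?Z = at 0 within (?Z - {0})"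
        by (rule at_within_nhd[where S=UNIV]) auto
      also have "\<dots> \<le> at_right 0" by (rule at_le) auto
      finally show ?thesis .
    qed
    ultimately show ?thesis using True tendsto_mono by auto
  next
    case False
    let ?c = "C t"
    have c: "?c \<in> A" "\<gamma> t \<in> cdom ?c" using C tI unfolding coherent_charts_def by blast+
    have tns: "\<not> singular_point g (\<gamma> t)" and t0: "0 < t" "t < \<epsilon>" using t False by auto
    let ?T = "{s \<in> I. \<gamma> s \<in> cdom ?c \<and> \<not> singular_point g (\<gamma> s)}"
    have tT: "t \<in> ?T" using tI c(2) tns by simp
    obtain T where T: "open T" "I \<inter> \<gamma> -` cdom ?c = I \<inter> T"
      using chart_arc_preimage[OF c(1) open_cdom[OF c(1)] order_refl] unfolding chart_arc_def by blast
    have Teq: "s \<in> T \<longleftrightarrow> \<gamma> s \<in> cdom ?c" if "s \<in> I" for s using T(2) that by blast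
    \<comment> \<open>Near \<open>t > 0\<close> the set in question consists of the nonsingular parameters in one chart arc.\<close>
    have "at t within ?Z = at t within ?T"
    proof (rule at_within_nhd)
      show "t \<in> T \<inter> {0<..}" using Teq[OF tI] c(2) t0 by simp
      show "open (T \<inter> {0<..})" using T(1) by auto
      show "?Z \<inter> (T \<inter> {0<..}) - {t} = ?T \<inter> (T \<inter> {0<..}) - {t}" using Teq by auto
    qed
    moreover have "(density ?c \<longlongrightarrow> density ?c t) (at t within ?T)"
      using continuous_on_density[OF c(1)] tT unfolding continuous_on by blast
    ultimately have lim: "(density ?c \<longlongrightarrow> density ?c t) (at t within ?Z)" by simp
    have "\<forall>\<^sub>F s in at t within ?Z. s \<in> I \<longrightarrow> \<not> singular_point g (\<gamma> s) \<longrightarrow>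
        geodesic_curvature_measure A g C I \<gamma> s = density ?c s"
      using eq filter_leD[OF at_le[OF ZI]] by blast
    moreover have "\<forall>\<^sub>F s in at t within ?Z. s \<in> ?Z" by (simp add: eventually_at_filter)
    moreover have "\<forall>\<^sub>F s in at t within ?Z. s \<noteq> 0"
      using tendsto_imp_eventually_ne[OF tendsto_ident_at False] .
    ultimately have "\<forall>\<^sub>F s in at t within ?Z. density ?c s = ?\<omega> s"
      by eventually_elim auto
    from Lim_transform_eventually[OF lim this]
    show ?thesis using curvature_measure_eq_density[of C t, OF c(1) tI c(2) tns] False by simp
  qed
qed

end

theorem theorem3p1:
  fixes A :: "'m::{t2_space,second_countable_topology} chart set"
    and g :: "'m metric_tensor"
    and p :: 'm
    and \<gamma> :: "real \<Rightarrow> 'm"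
    and \<epsilon> :: real
    and C :: "real \<Rightarrow> 'm chart"
  assumes "smooth_structure A"
    and "admissible_metric A g"
    and "intrinsic_cross_cap A g p"
    and "0 < \<epsilon>"
    and "smooth_curve A {0..<\<epsilon>} \<gamma>"
    and "regular_curve A {0..<\<epsilon>} \<gamma>"
    and "\<gamma> 0 = p"
    and "coherent_charts A {0..<\<epsilon>} \<gamma> C"
  shows "(\<exists>\<delta>>0. \<delta> \<le> \<epsilon> \<and> (\<forall>t\<in>{0<..<\<delta>}. \<not> singular_point g (\<gamma> t))) \<and>
    (\<exists>\<omega>. continuous_on ({0} \<union> {t \<in> {0<..<\<epsilon>}. \<not> singular_point g (\<gamma> t)}) \<omega> \<and>
         (\<forall>t\<in>{0<..<\<epsilon>}. \<not> singular_point g (\<gamma> t) \<longrightarrow>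
            \<omega> t = geodesic_curvature_measure A g C {0..<\<epsilon>} \<gamma> t))"
proof -
  interpret surface_curve A g \<gamma> \<epsilon>
    using assms(1,2,5,6) unfolding admissible_metric_def by unfold_locales auto
  have sing: "singular_point g (\<gamma> 0)" using assms(3,7) by (simp add: intrinsic_cross_cap_def)
  have adm: "admissible_point A g (\<gamma> 0)" using assms(2) sing by (simp add: admissible_metric_def)
  obtain c where c: "c \<in> A" "\<gamma> 0 \<in> cdom c" "cmap c (\<gamma> 0) = 0"
    and "det (vector [vector [partial_deriv 1 (partial_deriv 1 (lam A g c)) 0, partial_deriv 2 (partial_deriv 1 (lam A g c)) 0],
       vector [partial_deriv 2 (partial_deriv 1 (lam A g c)) 0, partial_deriv 2 (partial_deriv 2 (lam A g c)) 0]] :: real^2^2) \<noteq> 0"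
    using assms(3,7) unfolding intrinsic_cross_cap_def Let_def by blast
  then have hess: "let h = second_derivative (gram_det (CM c)) (cmap c (\<gamma> 0))
        in h e1 e1 * h e2 e2 - (h e2 e1)\<^sup>2 \<noteq> 0"
    by (simp add: det_2 lam_eq partial_deriv_def[abs_def] second_derivative_def Let_def c(3) power2_eq_square)
  obtain L where "(density c \<longlongrightarrow> L) (at_right 0)"
    using density_converges(1)[OF c(1,2) assms(4) sing adm hess] by blast
  moreover have C0: "C 0 \<in> A" "\<gamma> 0 \<in> cdom (C 0)"
    using assms(4,8) unfolding coherent_charts_def by auto
  ultimately obtain L' where L': "(density (C 0) \<longlongrightarrow> L') (at_right 0)"
    using density_converges_in_any_chart[OF c(1,2) C0 assms(4)] by blast
  note ns = density_converges(2)[OF c(1,2) assms(4) sing adm hess]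
  obtain b where b: "b > 0" "\<And>t. 0 < t \<Longrightarrow> t < b \<Longrightarrow> \<not> singular_point g (\<gamma> t)"
    using ns unfolding eventually_at_right_field by blast
  have "\<exists>\<delta>>0. \<delta> \<le> \<epsilon> \<and> (\<forall>t\<in>{0<..<\<delta>}. \<not> singular_point g (\<gamma> t))"
    using b assms(4) by (intro exI[of _ "min b \<epsilon>"]) auto
  moreover have "\<forall>t\<in>{0<..<\<epsilon>}. \<not> singular_point g (\<gamma> t) \<longrightarrow>
      (if t = 0 then L' else geodesic_curvature_measure A g C {0..<\<epsilon>} \<gamma> t) =
      geodesic_curvature_measure A g C {0..<\<epsilon>} \<gamma> t" by simp
  ultimately show ?thesis
    using curvature_measure_extends_continuously[OF assms(4,8) L' ns] by blast
qed

end
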